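(* Let $c\in\mathbb R$. There exist constants $\epsilon_0>0$, $C>0$ such that the following holds: if $s\in[\tfrac32,2)$ and $(u_0,v_0)\in H^s_0(\mathbb T,\mathbb R)\times H^{s-1}_0(\mathbb T,\mathbb R)$ satisfies $\|u_0\|_s+\|v_0\|_{s-1}\le\epsilon_0$, then the equation $$\partial_{tt}u-\Big(\frac{1}{1+c\int_{\mathbb T}|\partial_x u|^2dx}\Big)^2\partial_{xx}u=0$$ with initial data $u(0,\cdot)=u_0$, $\partial_tu(0,\cdot)=v_0$ admits a unique solution $u\in C^0([0,T],H^s(\mathbb T,\mathbb R))\cap C^1([0,T],H^{s-1}(\mathbb T,\mathbb R))$ with $$T\sim(\|u_0\|_s+\|v_0\|_{s-1})^{-6}$$ and $$\max_{t\in[0,T]}\big(\|u(t)\|_s+\|\partial_tu(t)\|_{s-1}\big)\le C\big(\|u_0\|_s+\|v_0\|_{s-1}\big).$$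
   Context: $\mathbb T=\mathbb R/2\pi\mathbb Z$, $u=(2\pi)^{-1/2}\sum_{k\in\mathbb Z}u_ke^{ikx}$. $H^s(\mathbb T,\mathbb R)$ is the Sobolev space of real-valued functions, and $H^s_0(\mathbb T,\mathbb R)$ its subspace of zero-mean functions, on which $\|u\|_s^2=\sum_{j\ne0}|j|^{2s}|u_j|^2$. The notation $T\sim A$ means that $T$ is comparable to $A$ up to positive multiplicative constants independent of the data (for zero data any $T$ is allowed). *)

theory Defs
  imports "HOL-Analysis.Analysis"
begin

text \<open>
  Functions on the circle are \<open>2 * pi\<close>-periodic functions on the real line, and
  elements of Lebesgue and Sobolev spaces are representatives, so that equality in those
  spaces is equality almost everywhere.
\<close>

definition L2_circle :: "(real \<Rightarrow> real) set" where
  "L2_circle = {f. (\<forall>x. f (x + 2 * pi) = f x) \<and> f \<in> borel_measurable borel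
      \<and> set_integrable lborel {0..2 * pi} (\<lambda>x. (f x)\<^sup>2)}"

definition circle_pairing :: "(real \<Rightarrow> real) \<Rightarrow> (real \<Rightarrow> real) \<Rightarrow> real" where
  "circle_pairing f g = (LBINT x:{0..2 * pi}. f x * g x)"

definition fourier_coeff :: "(real \<Rightarrow> real) \<Rightarrow> int \<Rightarrow> complex" where
  "fourier_coeff f k =
     (LBINT x:{0..2 * pi}. complex_of_real (f x) * exp (- \<i> * of_int k * of_real x))
       / of_real (sqrt (2 * pi))"

text \<open>
  The space \<open>sobolev s\<close> is \<open>H\<^sup>s\<close> only for \<open>s \<ge> 0\<close>, where its elements are
  functions in \<open>L\<^sup>2\<close>.
\<close>

definition sobolev :: "real \<Rightarrow> (real \<Rightarrow> real) set" where
  "sobolev s = {f \<in> L2_circle.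
      (\<lambda>j. \<bar>real_of_int j\<bar> powr (2 * s) * (cmod (fourier_coeff f j))\<^sup>2) summable_on (- {0})}"

definition sobolev0 :: "real \<Rightarrow> (real \<Rightarrow> real) set" where
  "sobolev0 s = {f \<in> sobolev s. (LBINT x:{0..2 * pi}. f x) = 0}"

text \<open>
  The homogeneous norm is the norm of \<open>sobolev0 s\<close>. The full norm adds the zero mode and
  gives the topology of \<open>sobolev s\<close>; the two agree on \<open>sobolev0 s\<close>.
\<close>

definition hom_norm :: "real \<Rightarrow> (real \<Rightarrow> real) \<Rightarrow> real" where
  "hom_norm s f =
     sqrt (\<Sum>\<^sub>\<infinity>j\<in>- {0}. \<bar>real_of_int j\<bar> powr (2 * s) * (cmod (fourier_coeff f j))\<^sup>2)"

definition full_norm :: "real \<Rightarrow> (real \<Rightarrow> real) \<Rightarrow> real" where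
  "full_norm s f = sqrt ((cmod (fourier_coeff f 0))\<^sup>2 + (hom_norm s f)\<^sup>2)"

definition test_functions :: "(real \<Rightarrow> real) set" where
  "test_functions = {\<phi>. (\<forall>x. \<phi> (x + 2 * pi) = \<phi> x)
      \<and> (\<forall>n. (deriv ^^ n) \<phi> differentiable_on UNIV)}"

definition has_weak_deriv :: "(real \<Rightarrow> real) \<Rightarrow> (real \<Rightarrow> real) \<Rightarrow> bool" where
  "has_weak_deriv f g \<longleftrightarrow>
     (\<forall>\<phi>\<in>test_functions. circle_pairing f (deriv \<phi>) = - circle_pairing g \<phi>)"

text \<open>
  Weak derivatives in \<open>L\<^sup>2\<close> are unique up to null sets; they exist on \<open>sobolev s\<close>
  for \<open>s \<ge> 1\<close>, the only range in which the following choice is used.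
\<close>

definition weak_deriv :: "(real \<Rightarrow> real) \<Rightarrow> real \<Rightarrow> real" where
  "weak_deriv f = (SOME g. g \<in> L2_circle \<and> has_weak_deriv f g)"

definition dirichlet_energy :: "(real \<Rightarrow> real) \<Rightarrow> real" where
  "dirichlet_energy f = (LBINT x:{0..2 * pi}. \<bar>weak_deriv f x\<bar>\<^sup>2)"

definition C0_sobolev :: "real \<Rightarrow> real \<Rightarrow> (real \<Rightarrow> real \<Rightarrow> real) \<Rightarrow> bool" where
  "C0_sobolev T s w \<longleftrightarrow> (\<forall>t\<in>{0..T}. w t \<in> sobolev s
      \<and> ((\<lambda>r. full_norm s (\<lambda>x. w r x - w t x)) \<longlongrightarrow> 0) (at t within {0..T}))"

definition has_time_deriv ::
    "real \<Rightarrow> real \<Rightarrow> (real \<Rightarrow> real \<Rightarrow> real) \<Rightarrow> (real \<Rightarrow> real \<Rightarrow> real) \<Rightarrow> bool" where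
  "has_time_deriv T s w w' \<longleftrightarrow> (\<forall>t\<in>{0..T}. w t \<in> sobolev s \<and> w' t \<in> sobolev s
      \<and> ((\<lambda>r. full_norm s (\<lambda>x. (w r x - w t x) / (r - t) - w' t x)) \<longlongrightarrow> 0)
           (at t within {0..T}))"

text \<open>
  Here \<open>u\<close> and \<open>v\<close> are functions of time with values in functions on the circle,
  and \<open>v\<close> is the time derivative of \<open>u\<close> in \<open>H\<^bsup>s-1\<^esup>\<close>. The second
  derivatives have regularity only \<open>H\<^bsup>s-2\<^esup>\<close> with \<open>s < 2\<close>, so the equation is an
  identity of distributions on the circle at each time. Since division is total in HOL, it is
  required explicitly that the denominator does not vanish.
\<close>

definition kirchhoff_solution ::
    "real \<Rightarrow> real \<Rightarrow> (real \<Rightarrow> real) \<Rightarrow> (real \<Rightarrow> real) \<Rightarrow> real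
      \<Rightarrow> (real \<Rightarrow> real \<Rightarrow> real) \<Rightarrow> (real \<Rightarrow> real \<Rightarrow> real) \<Rightarrow> bool" where
  "kirchhoff_solution c s u0 v0 T u v \<longleftrightarrow>
     C0_sobolev T s u \<and> has_time_deriv T (s - 1) u v \<and> C0_sobolev T (s - 1) v
     \<and> (AE x in lborel. u 0 x = u0 x) \<and> (AE x in lborel. v 0 x = v0 x)
     \<and> (\<forall>t\<in>{0..T}. 1 + c * dirichlet_energy (u t) \<noteq> 0)
     \<and> (\<forall>\<phi>\<in>test_functions. \<forall>t\<in>{0..T}.
          ((\<lambda>r. circle_pairing (v r) \<phi>) has_real_derivative
             (1 / (1 + c * dirichlet_energy (u t)))\<^sup>2 * circle_pairing (u t) (deriv (deriv \<phi>)))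
          (at t within {0..T}))"

definition unique_bounded_solution ::
    "real \<Rightarrow> real \<Rightarrow> real \<Rightarrow> (real \<Rightarrow> real) \<Rightarrow> (real \<Rightarrow> real) \<Rightarrow> real \<Rightarrow> bool" where
  "unique_bounded_solution c C s u0 v0 T \<longleftrightarrow>
     (\<exists>u v. kirchhoff_solution c s u0 v0 T u v
        \<and> (\<forall>u' v'. kirchhoff_solution c s u0 v0 T u' v' \<longrightarrow>
              (\<forall>t\<in>{0..T}. AE x in lborel. u' t x = u t x))
        \<and> (\<forall>t\<in>{0..T}. u t \<in> sobolev0 s \<and> v t \<in> sobolev0 (s - 1)
              \<and> hom_norm s (u t) + hom_norm (s - 1) (v t)
                  \<le> C * (hom_norm s u0 + hom_norm (s - 1) v0)))"

end

theory Submission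
  imports Defs "HOL-Probability.Discrete_Topology"
begin

text \<open>
  On the Fourier side the equation reads \<open>u\<^sub>k'' = - a\<^sup>2 k\<^sup>2 u\<^sub>k\<close> with \<open>a = 1 / (1 + c E)\<close> and
  \<open>E = \<Sum> k\<^sup>2 |u\<^sub>k|\<^sup>2\<close>. In the new time \<open>\<tau>\<close> with \<open>d\<tau> = a dt\<close> and in the variables
  \<open>p\<^sub>k = a\<^bsup>1/2\<^esup> k\<^bsup>3/2\<^esup> u\<^sub>k\<close>, \<open>q\<^sub>k = a\<^bsup>-1/2\<^esup> k\<^bsup>1/2\<^esup> u\<^sub>k'\<close> this particular nonlinearity becomes
  the cubic system \<open>p\<^sub>k' = k q\<^sub>k - \<gamma>\<sigma> p\<^sub>k\<close>, \<open>q\<^sub>k' = - k p\<^sub>k + \<gamma>\<sigma> q\<^sub>k\<close> with \<open>\<gamma> = 2c\<close> and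
  \<open>\<sigma> = \<Sum> Re (cnj p\<^sub>k q\<^sub>k)\<close> over the positive frequencies. It is semilinear in \<open>\<ell>\<^sup>2\<close>, so the
  threshold \<open>s = 3/2\<close> poses no difficulty.

  One step of normal form, dividing by \<open>j \<plusminus> k\<close>, removes all quartic terms from the time derivative
  of \<open>|p\<^sub>k|\<^sup>2 + |q\<^sub>k|\<^sup>2\<close>, and the remaining sextic terms are themselves an exact derivative. Hence
  for every frequency a quantity close to \<open>|p\<^sub>k|\<^sup>2 + |q\<^sub>k|\<^sup>2\<close> is exactly conserved, small solutions
  are global, all weighted norms stay comparable to their initial values, and any lifespan may be
  chosen, in particular \<open>\<epsilon>\<^bsup>-6\<^esup>\<close>.
\<close>

section \<open>An exactly conserved quantity for every frequency\<close>

text \<open>The system is exactly cubic because 1/a is affine in \<open>E\<close>: the time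
  derivative of \<open>E\<close> is 4\<sigma>, so the logarithmic derivative of \<open>a\<close> in
  the new time is 4\<sigma> times (da/dE) / a^2, and this last quotient is the constant -c. The
  powers 1/2 and -1/2 of \<open>a\<close> in p and q split it into the two terms with
  \<gamma>\<sigma>. The comparison must hold at each frequency with a constant that does not depend
  on the frequency. Each mode is therefore divided by the square root of its own initial size
  \<open>\<rho> n\<close>. The normalised modes start with size at most 1, the coupling becomes a
  sum with the summable weights \<open>\<rho>\<close>, and the system can be solved in the space of
  bounded sequences. A uniform bound for the normalised modes is a relative bound for the original
  ones and may be multiplied by any power of the frequency, so one estimate serves every s \<ge>
  3/2. The conserved quantity controls a mode only as long as all modes are known to be bounded.
  This is the reason for solving a truncated system and removing the truncation by
  continuation.\<close>

lemma has_real_derivative_suminf: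
  fixes f f' :: "nat \<Rightarrow> real \<Rightarrow> real"
  assumes S: "convex S" and x: "x \<in> S"
    and d: "\<And>n y. y \<in> S \<Longrightarrow> (f n has_real_derivative f' n y) (at y within S)"
    and b: "\<And>n y. y \<in> S \<Longrightarrow> \<bar>f' n y\<bar> \<le> M n" and M: "summable M"
    and s: "summable (\<lambda>n. f n x)"
  shows "((\<lambda>y. \<Sum>n. f n y) has_real_derivative (\<Sum>n. f' n x)) (at x within S)"
proof -
  have u: "uniform_limit S (\<lambda>n x. \<Sum>i<n. f' i x) (\<lambda>x. \<Sum>i. f' i x) sequentially"
    using b M by (intro Weierstrass_m_test) auto
  obtain g where g: "\<And>y. y \<in> S \<Longrightarrow> (\<lambda>n. f n y) sums g y"
    "\<And>y. y \<in> S \<Longrightarrow> (g has_real_derivative (\<Sum>i. f' i y)) (at y within S)"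
    using has_field_derivative_series[OF S d u x s] by blast
  have "(\<Sum>n. f n y) = g y" if "y \<in> S" for y
    using g(1)[OF that] by (simp add: sums_iff)
  then show ?thesis
    using g(2)[OF x] x by (auto intro: has_field_derivative_transform_within[where d=1])
qed

lemma continuous_on_suminf_bound:
  fixes f :: "nat \<Rightarrow> 'a::topological_space \<Rightarrow> 'b::banach"
  assumes "\<And>n. continuous_on S (f n)" "\<And>n y. y \<in> S \<Longrightarrow> norm (f n y) \<le> M n" "summable M"
  shows "continuous_on S (\<lambda>y. \<Sum>n. f n y)"
proof (rule uniform_limit_theorem)
  show "uniform_limit S (\<lambda>n x. \<Sum>i<n. f i x) (\<lambda>x. \<Sum>i. f i x) sequentially"
    using assms by (intro Weierstrass_m_test) auto
  show "\<forall>\<^sub>F n in sequentially. continuous_on S (\<lambda>x. \<Sum>i<n. f i x)"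
    using assms by (intro always_eventually allI continuous_on_sum) auto
qed simp

text \<open>\<open>modeN\<close> is the size of a mode, while \<open>modeD\<close> and
  \<open>modeR\<close> are the real and imaginary parts of
  \<open>(p + \<i> * q) * cnj (p - \<i> * q)\<close>. In real components the differentiation rules
  below become polynomial identities.\<close>

definition modeN :: "complex \<Rightarrow> complex \<Rightarrow> real" where
  "modeN p q = (Re p)\<^sup>2 + (Im p)\<^sup>2 + (Re q)\<^sup>2 + (Im q)\<^sup>2"
definition modeD :: "complex \<Rightarrow> complex \<Rightarrow> real" where
  "modeD p q = (Re p)\<^sup>2 + (Im p)\<^sup>2 - (Re q)\<^sup>2 - (Im q)\<^sup>2"
definition modeR :: "complex \<Rightarrow> complex \<Rightarrow> real" where
  "modeR p q = 2 * (Re p * Re q + Im p * Im q)"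

lemma modeN_eq: "modeN p q = (cmod p)\<^sup>2 + (cmod q)\<^sup>2"
  by (simp add: modeN_def cmod_power2)

lemma modeN_nonneg: "0 \<le> modeN p q"
  by (simp add: modeN_def)

lemma abs_modeD_le: "\<bar>modeD p q\<bar> \<le> modeN p q"
  by (simp add: modeN_def modeD_def abs_le_iff)

lemma abs_modeR_le: "\<bar>modeR p q\<bar> \<le> modeN p q"
proof -
  have "0 \<le> (Re p - Re q)\<^sup>2 + (Im p - Im q)\<^sup>2" "0 \<le> (Re p + Re q)\<^sup>2 + (Im p + Im q)\<^sup>2"
    by simp_all
  then show ?thesis
    by (simp add: modeN_def modeR_def abs_le_iff power2_diff power2_sum)
qed

text \<open>Index \<open>n\<close> stands for the pair of frequencies \<open>\<plusminus> (n + 1)\<close>.\<close>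

definition freq :: "nat \<Rightarrow> real" where "freq n = real (Suc n)"

lemma freq_ge_1: "1 \<le> freq n" by (simp add: freq_def)
lemma freq_pos: "0 < freq n" by (simp add: freq_def)

text \<open>
  The number \<open>modeD + \<i> modeR\<close> rotates with speed twice the frequency. The coefficients below are the sum
  and the difference of the inverse divisors that solve the homological equation for the products of
  the modes \<open>j\<close> and \<open>m\<close>; the resonance \<open>j = m\<close> does not contribute.
\<close>

definition kap :: "nat \<Rightarrow> nat \<Rightarrow> real" where
  "kap m j = 1 / (freq j + freq m) + (if j = m then 0 else 1 / (freq j - freq m))"
definition mu :: "nat \<Rightarrow> nat \<Rightarrow> real" where
  "mu m j = 1 / (freq j + freq m) - (if j = m then 0 else 1 / (freq j - freq m))"

lemma freq_diff_ge_1: "j \<noteq> m \<Longrightarrow> 1 \<le> \<bar>freq j - freq m\<bar>"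
  by (simp add: freq_def)

text \<open>Distinct frequencies differ by at least 1, so there are no small divisors and the
  coefficients are bounded uniformly in both indices.\<close>

lemma
  shows abs_kap_le: "\<bar>kap m j\<bar> \<le> 2" and abs_mu_le: "\<bar>mu m j\<bar> \<le> 2"
proof -
  have 1: "\<bar>1 / (freq j + freq m)\<bar> \<le> 1"
    using freq_ge_1[of j] freq_ge_1[of m] by simp
  have 2: "\<bar>if j = m then 0 else 1 / (freq j - freq m)\<bar> \<le> 1"
    using freq_diff_ge_1[of j m] by (auto simp: divide_simps)
  show "\<bar>kap m j\<bar> \<le> 2" "\<bar>mu m j\<bar> \<le> 2"
    unfolding kap_def mu_def using 1 2 by linarith+
qed

text \<open>For fixed \<open>m\<close> the divisors grow with \<open>j\<close>, since freq j / (freq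
  j - freq m) = 1 + freq m / (freq j - freq m). Differentiating a corrector costs a factor
  \<open>freq j\<close>; this bound keeps the differentiated series absolutely convergent. The
  dependence on \<open>m\<close> is harmless because the mode \<open>m\<close> stays fixed
  there.\<close>

lemma
  shows abs_freq_kap_le: "\<bar>freq j * kap m j\<bar> \<le> 2 + freq m"
    and abs_freq_mu_le: "\<bar>freq j * mu m j\<bar> \<le> 2 + freq m"
proof -
  have 1: "\<bar>freq j * (1 / (freq j + freq m))\<bar> \<le> 1"
    using freq_ge_1[of j] freq_ge_1[of m] by (simp add: abs_divide)
  have 2: "\<bar>freq j * (if j = m then 0 else 1 / (freq j - freq m))\<bar> \<le> 1 + freq m"
  proof (cases "j = m")
    case False
    have "freq j * (1 / (freq j - freq m)) = 1 + freq m * (1 / (freq j - freq m))"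
      using freq_diff_ge_1[OF False] by (auto simp: field_simps)
    moreover have "\<bar>freq m * (1 / (freq j - freq m))\<bar> \<le> freq m * 1"
      unfolding abs_mult using freq_diff_ge_1[OF False] freq_ge_1[of m]
      by (intro mult_mono) (auto simp: divide_simps)
    ultimately show ?thesis using False by (simp only: if_False, linarith?)
  qed (use freq_ge_1[of m] in auto)
  show "\<bar>freq j * kap m j\<bar> \<le> 2 + freq m" "\<bar>freq j * mu m j\<bar> \<le> 2 + freq m"
    unfolding kap_def mu_def distrib_left right_diff_distrib using 1 2 by linarith+
qed

text \<open>These are the homological equations. The first removes the products of
  \<open>modeR\<close> of mode \<open>m\<close> with \<open>modeD\<close> of mode \<open>j\<close>;
  the second produces the opposite products with the coefficient that cancels the derivative of
  \<open>modeN\<close>. On the diagonal the two kinds of product coincide and the coefficient 2 is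
  shared equally.\<close>

lemma kap_mu_identities:
  shows "freq m * kap m j + freq j * mu m j = (if j = m then 1 else 0)"
    and "freq j * kap m j + freq m * mu m j = 2 - (if j = m then 1 else 0)"
proof -
  have s: "freq j + freq m \<noteq> 0" using freq_pos[of j] freq_pos[of m] by linarith
  have "freq m * kap m j + freq j * mu m j = (if j = m then 1 else 0)
      \<and> freq j * kap m j + freq m * mu m j = 2 - (if j = m then 1 else 0)"
  proof (cases "j = m")
    case True
    then show ?thesis using freq_pos[of m] by (simp add: kap_def mu_def)
  next
    case False
    define a b where "a = 1 / (freq j + freq m)" and "b = 1 / (freq j - freq m)"
    have ab: "a * (freq j + freq m) = 1" "b * (freq j - freq m) = 1"
      using s freq_diff_ge_1[OF False] by (auto simp: a_def b_def)
    have k: "kap m j = a + b" "mu m j = a - b"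
      using False by (auto simp: kap_def mu_def a_def b_def)
    have "freq m * kap m j + freq j * mu m j = a * (freq j + freq m) - b * (freq j - freq m)"
      "freq j * kap m j + freq m * mu m j = a * (freq j + freq m) + b * (freq j - freq m)"
      unfolding k by (simp_all add: algebra_simps)
    then show ?thesis using False ab by simp
  qed
  then show "freq m * kap m j + freq j * mu m j = (if j = m then 1 else 0)"
    "freq j * kap m j + freq m * mu m j = 2 - (if j = m then 1 else 0)"
    by auto
qed

text \<open>The modes of the actual solution are \<open>p n\<close> and \<open>q n\<close> times the
  square root of \<open>\<rho> n\<close>, hence the weights in \<open>\<sigma>\<close>. The bound
  \<open>K\<close> is provisional. The time set is left open so that the results apply both to the
  bounded intervals of the continuation argument and to the half line.\<close>

locale mode_system =
  fixes \<gamma> :: real and \<rho> :: "nat \<Rightarrow> real" and S :: "real set" and K :: real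
    and p q :: "nat \<Rightarrow> real \<Rightarrow> complex" and \<sigma> :: "real \<Rightarrow> real"
  assumes S: "convex S"
    and \<rho>_nonneg: "\<And>n. 0 \<le> \<rho> n" and \<rho>_summable: "summable \<rho>"
    and bound: "\<And>n t. t \<in> S \<Longrightarrow> modeN (p n t) (q n t) \<le> K"
    and p_deriv: "\<And>n t. t \<in> S \<Longrightarrow>
      (p n has_vector_derivative (freq n *\<^sub>R q n t - (\<gamma> * \<sigma> t) *\<^sub>R p n t)) (at t within S)"
    and q_deriv: "\<And>n t. t \<in> S \<Longrightarrow>
      (q n has_vector_derivative ((\<gamma> * \<sigma> t) *\<^sub>R q n t - freq n *\<^sub>R p n t)) (at t within S)"
    and \<sigma>_eq: "\<And>t. t \<in> S \<Longrightarrow> \<sigma> t = (\<Sum>n. \<rho> n * modeR (p n t) (q n t)) / 2"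
begin

abbreviation N where "N n t \<equiv> modeN (p n t) (q n t)"
abbreviation D where "D n t \<equiv> modeD (p n t) (q n t)"
abbreviation R where "R n t \<equiv> modeR (p n t) (q n t)"

lemma component_derivs:
  assumes "t \<in> S"
  shows "((\<lambda>t. Re (p n t)) has_real_derivative (freq n * Re (q n t) - \<gamma> * \<sigma> t * Re (p n t))) (at t within S)"
    "((\<lambda>t. Im (p n t)) has_real_derivative (freq n * Im (q n t) - \<gamma> * \<sigma> t * Im (p n t))) (at t within S)"
    "((\<lambda>t. Re (q n t)) has_real_derivative (\<gamma> * \<sigma> t * Re (q n t) - freq n * Re (p n t))) (at t within S)"
    "((\<lambda>t. Im (q n t)) has_real_derivative (\<gamma> * \<sigma> t * Im (q n t) - freq n * Im (p n t))) (at t within S)"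
  using bounded_linear.has_vector_derivative[OF bounded_linear_Re p_deriv[OF assms]]
    bounded_linear.has_vector_derivative[OF bounded_linear_Im p_deriv[OF assms]]
    bounded_linear.has_vector_derivative[OF bounded_linear_Re q_deriv[OF assms]]
    bounded_linear.has_vector_derivative[OF bounded_linear_Im q_deriv[OF assms]]
  by (simp_all add: has_real_derivative_iff_has_vector_derivative)

lemma N_deriv: "t \<in> S \<Longrightarrow> (N n has_real_derivative - 2 * \<gamma> * \<sigma> t * D n t) (at t within S)"
  unfolding modeN_def modeD_def
  by (rule DERIV_cong, (rule DERIV_add DERIV_diff DERIV_power component_derivs | assumption)+)
    (simp add: algebra_simps power2_eq_square)

lemma D_deriv: "t \<in> S \<Longrightarrow>
    (D n has_real_derivative 2 * freq n * R n t - 2 * \<gamma> * \<sigma> t * N n t) (at t within S)"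
  unfolding modeN_def modeD_def modeR_def
  by (rule DERIV_cong, (rule DERIV_add DERIV_diff DERIV_power component_derivs | assumption)+)
    (simp add: algebra_simps power2_eq_square)

lemma R_deriv: "t \<in> S \<Longrightarrow> (R n has_real_derivative - 2 * freq n * D n t) (at t within S)"
  unfolding modeD_def modeR_def
  by (rule DERIV_cong, (rule DERIV_cmult DERIV_add DERIV_mult component_derivs | assumption)+)
    (simp add: algebra_simps power2_eq_square)

lemma
  assumes "t \<in> S"
  shows abs_N_le: "\<bar>N n t\<bar> \<le> K" and abs_D_le: "\<bar>D n t\<bar> \<le> K" and abs_R_le: "\<bar>R n t\<bar> \<le> K"
  using bound[OF assms, of n] modeN_nonneg[of "p n t" "q n t"]
    abs_modeD_le[of "p n t" "q n t"] abs_modeR_le[of "p n t" "q n t"] by linarith+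

lemma weighted_bound:
  assumes "\<bar>x\<bar> \<le> K" "\<bar>c\<bar> \<le> B"
  shows "\<bar>\<rho> n * (c * x)\<bar> \<le> B * K * \<rho> n"
proof -
  have "\<bar>c\<bar> * \<bar>x\<bar> \<le> B * K" using assms by (intro mult_mono) auto
  then have "\<rho> n * (\<bar>c\<bar> * \<bar>x\<bar>) \<le> \<rho> n * (B * K)" by (rule mult_left_mono) (rule \<rho>_nonneg)
  then show ?thesis using \<rho>_nonneg[of n] by (simp add: abs_mult mult_ac)
qed

lemma weighted_summable:
  assumes "\<And>n. \<bar>x n\<bar> \<le> K" "\<And>n. \<bar>c n\<bar> \<le> B"
  shows "summable (\<lambda>n. \<rho> n * (c n * x n))"
  by (rule summable_comparison_test'[where g="\<lambda>n. B * K * \<rho> n"])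
    (use weighted_bound[OF assms] summable_mult[OF \<rho>_summable] in auto)

lemma weighted_suminf_le:
  assumes "\<And>n. \<bar>x n\<bar> \<le> K" "\<And>n. \<bar>c n\<bar> \<le> B"
  shows "\<bar>\<Sum>n. \<rho> n * (c n * x n)\<bar> \<le> B * K * suminf \<rho>"
proof -
  have "norm (\<Sum>n. \<rho> n * (c n * x n)) \<le> (\<Sum>n. B * K * \<rho> n)"
    using weighted_bound[OF assms] summable_mult[OF \<rho>_summable]
    by (intro norm_suminf_le) auto
  then show ?thesis by (simp add: suminf_mult[OF \<rho>_summable])
qed

lemma \<sigma>_bound: assumes "t \<in> S" shows "\<bar>\<sigma> t\<bar> \<le> K * suminf \<rho>"
proof -
  have "\<bar>\<Sum>n. \<rho> n * (1 * R n t)\<bar> \<le> 1 * K * suminf \<rho>"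
    by (rule weighted_suminf_le) (use assms abs_R_le in auto)
  then have "\<bar>2 * \<sigma> t\<bar> \<le> K * suminf \<rho>" using assms by (simp add: \<sigma>_eq)
  then show ?thesis unfolding abs_mult by simp
qed

text \<open>The bound is placed on the product \<open>c n * x' n\<close>: the derivative of
  \<open>D n\<close> or \<open>R n\<close> carries the factor \<open>freq n\<close>, which only the
  decay of the coefficients \<open>c n\<close> compensates.\<close>

lemma weighted_deriv:
  assumes t: "t \<in> S" and c: "\<And>n. \<bar>c n\<bar> \<le> B" and x: "\<And>n t. t \<in> S \<Longrightarrow> \<bar>x n t\<bar> \<le> K"
    and d: "\<And>n t. t \<in> S \<Longrightarrow> (x n has_real_derivative x' n t) (at t within S)"
    and b: "\<And>n t. t \<in> S \<Longrightarrow> \<bar>c n * x' n t\<bar> \<le> B'"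
  shows "((\<lambda>t. \<Sum>n. \<rho> n * (c n * x n t)) has_real_derivative (\<Sum>n. \<rho> n * (c n * x' n t))) (at t within S)"
proof (rule has_real_derivative_suminf[where S=S and M="\<lambda>n. B' * \<rho> n"])
  show "summable (\<lambda>n. \<rho> n * (c n * x n t))"
    by (rule weighted_summable) (use x t c in auto)
  show "\<bar>\<rho> n * (c n * x' n y)\<bar> \<le> B' * \<rho> n" if "y \<in> S" for n y
    using mult_left_mono[OF b[OF that, of n] \<rho>_nonneg[of n]] \<rho>_nonneg[of n]
    by (simp add: abs_mult mult_ac)
qed (auto intro!: derivative_eq_intros S t d summable_mult \<rho>_summable)

text \<open>The action of all modes on mode \<open>m\<close>, after division by the divisors.
  \<open>DK\<close> and \<open>RM\<close> are the partners of \<open>D m\<close> and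
  \<open>R m\<close> in the corrector of the normal form; \<open>GN\<close> is the partner of
  \<open>N m\<close> in the term that integrates the remainder.\<close>

definition DK where "DK m t = (\<Sum>j. \<rho> j * (kap m j * D j t))"
definition RM where "RM m t = (\<Sum>j. \<rho> j * (mu m j * R j t))"
definition GN where "GN m t = (\<Sum>j. \<rho> j * (kap m j * N j t))"

lemma \<gamma>\<sigma>_bound: assumes "t \<in> S" "\<bar>x\<bar> \<le> K"
  shows "\<bar>2 * \<gamma> * \<sigma> t * x\<bar> \<le> 2 * \<bar>\<gamma>\<bar> * (K * suminf \<rho>) * K"
proof -
  have "\<bar>\<sigma> t\<bar> * \<bar>x\<bar> \<le> K * suminf \<rho> * K"
    using \<sigma>_bound[OF assms(1)] assms(2) by (intro mult_mono) auto
  then have "2 * \<bar>\<gamma>\<bar> * (\<bar>\<sigma> t\<bar> * \<bar>x\<bar>) \<le> 2 * \<bar>\<gamma>\<bar> * (K * suminf \<rho> * K)"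
    by (rule mult_left_mono) simp
  then show ?thesis by (simp add: abs_mult mult_ac)
qed

lemma kap_mult_le: "\<bar>x\<bar> \<le> B \<Longrightarrow> \<bar>kap m n * x\<bar> \<le> 2 * B"
  unfolding abs_mult using abs_kap_le[of m n] by (intro mult_mono) auto

lemma GN_deriv: assumes "t \<in> S"
  shows "(GN m has_real_derivative - 2 * \<gamma> * \<sigma> t * DK m t) (at t within S)"
proof -
  have "((\<lambda>t. \<Sum>n. \<rho> n * (kap m n * N n t)) has_real_derivative
     (\<Sum>n. \<rho> n * (kap m n * (- 2 * \<gamma> * \<sigma> t * D n t)))) (at t within S)"
  proof (rule weighted_deriv[where B=2])
    show "\<bar>kap m n * (- 2 * \<gamma> * \<sigma> t * D n t)\<bar> \<le> 2 * (2 * \<bar>\<gamma>\<bar> * (K * suminf \<rho>) * K)" if "t \<in> S" for n t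
      using \<gamma>\<sigma>_bound[OF that abs_D_le[OF that]] by (intro kap_mult_le) simp
  qed (use assms abs_kap_le abs_N_le N_deriv in auto)
  moreover have "(\<Sum>n. \<rho> n * (kap m n * (- 2 * \<gamma> * \<sigma> t * D n t)))
      = (\<Sum>n. (- 2 * \<gamma> * \<sigma> t) * (\<rho> n * (kap m n * D n t)))"
    by (simp add: mult_ac)
  moreover have "\<dots> = - 2 * \<gamma> * \<sigma> t * DK m t"
    unfolding DK_def by (rule suminf_mult) (rule weighted_summable[where B=2], use assms abs_kap_le abs_D_le in auto)
  ultimately show ?thesis by (simp add: GN_def[abs_def])
qed

lemma DK_deriv: assumes "t \<in> S"
  shows "(DK m has_real_derivative
    (\<Sum>n. \<rho> n * (freq n * kap m n * R n t)) * 2 - 2 * \<gamma> * \<sigma> t * GN m t) (at t within S)"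
proof -
  have "((\<lambda>t. \<Sum>n. \<rho> n * (kap m n * D n t)) has_real_derivative
     (\<Sum>n. \<rho> n * (kap m n * (2 * freq n * R n t - 2 * \<gamma> * \<sigma> t * N n t)))) (at t within S)"
  proof (rule weighted_deriv[where B=2])
    show "\<bar>kap m n * (2 * freq n * R n t - 2 * \<gamma> * \<sigma> t * N n t)\<bar>
       \<le> 2 * ((2 + freq m) * K) + 2 * (2 * \<bar>\<gamma>\<bar> * (K * suminf \<rho>) * K)" if "t \<in> S" for n t
    proof -
      have "\<bar>freq n * kap m n\<bar> * \<bar>R n t\<bar> \<le> (2 + freq m) * K"
        using abs_freq_kap_le abs_R_le[OF that] freq_pos[of m] by (intro mult_mono) auto
      moreover have "\<bar>kap m n * (2 * freq n * R n t)\<bar> = 2 * (\<bar>freq n * kap m n\<bar> * \<bar>R n t\<bar>)"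
        by (simp add: abs_mult)
      ultimately have "\<bar>kap m n * (2 * freq n * R n t)\<bar> \<le> 2 * ((2 + freq m) * K)"
        by linarith
      moreover have "\<bar>kap m n * (2 * \<gamma> * \<sigma> t * N n t)\<bar> \<le> 2 * (2 * \<bar>\<gamma>\<bar> * (K * suminf \<rho>) * K)"
        using \<gamma>\<sigma>_bound[OF that abs_N_le[OF that]] by (intro kap_mult_le) simp
      ultimately show ?thesis unfolding right_diff_distrib by linarith
    qed
  qed (use assms abs_kap_le abs_D_le D_deriv in auto)
  moreover have "(\<Sum>n. \<rho> n * (kap m n * (2 * freq n * R n t - 2 * \<gamma> * \<sigma> t * N n t)))
      = (\<Sum>n. \<rho> n * (freq n * kap m n * R n t) * 2 - (2 * \<gamma> * \<sigma> t) * (\<rho> n * (kap m n * N n t)))"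
    by (simp add: algebra_simps)
  moreover have "\<dots> = (\<Sum>n. \<rho> n * (freq n * kap m n * R n t)) * 2 - 2 * \<gamma> * \<sigma> t * GN m t"
  proof -
    have "summable (\<lambda>n. \<rho> n * (freq n * kap m n * R n t))"
      by (rule weighted_summable[where B="2+freq m"]) (use assms abs_freq_kap_le abs_R_le in auto)
    moreover have "summable (\<lambda>n. \<rho> n * (kap m n * N n t))"
      by (rule weighted_summable[where B=2]) (use assms abs_kap_le abs_N_le in auto)
    ultimately show ?thesis
      unfolding GN_def by (simp only: suminf_diff[OF summable_mult2 summable_mult, symmetric] suminf_mult[symmetric] suminf_mult2)
  qed
  ultimately show ?thesis by (simp add: DK_def[abs_def])
qed

lemma RM_deriv: assumes "t \<in> S"
  shows "(RM m has_real_derivative - 2 * (\<Sum>n. \<rho> n * (freq n * mu m n * D n t))) (at t within S)"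
proof -
  have "((\<lambda>t. \<Sum>n. \<rho> n * (mu m n * R n t)) has_real_derivative
     (\<Sum>n. \<rho> n * (mu m n * (- 2 * freq n * D n t)))) (at t within S)"
  proof (rule weighted_deriv[where B=2])
    show "\<bar>mu m n * (- 2 * freq n * D n t)\<bar> \<le> 2 * ((2 + freq m) * K)" if "t \<in> S" for n t
    proof -
      have "\<bar>freq n * mu m n\<bar> * \<bar>D n t\<bar> \<le> (2 + freq m) * K"
        using abs_freq_mu_le abs_D_le[OF that] freq_pos[of m] by (intro mult_mono) auto
      moreover have "\<bar>mu m n * (- 2 * freq n * D n t)\<bar> = 2 * (\<bar>freq n * mu m n\<bar> * \<bar>D n t\<bar>)"
        by (simp add: abs_mult)
      ultimately show ?thesis by linarith
    qed
  qed (use assms abs_mu_le abs_R_le R_deriv in auto)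
  moreover have "(\<Sum>n. \<rho> n * (mu m n * (- 2 * freq n * D n t)))
      = (\<Sum>n. - 2 * (\<rho> n * (freq n * mu m n * D n t)))"
    by (simp add: mult_ac)
  moreover have "\<dots> = - 2 * (\<Sum>n. \<rho> n * (freq n * mu m n * D n t))"
    by (rule suminf_mult) (rule weighted_summable[where B="2+freq m"], use assms abs_freq_mu_le abs_D_le in auto)
  ultimately show ?thesis by (simp add: RM_def[abs_def])
qed

text \<open>The factor \<gamma> / 4 is forced: under the pure rotation
  \<open>D m * DK m - R m * RM m\<close> has derivative 8\<sigma> times \<open>D m\<close>, whereas
  \<open>N m\<close> has derivative -2\<gamma>\<sigma> times \<open>D m\<close> in the full
  system.\<close>

definition invariant :: "nat \<Rightarrow> real \<Rightarrow> real" where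
  "invariant m t = N m t + \<gamma> / 4 * (D m t * DK m t - R m t * RM m t) - \<gamma> / 4 * (GN m t * N m t)"

text \<open>After the cancellation at first order, the corrector leaves only terms containing
  \<sigma>, namely -2\<gamma>\<sigma> times \<open>N m * DK m + GN m * D m\<close>. This is exactly
  the derivative of \<open>GN m * N m\<close>, because \<open>GN m\<close> and \<open>N m\<close>
  obey the same rule, with \<open>DK m\<close> and \<open>D m\<close> on the right.\<close>

lemma invariant_deriv:
  assumes t: "t \<in> S"
  shows "(invariant m has_real_derivative 0) (at t within S)"
proof -
  define X where "X = (\<Sum>n. \<rho> n * (freq n * kap m n * R n t))"
  define Y where "Y = (\<Sum>n. \<rho> n * (freq n * mu m n * D n t))"
  have sums: "(\<lambda>j. \<rho> j * (c j * x j)) sums (\<Sum>j. \<rho> j * (c j * x j))"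
    if "\<And>j. \<bar>x j\<bar> \<le> K" "\<And>j. \<bar>c j\<bar> \<le> B" for c x B
    using weighted_summable[OF that] by (rule summable_sums)
  have single: "(\<lambda>j. \<rho> j * ((if j = m then 1 else 0) * x j)) sums (\<rho> m * x m)" for x
    using sums_single[of m "\<lambda>j. \<rho> j * x j"] by (simp add: if_distrib if_distribR cong: if_cong)
  have "(\<lambda>j. freq m * (\<rho> j * (kap m j * D j t)) + \<rho> j * (freq j * mu m j * D j t)) sums (freq m * DK m t + Y)"
    unfolding DK_def Y_def
    by (intro sums_add sums_mult sums[where B=2] sums[where B="2+freq m"])
      (use abs_kap_le abs_freq_mu_le abs_D_le t in auto)
  moreover have "freq m * (\<rho> j * (kap m j * D j t)) + \<rho> j * (freq j * mu m j * D j t)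
      = \<rho> j * ((if j = m then 1 else 0) * D j t)" for j
    unfolding kap_mu_identities(1)[of m j, symmetric] by (simp add: algebra_simps)
  ultimately have 1: "freq m * DK m t + Y = \<rho> m * D m t"
    using single[of "\<lambda>j. D j t"] by (auto dest: sums_unique2)
  have "(\<lambda>j. freq m * (\<rho> j * (mu m j * R j t)) + \<rho> j * (freq j * kap m j * R j t)) sums (freq m * RM m t + X)"
    unfolding RM_def X_def
    by (intro sums_add sums_mult sums[where B=2] sums[where B="2+freq m"])
      (use abs_mu_le abs_freq_kap_le abs_R_le t in auto)
  moreover have "freq m * (\<rho> j * (mu m j * R j t)) + \<rho> j * (freq j * kap m j * R j t)
      = \<rho> j * ((2 - (if j = m then 1 else 0)) * R j t)" for j
    unfolding kap_mu_identities(2)[of j m, symmetric] by (simp add: algebra_simps)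
  moreover have "(\<lambda>j. 2 * (\<rho> j * (1 * R j t)) - \<rho> j * ((if j = m then 1 else 0) * R j t))
      sums (2 * (\<Sum>j. \<rho> j * (1 * R j t)) - \<rho> m * R m t)"
    by (intro sums_diff sums_mult single sums[where B=1]) (use abs_R_le t in auto)
  moreover have "2 * (\<rho> j * (1 * R j t)) - \<rho> j * ((if j = m then 1 else 0) * R j t)
      = \<rho> j * ((2 - (if j = m then 1 else 0)) * R j t)" for j
    by (simp add: algebra_simps)
  ultimately have 2: "freq m * RM m t + X = 4 * \<sigma> t - \<rho> m * R m t"
    using t by (auto dest: sums_unique2 simp: \<sigma>_eq)
  \<comment> \<open>The sums that carry the factor \<open>freq n\<close> are expressed by the
    correctors and \<open>\<sigma>\<close>. The two diagonal remainders, with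
    \<open>\<rho> m * D m\<close> and \<open>\<rho> m * R m\<close>, cancel each other once
    multiplied by \<open>R m\<close> and \<open>D m\<close>.\<close>
  have Yeq: "Y = \<rho> m * D m t - freq m * DK m t" and Xeq: "X = 4 * \<sigma> t - \<rho> m * R m t - freq m * RM m t"
    using 1 2 by auto
  have "(invariant m has_real_derivative
     - 2 * \<gamma> * \<sigma> t * D m t + \<gamma> / 4 *
       ((2 * freq m * R m t - 2 * \<gamma> * \<sigma> t * N m t) * DK m t
         + (X * 2 - 2 * \<gamma> * \<sigma> t * GN m t) * D m t
         - ((- 2 * freq m * D m t) * RM m t + (- 2 * Y) * R m t))
      - \<gamma> / 4 * ((- 2 * \<gamma> * \<sigma> t * DK m t) * N m t + (- 2 * \<gamma> * \<sigma> t * D m t) * GN m t)) (at t within S)"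
    unfolding invariant_def[abs_def]
    by (intro DERIV_add DERIV_diff DERIV_cmult DERIV_mult' DERIV_mult N_deriv D_deriv R_deriv GN_deriv t
        DK_deriv[of t m, folded X_def] RM_deriv[of t m, folded Y_def])
  then show ?thesis
    by (rule DERIV_cong) (unfold Yeq Xeq, simp add: algebra_simps)
qed

lemma invariant_const:
  assumes "s \<in> S" "t \<in> S" shows "invariant m s = invariant m t"
proof -
  obtain c where c: "\<forall>x\<in>S. invariant m x = c"
    using has_field_derivative_zero_constant[OF S invariant_deriv, of m] by metis
  then show ?thesis using assms by simp
qed

text \<open>Every correction term contains one factor belonging to mode \<open>m\<close> itself, so
  the error is proportional to \<open>N m t\<close>. This makes the comparison relative, however
  small the mode is.\<close>

lemma invariant_near:
  assumes t: "t \<in> S"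
  shows "\<bar>invariant m t - N m t\<bar> \<le> \<bar>\<gamma>\<bar> * (2 * K * suminf \<rho>) * N m t"
proof -
  let ?B = "2 * K * suminf \<rho>"
  have DK: "\<bar>DK m t\<bar> \<le> ?B" unfolding DK_def
    by (rule weighted_suminf_le) (use abs_kap_le abs_D_le t in auto)
  have RM: "\<bar>RM m t\<bar> \<le> ?B" unfolding RM_def
    by (rule weighted_suminf_le) (use abs_mu_le abs_R_le t in auto)
  have GN: "\<bar>GN m t\<bar> \<le> ?B" unfolding GN_def
    by (rule weighted_suminf_le) (use abs_kap_le abs_N_le t in auto)
  have "\<bar>D m t * DK m t\<bar> \<le> N m t * ?B" "\<bar>R m t * RM m t\<bar> \<le> N m t * ?B" "\<bar>GN m t * N m t\<bar> \<le> ?B * N m t"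
    unfolding abs_mult using abs_modeD_le abs_modeR_le DK RM GN modeN_nonneg
    by (auto intro!: mult_mono)
  then have "\<bar>D m t * DK m t - R m t * RM m t - GN m t * N m t\<bar> \<le> 3 * (?B * N m t)"
    unfolding mult.commute[of "N m t" ?B] by linarith
  then have "\<bar>\<gamma>\<bar> / 4 * \<bar>D m t * DK m t - R m t * RM m t - GN m t * N m t\<bar> \<le> \<bar>\<gamma>\<bar> / 4 * (3 * (?B * N m t))"
    by (rule mult_left_mono) simp
  also have "\<dots> \<le> \<bar>\<gamma>\<bar> * ?B * N m t"
  proof -
    have "0 \<le> ?B * N m t" using DK modeN_nonneg[of "p m t" "q m t"] by (auto intro!: mult_nonneg_nonneg)
    then have "0 \<le> \<bar>\<gamma>\<bar> * (?B * N m t)" by simp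
    then show ?thesis by (simp add: mult.assoc)
  qed
  finally show ?thesis
    unfolding invariant_def by (simp add: abs_mult[symmetric] algebra_simps abs_divide)
qed

text \<open>Under the smallness assumption the invariant differs from \<open>N m\<close> by at most
  a quarter of \<open>N m\<close>. Its constancy therefore costs the factor (5/4) / (3/4) =
  5/3.\<close>

lemma modeN_le:
  assumes "s \<in> S" "t \<in> S" and small: "\<bar>\<gamma>\<bar> * (K * suminf \<rho>) \<le> 1 / 8"
  shows "N m t \<le> 5 / 3 * N m s"
proof -
  have b: "\<bar>\<gamma>\<bar> * (2 * K * suminf \<rho>) * N m x \<le> 1 / 4 * N m x" for x
    using small modeN_nonneg by (intro mult_right_mono) auto
  show ?thesis
    using invariant_near[OF assms(1), of m] invariant_near[OF assms(2), of m]
      invariant_const[OF assms(1,2), of m] b[of s] b[of t] by linarith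
qed

end


section \<open>Global solutions of the mode system\<close>

lemma has_vector_derivative_integral_halfline:
  fixes f :: "real \<Rightarrow> 'a::banach"
  assumes "continuous_on {0..} f" "0 \<le> t"
  shows "((\<lambda>x. integral {0..x} f) has_vector_derivative f t) (at t within {0..})"
proof -
  have "((\<lambda>x. integral {0..x} f) has_vector_derivative f t) (at t within {0..t + 1})"
    using assms by (intro integral_has_vector_derivative) (auto intro: continuous_on_subset)
  moreover have "at t within {0..t + 1} = at t within {0..}"
    by (rule at_within_nhd[of t "{..<t + 1}"]) auto
  ultimately show ?thesis by simp
qed

text \<open>The slices over a discrete factor are open, so continuity may be checked on each of
  them. No uniformity in the discrete index is involved.\<close>

lemma continuous_on_discrete_times:
  fixes f :: "'c discrete \<times> 'a::topological_space \<Rightarrow> 'b::topological_space"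
  assumes "\<And>n. continuous_on UNIV (\<lambda>t. f (n, t))"
  shows "continuous_on UNIV f"
proof -
  have "continuous_on (\<Union>n. {n} \<times> UNIV) f"
  proof (rule continuous_on_open_UN)
    fix n :: "'c discrete"
    have "continuous_on ({n} \<times> UNIV) (\<lambda>x. f (n, snd x))"
      by (rule continuous_on_compose2[OF assms[of n] continuous_on_snd]) (auto intro: continuous_on_id)
    then show "continuous_on ({n} \<times> UNIV) f"
      by (rule continuous_on_eq) auto
  qed (auto intro!: open_Times Discrete_Topology.open_discrete)
  moreover have "(\<Union>n. {n} \<times> UNIV) = (UNIV :: ('c discrete \<times> 'a) set)" by auto
  ultimately show ?thesis by simp
qed

text \<open>The whole sequence of unknown functions is encoded as one bounded continuous function on
  \<open>nat discrete \<times> real\<close>. The complete space of such functions carries the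
  supremum over all indices and times, in which Banach's fixed point theorem applies, and time
  continuity has to be verified for each index separately only.\<close>

lemma picard_sequence:
  fixes F :: "nat \<Rightarrow> real \<Rightarrow> (nat \<Rightarrow> 'b::banach) \<Rightarrow> 'b"
  assumes cont: "\<And>n y. (\<And>m. continuous_on {0..} (y m)) \<Longrightarrow> continuous_on {0..} (\<lambda>t. F n t (\<lambda>m. y m t))"
    and bnd: "\<And>n t y. norm (F n t y) \<le> B"
    and lip: "\<And>n t y y' d. (\<And>m. norm (y m - y' m) \<le> d) \<Longrightarrow> norm (F n t y - F n t y') \<le> k * d"
    and k: "0 \<le> k" "k < 1" and y0: "\<And>n. norm (y0 n) \<le> B0"
  obtains y where "\<And>n. y n 0 = y0 n"
    "\<And>n t. 0 \<le> t \<Longrightarrow> (y n has_vector_derivative F n t (\<lambda>m. y m t)) (at t within {0..})"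
proof -
  \<comment> \<open>The weight \<open>exp (- t)\<close> makes the Picard map a contraction on the whole half line.\<close>
  define G where "G w n r = F n r (\<lambda>m. exp r *\<^sub>R apply_bcontfun w (discrete m, r))"
    for w :: "(nat discrete \<times> real) \<Rightarrow>\<^sub>C 'b" and n r
  define I where "I w n t = y0 n + integral {0..t} (G w n)" for w n t
  \<comment> \<open>A fixed point \<open>w\<close> stores the solution multiplied by
    \<open>exp (- t)\<close>. Since \<open>w\<close> has to be defined for all real times,
    \<open>max 0\<close> continues it constantly to negative ones.\<close>
  define P where "P w x = exp (- max 0 (snd x)) *\<^sub>R I w (of_discrete (fst x)) (max 0 (snd x))" for w x
  have Gc: "continuous_on {0..} (G w n)" for w n
    unfolding G_def
    by (rule cont) (intro continuous_intros continuous_on_compose2[OF continuous_on_apply_bcontfun[of UNIV]] subset_UNIV)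
  have Gi: "G w n integrable_on {0..t}" for w n t
    by (rule integrable_continuous_real) (rule continuous_on_subset[OF Gc], auto)
  have Id: "(I w n has_vector_derivative G w n t) (at t within {0..})" if "0 \<le> t" for w n t
    unfolding I_def[abs_def] using has_vector_derivative_integral_halfline[OF Gc that]
    by (auto intro!: derivative_eq_intros)
  have Ic: "continuous_on {0..} (I w n)" for w n
    by (auto simp: continuous_on_eq_continuous_within intro!: has_vector_derivative_continuous[OF Id])
  have Pc: "continuous_on UNIV (P w)" for w
    unfolding P_def
    by (rule continuous_on_discrete_times)
      (auto intro!: continuous_intros continuous_on_compose2[OF Ic])
  have B: "0 \<le> B" using bnd[of 0 0 "\<lambda>_. 0"] norm_ge_zero[of "F 0 0 (\<lambda>_. 0)"] by linarith
  have I_le: "norm (I w n t) \<le> B0 + B * t" if "0 \<le> t" for w n t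
  proof -
    have "norm (integral {0..t} (G w n)) \<le> integral {0..t} (\<lambda>_. B)"
      by (rule integral_norm_bound_integral[OF Gi]) (auto simp: G_def bnd)
    then show ?thesis using that y0[of n] unfolding I_def
      by (simp add: mult.commute) (meson add_mono norm_triangle_le)
  qed
  have Pb: "norm (P w x) \<le> B0 + B" for w x
  proof -
    define t where "t = max 0 (snd x)"
    have t: "0 \<le> t" by (simp add: t_def)
    have B0: "0 \<le> B0" using y0[of 0] norm_ge_zero[of "y0 0"] by linarith
    \<comment> \<open>The integral grows at most linearly in time, so the exponential weight makes
      the image bounded.\<close>
    have "t \<le> exp t" using exp_ge_add_one_self[of t] by linarith
    then have e: "exp (- t) \<le> 1" "exp (- t) * t \<le> 1"
      using t by (auto simp: exp_minus field_simps)
    have "norm (P w x) = exp (- t) * norm (I w (of_discrete (fst x)) t)" by (simp add: P_def t_def)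
    also have "\<dots> \<le> exp (- t) * (B0 + B * t)" by (intro mult_left_mono I_le t) simp
    also have "\<dots> = exp (- t) * B0 + B * (exp (- t) * t)" by (simp add: algebra_simps)
    also have "\<dots> \<le> 1 * B0 + B * 1" by (intro add_mono mult_right_mono mult_left_mono e B B0)
    finally show ?thesis by simp
  qed
  have Pin: "P w \<in> bcontfun" for w
    by (rule bcontfun_normI[OF Pc Pb])
  define Q where "Q w = Bcontfun (P w)" for w
  have Q: "apply_bcontfun (Q w) x = P w x" for w x
    using Bcontfun_inverse[OF Pin] by (simp add: Q_def)
  have "dist (Q v) (Q w) \<le> k * dist v w" for v w
  proof (rule dist_bound)
    fix x :: "nat discrete \<times> real"
    define n t where "n = of_discrete (fst x)" and "t = max 0 (snd x)"
    have t: "0 \<le> t" by (simp add: t_def)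
    have d: "norm (G v n r - G w n r) \<le> k * dist v w * exp r" for r
    proof -
      have "norm (G v n r - G w n r) \<le> k * (exp r * dist v w)"
        unfolding G_def
      proof (rule lip)
        fix m
        have "norm (exp r *\<^sub>R apply_bcontfun v (discrete m, r) - exp r *\<^sub>R apply_bcontfun w (discrete m, r))
            = exp r * dist (apply_bcontfun v (discrete m, r)) (apply_bcontfun w (discrete m, r))"
          by (simp add: dist_norm scaleR_diff_right[symmetric])
        also have "\<dots> \<le> exp r * dist v w" by (intro mult_left_mono dist_bounded) simp
        finally show "norm (exp r *\<^sub>R apply_bcontfun v (discrete m, r) - exp r *\<^sub>R apply_bcontfun w (discrete m, r)) \<le> exp r * dist v w" .
      qed
      then show ?thesis by (simp add: mult_ac)
    qed
    \<comment> \<open>The weighted distance at time \<open>r\<close> costs a factor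
      \<open>exp r\<close>. Its integral is \<open>exp t - 1\<close>, which the weight
      \<open>exp (- t)\<close> brings below 1, so the Lipschitz constant \<open>k\<close> of the
      field is itself the contraction constant.\<close>
    have e: "((\<lambda>r. k * dist v w * exp r) has_integral (k * dist v w * exp t - k * dist v w * exp 0)) {0..t}"
      using t by (intro fundamental_theorem_of_calculus)
        (auto intro!: derivative_eq_intros simp: has_real_derivative_iff_has_vector_derivative[symmetric])
    have "norm (I v n t - I w n t) = norm (integral {0..t} (\<lambda>r. G v n r - G w n r))"
      unfolding I_def by (subst integral_diff[OF Gi Gi]) simp
    also have "\<dots> \<le> integral {0..t} (\<lambda>r. k * dist v w * exp r)"
      using e by (intro integral_norm_bound_integral integrable_diff Gi d) (auto simp: has_integral_integrable_integral)
    also have "\<dots> = k * dist v w * (exp t - 1)"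
      by (subst integral_unique[OF e]) (simp add: algebra_simps)
    finally have "norm (I v n t - I w n t) \<le> k * dist v w * (exp t - 1)" .
    then have "exp (- t) * norm (I v n t - I w n t) \<le> exp (- t) * (k * dist v w * (exp t - 1))"
      by (rule mult_left_mono) simp
    also have "\<dots> = k * dist v w * (1 - exp (- t))" by (simp add: algebra_simps exp_minus)
    also have "\<dots> \<le> k * dist v w * 1" using k by (intro mult_left_mono) auto
    finally show "dist (apply_bcontfun (Q v) x) (apply_bcontfun (Q w) x) \<le> k * dist v w"
      by (simp add: Q P_def n_def t_def dist_norm scaleR_diff_right[symmetric])
  qed
  then obtain w where w: "Q w = w"
    using banach_fix_type[OF k, of Q] by blast
  have wI: "I w n t = exp t *\<^sub>R apply_bcontfun w (discrete n, t)" if "0 \<le> t" for n t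
    using Q[of w "(discrete n, t)"] that by (simp add: w P_def exp_minus discrete_inverse)
  show ?thesis
  proof (rule that[of "I w"])
    show "I w n 0 = y0 n" for n by (simp add: I_def)
    show "(I w n has_vector_derivative F n t (\<lambda>m. I w m t)) (at t within {0..})" if "0 \<le> t" for n t
      using Id[OF that, of w n] by (simp add: G_def wI that)
  qed
qed


section \<open>The truncated vector field in the rotating frame\<close>

definition proj3 :: "complex \<Rightarrow> complex" where
  "proj3 = closest_point (cball 0 3)"

lemma cmod_proj3_le: "cmod (proj3 z) \<le> 3"
  using closest_point_in_set[of "cball (0::complex) 3" z] by (simp add: proj3_def)

lemma proj3_id: "cmod z \<le> 3 \<Longrightarrow> proj3 z = z"
  by (simp add: proj3_def closest_point_self)

text \<open>The nearest-point projection onto a convex set does not increase distances. The radius 3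
  exceeds by 1 the bound 2 that the invariants give back, more than the solution can move in unit
  time.\<close>

lemma proj3_lipschitz: "cmod (proj3 z - proj3 w) \<le> cmod (z - w)"
  using closest_point_lipschitz[of "cball (0::complex) 3" z w] by (simp add: proj3_def dist_norm)

lemma continuous_on_proj3 [continuous_intros]:
  "continuous_on S f \<Longrightarrow> continuous_on S (\<lambda>x. proj3 (f x))"
  unfolding proj3_def
  by (rule continuous_on_compose2[OF continuous_on_closest_point[of _ UNIV]]) auto

text \<open>
  In the rotating frame \<open>\<zeta>\<^sub>n = cis (\<lambda>\<^sub>n t) (p\<^sub>n + \<i> q\<^sub>n)\<close>, \<open>\<omega>\<^sub>n = cis (- \<lambda>\<^sub>n t) (p\<^sub>n - \<i> q\<^sub>n)\<close>,
  where \<open>\<lambda>\<^sub>n = freq n\<close>, the unbounded linear part disappears. The cut-off \<open>proj3\<close> makes the remaining vector field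
  globally Lipschitz; it is never active on the solutions that are used.
\<close>

definition cut_R :: "nat \<Rightarrow> real \<Rightarrow> complex \<times> complex \<Rightarrow> real" where
  "cut_R n t y = Im (cis (- 2 * freq n * t) * (proj3 (fst y) * cnj (proj3 (snd y))))"

definition cut_sigma :: "(nat \<Rightarrow> real) \<Rightarrow> real \<Rightarrow> (nat \<Rightarrow> complex \<times> complex) \<Rightarrow> real" where
  "cut_sigma \<rho> t y = (\<Sum>n. \<rho> n * cut_R n t (y n)) / 2"

definition cut_swap :: "nat \<Rightarrow> real \<Rightarrow> complex \<times> complex \<Rightarrow> complex \<times> complex" where
  "cut_swap n t y = (cis (2 * freq n * t) * proj3 (snd y), cis (- 2 * freq n * t) * proj3 (fst y))"

definition cut_field :: "real \<Rightarrow> (nat \<Rightarrow> real) \<Rightarrow> nat \<Rightarrow> real \<Rightarrow> (nat \<Rightarrow> complex \<times> complex) \<Rightarrow> complex \<times> complex" where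
  "cut_field \<gamma> \<rho> n t y = (- \<gamma> * cut_sigma \<rho> t y) *\<^sub>R cut_swap n t (y n)"

lemma norm_pair_bounds:
  fixes y :: "complex \<times> complex"
  shows "cmod (fst y) \<le> norm y" "cmod (snd y) \<le> norm y" "norm y \<le> cmod (fst y) + cmod (snd y)"
  using norm_fst_le[of "fst y" "snd y"] norm_snd_le[of "snd y" "fst y"] norm_Pair_le[of "fst y" "snd y"] by auto

lemma cut_R_bound: "\<bar>cut_R n t y\<bar> \<le> 9"
proof -
  have "\<bar>cut_R n t y\<bar> \<le> cmod (cis (- 2 * freq n * t) * (proj3 (fst y) * cnj (proj3 (snd y))))"
    unfolding cut_R_def by (rule abs_Im_le_cmod)
  also have "\<dots> = cmod (proj3 (fst y)) * cmod (proj3 (snd y))" by (simp add: norm_mult)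
  also have "\<dots> \<le> 3 * 3" by (intro mult_mono cmod_proj3_le) auto
  finally show ?thesis by simp
qed

text \<open>The difference of two products is split as
  \<open>(a - a') * cnj b + a' * cnj (b - b')\<close>. The truncated factors are at most 3, whence 6
  = 3 + 3.\<close>

lemma cut_R_lipschitz:
  assumes "norm (y - y') \<le> d" shows "\<bar>cut_R n t y - cut_R n t y'\<bar> \<le> 6 * d"
proof -
  define a b a' b' where "a = proj3 (fst y)" and "b = proj3 (snd y)" and "a' = proj3 (fst y')" and "b' = proj3 (snd y')"
  have a: "cmod (a - a') \<le> d" and b: "cmod (b - b') \<le> d"
    using proj3_lipschitz[of "fst y" "fst y'"] proj3_lipschitz[of "snd y" "snd y'"]
      norm_pair_bounds(1,2)[of "y - y'"] assms unfolding a_def a'_def b_def b'_def by auto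
  have "\<bar>cut_R n t y - cut_R n t y'\<bar> \<le> cmod (cis (- 2 * freq n * t) * ((a - a') * cnj b + a' * cnj (b - b')))"
  proof -
    have "cut_R n t y - cut_R n t y' = Im (cis (- 2 * freq n * t) * ((a - a') * cnj b + a' * cnj (b - b')))"
      unfolding cut_R_def a_def b_def a'_def b'_def minus_complex.sel(2)[symmetric]
      by (rule arg_cong[of _ _ Im]) (simp add: algebra_simps)
    then show ?thesis using abs_Im_le_cmod by metis
  qed
  also have "\<dots> = cmod ((a - a') * cnj b + a' * cnj (b - b'))" by (simp add: norm_mult)
  also have "\<dots> \<le> cmod (a - a') * cmod b + cmod a' * cmod (b - b')"
    by (rule order_trans[OF norm_triangle_ineq]) (simp add: norm_mult del: complex_cnj_diff)
  also have "\<dots> \<le> d * 3 + 3 * d"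
    using a b cmod_proj3_le unfolding a'_def b_def
    by (intro add_mono mult_mono) (auto intro: order_trans[OF norm_ge_zero])
  finally show ?thesis by simp
qed

lemma cut_swap_bound: "norm (cut_swap n t y) \<le> 6"
  by (rule order_trans[OF norm_pair_bounds(3)])
    (use cmod_proj3_le[of "fst y"] cmod_proj3_le[of "snd y"] in \<open>simp add: cut_swap_def norm_mult\<close>)

lemma cut_swap_lipschitz:
  assumes "norm (y - y') \<le> d" shows "norm (cut_swap n t y - cut_swap n t y') \<le> 2 * d"
proof (rule order_trans[OF norm_pair_bounds(3)])
  have "cmod (proj3 (fst y) - proj3 (fst y')) \<le> d" "cmod (proj3 (snd y) - proj3 (snd y')) \<le> d"
    using proj3_lipschitz[of "fst y" "fst y'"] proj3_lipschitz[of "snd y" "snd y'"]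
      norm_pair_bounds(1,2)[of "y - y'"] assms by auto
  then show "cmod (fst (cut_swap n t y - cut_swap n t y')) + cmod (snd (cut_swap n t y - cut_swap n t y')) \<le> 2 * d"
    by (simp add: cut_swap_def right_diff_distrib[symmetric] norm_mult)
qed

lemma cut_sigma_bounds:
  assumes \<rho>: "\<And>n. 0 \<le> \<rho> n" "summable \<rho>"
  shows "\<bar>cut_sigma \<rho> t y\<bar> \<le> 9 / 2 * suminf \<rho>"
    and "(\<And>m. norm (y m - y' m) \<le> d) \<Longrightarrow> \<bar>cut_sigma \<rho> t y - cut_sigma \<rho> t y'\<bar> \<le> 3 * suminf \<rho> * d"
proof -
  have b: "norm (\<rho> n * cut_R n t (y n)) \<le> 9 * \<rho> n" for n y
    using mult_left_mono[OF cut_R_bound \<rho>(1)] \<rho>(1) by (simp add: abs_mult mult.commute)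
  have s: "summable (\<lambda>n. \<rho> n * cut_R n t (y n))" for y
    by (rule summable_comparison_test'[OF summable_mult[OF \<rho>(2)] b])
  have "norm (\<Sum>n. \<rho> n * cut_R n t (y n)) \<le> (\<Sum>n. 9 * \<rho> n)"
    by (intro norm_suminf_le b summable_mult \<rho>)
  then show "\<bar>cut_sigma \<rho> t y\<bar> \<le> 9 / 2 * suminf \<rho>"
    by (simp add: cut_sigma_def suminf_mult[OF \<rho>(2)])
  assume d: "\<And>m. norm (y m - y' m) \<le> d"
  have "norm (\<Sum>n. \<rho> n * cut_R n t (y n) - \<rho> n * cut_R n t (y' n)) \<le> (\<Sum>n. (6 * d) * \<rho> n)"
  proof (intro norm_suminf_le summable_mult \<rho>)
    show "norm (\<rho> n * cut_R n t (y n) - \<rho> n * cut_R n t (y' n)) \<le> 6 * d * \<rho> n" for n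
      using mult_left_mono[OF cut_R_lipschitz[OF d] \<rho>(1)] \<rho>(1)
      by (simp add: right_diff_distrib[symmetric] abs_mult mult.commute)
  qed
  then show "\<bar>cut_sigma \<rho> t y - cut_sigma \<rho> t y'\<bar> \<le> 3 * suminf \<rho> * d"
    unfolding suminf_mult[OF \<rho>(2)] suminf_diff[OF s s, symmetric]
    by (simp add: cut_sigma_def diff_divide_distrib[symmetric] mult_ac)
qed

text \<open>The threshold 1/72 is what \<open>modeN_le\<close> asks for with \<open>K = 9\<close>,
  since 9/72 = 1/8. Here it bounds \<gamma>\<sigma> by (9/2) / 72 = 1/16. With 6 as bound of
  \<open>cut_swap\<close> this gives 6/16 = 3/8 for the size of the field, and 6/24 + 2/16 = 3/8 for
  its Lipschitz constant.\<close>

lemma cut_field_bounds: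
  assumes \<rho>: "\<And>n. 0 \<le> \<rho> n" "summable \<rho>" and small: "\<bar>\<gamma>\<bar> * suminf \<rho> \<le> 1 / 72"
  shows "norm (cut_field \<gamma> \<rho> n t y) \<le> 3 / 8"
    and "(\<And>m. norm (y m - y' m) \<le> d) \<Longrightarrow> norm (cut_field \<gamma> \<rho> n t y - cut_field \<gamma> \<rho> n t y') \<le> 3 / 8 * d"
proof -
  have g: "\<bar>\<gamma>\<bar> * \<bar>cut_sigma \<rho> t y\<bar> \<le> 1 / 16" for y
    using mult_left_mono[OF cut_sigma_bounds(1)[OF \<rho>, of t y], of "\<bar>\<gamma>\<bar>"] small by simp
  have "norm (cut_field \<gamma> \<rho> n t y) = \<bar>\<gamma>\<bar> * \<bar>cut_sigma \<rho> t y\<bar> * norm (cut_swap n t (y n))"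
    by (simp add: cut_field_def abs_mult)
  also have "\<dots> \<le> 1 / 16 * 6" by (intro mult_mono g cut_swap_bound) auto
  finally show "norm (cut_field \<gamma> \<rho> n t y) \<le> 3 / 8" by simp
  assume d: "\<And>m. norm (y m - y' m) \<le> d"
  have d0: "0 \<le> d" using order_trans[OF norm_ge_zero d] .
  have "\<bar>\<gamma>\<bar> * \<bar>cut_sigma \<rho> t y - cut_sigma \<rho> t y'\<bar> \<le> \<bar>\<gamma>\<bar> * (3 * suminf \<rho> * d)"
    by (intro mult_left_mono cut_sigma_bounds(2)[OF \<rho> d]) auto
  also have "\<dots> = 3 * d * (\<bar>\<gamma>\<bar> * suminf \<rho>)" by simp
  also have "\<dots> \<le> 3 * d * (1 / 72)" using d0 by (intro mult_left_mono small) auto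
  finally have 1: "\<bar>\<gamma>\<bar> * \<bar>cut_sigma \<rho> t y - cut_sigma \<rho> t y'\<bar> \<le> d / 24" by simp
  have "cut_field \<gamma> \<rho> n t y - cut_field \<gamma> \<rho> n t y'
      = (- \<gamma> * (cut_sigma \<rho> t y - cut_sigma \<rho> t y')) *\<^sub>R cut_swap n t (y n)
       + (- \<gamma> * cut_sigma \<rho> t y') *\<^sub>R (cut_swap n t (y n) - cut_swap n t (y' n))"
    by (simp add: cut_field_def algebra_simps)
  also have "norm \<dots> \<le> \<bar>\<gamma>\<bar> * \<bar>cut_sigma \<rho> t y - cut_sigma \<rho> t y'\<bar> * norm (cut_swap n t (y n))
       + \<bar>\<gamma>\<bar> * \<bar>cut_sigma \<rho> t y'\<bar> * norm (cut_swap n t (y n) - cut_swap n t (y' n))"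
    by (rule order_trans[OF norm_triangle_ineq]) (simp add: abs_mult)
  also have "\<dots> \<le> d / 24 * 6 + 1 / 16 * (2 * d)"
    using d0 by (intro add_mono mult_mono g 1 cut_swap_bound cut_swap_lipschitz d) auto
  finally show "norm (cut_field \<gamma> \<rho> n t y - cut_field \<gamma> \<rho> n t y') \<le> 3 / 8 * d" by simp
qed

lemma cut_field_continuous:
  assumes \<rho>: "\<And>n. 0 \<le> \<rho> n" "summable \<rho>" and y: "\<And>m. continuous_on S (y m)"
  shows "continuous_on S (\<lambda>t. cut_field \<gamma> \<rho> n t (\<lambda>m. y m t))"
proof -
  have "continuous_on S (\<lambda>t. \<Sum>m. \<rho> m * cut_R m t (y m t))"
  proof (rule continuous_on_suminf_bound)
    show "summable (\<lambda>m. 9 * \<rho> m)" by (intro summable_mult \<rho>)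
    show "norm (\<rho> m * cut_R m t (y m t)) \<le> 9 * \<rho> m" for m t
      using mult_left_mono[OF cut_R_bound \<rho>(1)] \<rho>(1) by (simp add: abs_mult mult.commute)
  qed (auto simp: cut_R_def intro!: continuous_intros y)
  then show ?thesis
    unfolding cut_field_def cut_sigma_def cut_swap_def by (intro continuous_intros y) auto
qed

lemma has_vector_derivative_cis_mult:
  "((\<lambda>t. cis (a * t)) has_vector_derivative (\<i> * a * cis (a * t))) (at t within S)"
proof -
  have "((\<lambda>t. exp (\<i> * complex_of_real a * complex_of_real t)) has_vector_derivative
      (\<i> * a * exp (\<i> * complex_of_real a * complex_of_real t))) (at t within S)"
    by (intro has_vector_derivative_real_field) (auto intro!: derivative_eq_intros)
  then show ?thesis by (simp add: cis_conv_exp mult.assoc)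
qed

text \<open>The half sum and half difference undo the change of frame. Differentiating the phases
  \<open>cis (- a * t)\<close> and \<open>cis (a * t)\<close> restores the linear part, and moving a
  phase across the coupling term exchanges it for its conjugate; these are \<open>c1\<close> and
  \<open>c2\<close>.\<close>

lemma rotating_frame_derivs:
  assumes z: "(z has_vector_derivative (- g) *\<^sub>R (cis (2 * a * t) * w t)) (at t within S)"
    and w: "(w has_vector_derivative (- g) *\<^sub>R (cis (- 2 * a * t) * z t)) (at t within S)"
  defines "p \<equiv> \<lambda>t. (cis (- a * t) * z t + cis (a * t) * w t) / 2"
    and "q \<equiv> \<lambda>t. (cis (- a * t) * z t - cis (a * t) * w t) / (2 * \<i>)"
  shows "(p has_vector_derivative (a *\<^sub>R q t - g *\<^sub>R p t)) (at t within S)"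
    "(q has_vector_derivative (g *\<^sub>R q t - a *\<^sub>R p t)) (at t within S)"
proof -
  have c1: "cis (- a * t) * cis (2 * a * t) = cis (a * t)" and c2: "cis (a * t) * cis (- 2 * a * t) = cis (- a * t)"
    by (simp_all add: cis_mult)
  have alg: "e * ((- g) *\<^sub>R (E * y)) + \<i> * complex_of_real b * e * x = \<i> * b * (e * x) - g * (e' * y)"
    if "e * E = e'" for e E e' x y :: complex and b
    by (simp add: that[symmetric] scaleR_conv_of_real algebra_simps)
  have Z: "((\<lambda>t. cis (- a * t) * z t) has_vector_derivative
      (\<i> * complex_of_real (- a) * (cis (- a * t) * z t) - g * (cis (a * t) * w t))) (at t within S)"
    using has_vector_derivative_mult[OF has_vector_derivative_cis_mult[of "- a"] z]
    by (rule has_vector_derivative_eq_rhs) (rule alg[OF c1])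
  have W: "((\<lambda>t. cis (a * t) * w t) has_vector_derivative
      (\<i> * complex_of_real a * (cis (a * t) * w t) - g * (cis (- a * t) * z t))) (at t within S)"
    using has_vector_derivative_mult[OF has_vector_derivative_cis_mult[of "a"] w]
    by (rule has_vector_derivative_eq_rhs) (rule alg[OF c2])
  show "(p has_vector_derivative (a *\<^sub>R q t - g *\<^sub>R p t)) (at t within S)"
    unfolding p_def q_def
    by (rule has_vector_derivative_eq_rhs[OF has_vector_derivative_divide[OF has_vector_derivative_add[OF Z W]]])
      (simp add: scaleR_conv_of_real field_simps)
  show "(q has_vector_derivative (g *\<^sub>R q t - a *\<^sub>R p t)) (at t within S)"
    unfolding p_def q_def
    by (rule has_vector_derivative_eq_rhs[OF has_vector_derivative_divide[OF has_vector_derivative_diff[OF Z W]]])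
      (simp add: scaleR_conv_of_real field_simps)
qed


text \<open>Phases leave moduli unchanged, and p + \<i> q, p - \<i> q have squared moduli with sum
  \<open>2 * modeN p q\<close>. In their product with one conjugated factor the two phases add up to
  \<open>cis (- 2 * a * t)\<close>.\<close>

lemma rotating_frame_mode:
  fixes z w :: complex and a t :: real
  defines "p \<equiv> (cis (- a * t) * z + cis (a * t) * w) / 2"
    and "q \<equiv> (cis (- a * t) * z - cis (a * t) * w) / (2 * \<i>)"
  shows "modeN p q = ((cmod z)\<^sup>2 + (cmod w)\<^sup>2) / 2"
    and "modeR p q = Im (cis (- 2 * a * t) * (z * cnj w))"
proof -
  define x y where "x = cis (- a * t) * z" and "y = cis (a * t) * w"
  have p: "p = (x + y) / 2" and q: "q = (x - y) / (2 * \<i>)" by (simp_all add: p_def q_def x_def y_def)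
  have re: "Re p = (Re x + Re y) / 2" "Im p = (Im x + Im y) / 2"
    "Re q = (Im x - Im y) / 2" "Im q = - (Re x - Re y) / 2"
    by (simp_all add: p q Re_divide Im_divide power2_eq_square field_simps)
  have "modeN p q = ((cmod x)\<^sup>2 + (cmod y)\<^sup>2) / 2"
    unfolding modeN_def re cmod_power2 by (simp add: power2_eq_square field_simps)
  then show "modeN p q = ((cmod z)\<^sup>2 + (cmod w)\<^sup>2) / 2"
    by (simp add: x_def y_def norm_mult)
  have "modeR p q = Im (x * cnj y)"
    unfolding modeR_def re by (simp add: field_simps)
  also have "x * cnj y = cis (- 2 * a * t) * (z * cnj w)"
  proof -
    have "cis (- a * t) * cis (- (a * t)) = cis (- 2 * a * t)" by (simp add: cis_mult mult.assoc)
    moreover have "x * cnj y = (cis (- a * t) * cis (- (a * t))) * (z * cnj w)"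
      by (simp add: x_def y_def cis_cnj mult_ac)
    ultimately show ?thesis by simp
  qed
  finally show "modeR p q = Im (cis (- 2 * a * t) * (z * cnj w))" .
qed

lemma sum_squares_le_imp_le:
  fixes x y :: real
  assumes "x\<^sup>2 + y\<^sup>2 \<le> r\<^sup>2" "0 \<le> r" shows "x \<le> r \<and> y \<le> r"
proof -
  have "x\<^sup>2 \<le> r\<^sup>2" "y\<^sup>2 \<le> r\<^sup>2"
    using assms(1) zero_le_power2[of x] zero_le_power2[of y] by linarith+
  then show ?thesis using power2_le_imp_le assms(2) by blast
qed

text \<open>While both rotating coordinates stay within 3, the truncation is inactive and
  \<open>modeN\<close>, half the sum of their squares, is at most 9. This is the value of
  \<open>K\<close> with which the invariants are applied.\<close>

theorem mode_system_global:
  fixes \<gamma> :: real and \<rho> :: "nat \<Rightarrow> real" and p0 q0 :: "nat \<Rightarrow> complex"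
  assumes \<rho>: "\<And>n. 0 \<le> \<rho> n" "summable \<rho>" and small: "\<bar>\<gamma>\<bar> * suminf \<rho> \<le> 1 / 72"
    and init: "\<And>n. modeN (p0 n) (q0 n) \<le> 1"
  obtains p q \<sigma> where "mode_system \<gamma> \<rho> {0..} 9 p q \<sigma>"
    "\<And>n. p n 0 = p0 n" "\<And>n. q n 0 = q0 n"
    "\<And>n t. 0 \<le> t \<Longrightarrow> modeN (p n t) (q n t) \<le> 2"
proof -
  define y0 where "y0 n = (p0 n + \<i> * q0 n, p0 n - \<i> * q0 n)" for n
  have y0_sq: "(cmod (fst (y0 n)))\<^sup>2 + (cmod (snd (y0 n)))\<^sup>2 = 2 * modeN (p0 n) (q0 n)" for n
    unfolding cmod_power2 modeN_def by (simp add: y0_def power2_eq_square algebra_simps)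
  have y0_le: "cmod (fst (y0 n)) \<le> 2 \<and> cmod (snd (y0 n)) \<le> 2" for n
    by (rule sum_squares_le_imp_le) (use y0_sq[of n] init[of n] in auto)
  have y0_norm: "norm (y0 n) \<le> 4" for n
    using norm_pair_bounds(3)[of "y0 n"] y0_le[of n] by linarith
  obtain y where y_init: "\<And>n. y n 0 = y0 n"
    and y_deriv: "\<And>n t. 0 \<le> t \<Longrightarrow>
      (y n has_vector_derivative cut_field \<gamma> \<rho> n t (\<lambda>m. y m t)) (at t within {0..})"
  proof (rule picard_sequence[of "cut_field \<gamma> \<rho>" "3 / 8" "3 / 8" y0 4])
    show "continuous_on {0..} (\<lambda>t. cut_field \<gamma> \<rho> n t (\<lambda>m. y m t))"
      if "\<And>m. continuous_on {0..} (y m)" for n y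
      by (rule cut_field_continuous[OF \<rho> that])
  qed (use cut_field_bounds[OF \<rho> small] y0_norm in auto)
  define p q \<sigma> where "p n t = (cis (- freq n * t) * fst (y n t) + cis (freq n * t) * snd (y n t)) / 2"
    and "q n t = (cis (- freq n * t) * fst (y n t) - cis (freq n * t) * snd (y n t)) / (2 * \<i>)"
    and "\<sigma> t = cut_sigma \<rho> t (\<lambda>m. y m t)" for n t
  have N: "modeN (p n t) (q n t) = ((cmod (fst (y n t)))\<^sup>2 + (cmod (snd (y n t)))\<^sup>2) / 2" for n t
    unfolding p_def q_def by (rule rotating_frame_mode)
  \<comment> \<open>This is proved for every convex time set on which the truncation is inactive: it
    is applied to \<open>{0..T}\<close> during the continuation and to the whole half line at the
    end.\<close>
  have system: "mode_system \<gamma> \<rho> S 9 p q \<sigma>"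
    if S: "convex S" "S \<subseteq> {0..}"
      and le3: "\<And>n t. t \<in> S \<Longrightarrow> cmod (fst (y n t)) \<le> 3 \<and> cmod (snd (y n t)) \<le> 3" for S
  proof
    show "modeN (p n t) (q n t) \<le> 9" if "t \<in> S" for n t
      using power_mono[of "cmod (fst (y n t))" 3 2] power_mono[of "cmod (snd (y n t))" 3 2] le3[OF that, of n]
      by (simp add: N)
    have der: "(p n has_vector_derivative (freq n *\<^sub>R q n t - (\<gamma> * \<sigma> t) *\<^sub>R p n t)) (at t within S)
        \<and> (q n has_vector_derivative ((\<gamma> * \<sigma> t) *\<^sub>R q n t - freq n *\<^sub>R p n t)) (at t within S)"
      if t: "t \<in> S" for n t
    proof -
      have d: "(y n has_vector_derivative cut_field \<gamma> \<rho> n t (\<lambda>m. y m t)) (at t within S)"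
        using y_deriv[of t n] t S(2) by (auto intro: has_vector_derivative_within_subset)
      have "((\<lambda>t. fst (y n t)) has_vector_derivative
          (- (\<gamma> * \<sigma> t)) *\<^sub>R (cis (2 * freq n * t) * snd (y n t))) (at t within S)"
        using bounded_linear.has_vector_derivative[OF bounded_linear_fst d] le3[OF t, of n]
        by (simp add: cut_field_def cut_swap_def \<sigma>_def proj3_id)
      moreover have "((\<lambda>t. snd (y n t)) has_vector_derivative
          (- (\<gamma> * \<sigma> t)) *\<^sub>R (cis (- 2 * freq n * t) * fst (y n t))) (at t within S)"
        using bounded_linear.has_vector_derivative[OF bounded_linear_snd d] le3[OF t, of n]
        by (simp add: cut_field_def cut_swap_def \<sigma>_def proj3_id)
      ultimately show ?thesis
        unfolding p_def[abs_def] q_def[abs_def] by (intro conjI rotating_frame_derivs)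
    qed
    show "(p n has_vector_derivative (freq n *\<^sub>R q n t - (\<gamma> * \<sigma> t) *\<^sub>R p n t)) (at t within S)"
      "(q n has_vector_derivative ((\<gamma> * \<sigma> t) *\<^sub>R q n t - freq n *\<^sub>R p n t)) (at t within S)"
      if "t \<in> S" for n t
      using der[OF that] by auto
    show "\<sigma> t = (\<Sum>n. \<rho> n * modeR (p n t) (q n t)) / 2" if t: "t \<in> S" for t
      using le3[OF t] unfolding \<sigma>_def cut_sigma_def cut_R_def p_def q_def rotating_frame_mode
      by (simp add: proj3_id)
  qed (use \<rho> S in auto)
  \<comment> \<open>Continuation: \<open>y\<close> moves by at most \<open>3 / 8\<close> in unit time, and the invariants improve the bound
    \<open>3\<close> back to \<open>2\<close>.\<close>
  have improve: "cmod (fst (y n t)) \<le> 2 \<and> cmod (snd (y n t)) \<le> 2 \<and> modeN (p n t) (q n t) \<le> 2"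
    if le3: "\<And>n t. t \<in> {0..T} \<Longrightarrow> cmod (fst (y n t)) \<le> 3 \<and> cmod (snd (y n t)) \<le> 3" and t: "t \<in> {0..T}" for T n t
  proof -
    interpret mode_system \<gamma> \<rho> "{0..T}" 9 p q \<sigma> by (rule system) (use le3 in auto)
    have "N n t \<le> 5 / 3 * N n 0" by (rule modeN_le) (use t small in auto)
    also have "N n 0 \<le> 1" unfolding N y_init y0_sq using init by simp
    finally have N_le: "N n t \<le> 5 / 3" by simp
    \<comment> \<open>The squares of the two moduli add up to twice \<open>N n t\<close>, hence to
      at most 10/3, below 2 squared.\<close>
    then have "cmod (fst (y n t)) \<le> 2 \<and> cmod (snd (y n t)) \<le> 2"
      by (intro sum_squares_le_imp_le) (simp_all add: N)
    then show ?thesis using N_le by simp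
  qed
  have step: "norm (y n t - y n s) \<le> 3 / 8 * (t - s)" if "0 \<le> s" "s \<le> t" for n s t
  proof -
    have "norm (y n t - y n s) \<le> 3 / 8 * norm (t - s)"
    proof (rule differentiable_bound[where S="{0..}" and f'="\<lambda>t h. h *\<^sub>R cut_field \<gamma> \<rho> n t (\<lambda>m. y m t)"])
      show "(y n has_derivative (\<lambda>h. h *\<^sub>R cut_field \<gamma> \<rho> n x (\<lambda>m. y m x))) (at x within {0..})" if "x \<in> {0..}" for x
        using y_deriv[of x n] that by (simp add: has_vector_derivative_def)
      show "onorm (\<lambda>h. h *\<^sub>R cut_field \<gamma> \<rho> n x (\<lambda>m. y m x)) \<le> 3 / 8" for x
        using mult_left_mono[OF cut_field_bounds(1)[OF \<rho> small, of n x "\<lambda>m. y m x"] abs_ge_zero]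
        by (intro onorm_le) (simp add: mult.commute)
    qed (use that in auto)
    then show ?thesis using that by simp
  qed
  have upto: "\<forall>n t. t \<in> {0..real k} \<longrightarrow> cmod (fst (y n t)) \<le> 2 \<and> cmod (snd (y n t)) \<le> 2" for k
  proof (induction k)
    case 0
    then show ?case using y0_le by (auto simp: y_init)
  next
    case (Suc k)
    have "cmod (fst (y n t)) \<le> 3 \<and> cmod (snd (y n t)) \<le> 3" if t: "t \<in> {0..real (Suc k)}" for n t
    proof (cases "t \<le> real k")
      case True
      then have "cmod (fst (y n t)) \<le> 2" "cmod (snd (y n t)) \<le> 2" using Suc t by auto
      then show ?thesis by linarith
    next
      case False
      have "norm (y n t - y n (real k)) \<le> 3 / 8 * (t - real k)" using False by (intro step) auto
      also have "\<dots> \<le> 1" using t by simp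
      finally have "cmod (fst (y n t) - fst (y n (real k))) \<le> 1" "cmod (snd (y n t) - snd (y n (real k))) \<le> 1"
        using norm_pair_bounds(1,2)[of "y n t - y n (real k)"] by auto
      moreover have "cmod (fst (y n (real k))) \<le> 2" "cmod (snd (y n (real k))) \<le> 2" using Suc by auto
      ultimately show ?thesis
        using norm_triangle_sub[of "fst (y n t)" "fst (y n (real k))"]
          norm_triangle_sub[of "snd (y n t)" "snd (y n (real k))"] by linarith
    qed
    then show ?case using improve[of "real (Suc k)"] by blast
  qed
  have le3: "cmod (fst (y n t)) \<le> 3 \<and> cmod (snd (y n t)) \<le> 3" if "0 \<le> t" for n t
  proof -
    obtain k where "t \<le> real k" using real_arch_simple by blast
    then have "cmod (fst (y n t)) \<le> 2" "cmod (snd (y n t)) \<le> 2" using upto[of k] that by auto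
    then show ?thesis by linarith
  qed
  show ?thesis
  proof (rule that[of p q \<sigma>])
    show "mode_system \<gamma> \<rho> {0..} 9 p q \<sigma>" by (rule system) (use le3 in auto)
    show "modeN (p n t) (q n t) \<le> 2" if "0 \<le> t" for n t
      using improve[of t t n] le3 that by auto
    show "p n 0 = p0 n" "q n 0 = q0 n" for n
      by (simp_all add: p_def q_def y_init y0_def)
  qed
qed


section \<open>Change of time\<close>

text \<open>Derivatives are taken within sets, so that the initial time, an endpoint, is covered.
  The difference quotient of \<open>T\<close> is composed with \<open>g\<close>, which is injective
  as a right inverse, and then inverted.\<close>

lemma has_real_derivative_right_inverse:
  fixes g T :: "real \<Rightarrow> real"
  assumes T: "(T has_real_derivative D) (at (g t) within S)" and D: "D \<noteq> 0"
    and g: "\<And>y. y \<in> S' \<Longrightarrow> g y \<in> S" "\<And>y. y \<in> S' \<Longrightarrow> T (g y) = y"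
    and t: "t \<in> S'" and cont: "continuous (at t within S') g"
  shows "(g has_real_derivative 1 / D) (at t within S')"
proof -
  have ev: "\<forall>\<^sub>F y in at t within S'. g y \<in> S \<and> g y \<noteq> g t \<and> T (g y) = y"
    unfolding eventually_at_filter using g t by (intro always_eventually) metis
  have "filterlim g (at (g t) within S) (at t within S')"
    unfolding filterlim_at using ev cont by (auto simp: continuous_within elim: eventually_mono)
  moreover have "((\<lambda>x. (T x - T (g t)) / (x - g t)) \<longlongrightarrow> D) (at (g t) within S)"
    using T by (simp add: has_field_derivative_iff)
  ultimately have "((\<lambda>y. (T (g y) - T (g t)) / (g y - g t)) \<longlongrightarrow> D) (at t within S')"
    by (rule filterlim_compose[rotated])
  then have "((\<lambda>y. inverse ((T (g y) - T (g t)) / (g y - g t))) \<longlongrightarrow> inverse D) (at t within S')"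
    using D by (rule tendsto_inverse)
  moreover have "\<forall>\<^sub>F y in at t within S'. inverse ((T (g y) - T (g t)) / (g y - g t)) = (g y - g t) / (y - t)"
    using ev by (rule eventually_mono) (use g(2)[OF t] in auto)
  ultimately show ?thesis
    unfolding has_field_derivative_iff by (auto simp: inverse_eq_divide elim: Lim_transform_eventually)
qed

lemma within_derivative_nonneg_imp_le:
  fixes f :: "real \<Rightarrow> real"
  assumes "a \<le> b" and d: "\<And>x. x \<in> {a..b} \<Longrightarrow> (f has_real_derivative f' x) (at x within {a..b})"
    and nn: "\<And>x. x \<in> {a..b} \<Longrightarrow> 0 \<le> f' x"
  shows "f a \<le> f b"
proof -
  have "\<exists>x\<in>{a..b}. f b - f a = f' x * (b - a)"
    using assms(1) d by (intro mvt_very_simple) (auto simp: has_field_derivative_def)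
  then obtain x where "x \<in> {a..b}" "f b - f a = f' x * (b - a)" by blast
  moreover have "0 \<le> f' x * (b - a)" using nn calculation(1) assms(1) by simp
  ultimately show ?thesis by linarith
qed

text \<open>The integral of \<open>h\<close> is the old time as a function of the new one, and
  \<theta> is its inverse. The lower bound 1/2 makes the integral reach every time t \<ge> 0 before
  2t, and makes the inverse Lipschitz with constant 2.\<close>

lemma increasing_reparametrization:
  fixes h :: "real \<Rightarrow> real"
  assumes cont: "continuous_on {0..} h" and h: "\<And>x. 0 \<le> x \<Longrightarrow> 1 / 2 \<le> h x"
  obtains \<theta> where "\<theta> 0 = 0" "\<And>t. 0 \<le> t \<Longrightarrow> 0 \<le> \<theta> t"
    "\<And>t. 0 \<le> t \<Longrightarrow> (\<theta> has_real_derivative 1 / h (\<theta> t)) (at t within {0..})"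
proof -
  define T where "T x = integral {0..x} h" for x
  have T': "(T has_real_derivative h x) (at x within {0..})" if "0 \<le> x" for x
    using has_vector_derivative_integral_halfline[OF cont that]
    by (simp add: T_def[abs_def] has_real_derivative_iff_has_vector_derivative)
  have T0: "T 0 = 0" by (simp add: T_def)
  have Tc: "continuous_on {0..} T"
    by (auto simp: continuous_on_eq_continuous_within intro!: DERIV_continuous[OF T'])
  have grow: "(y - x) / 2 \<le> T y - T x" if "0 \<le> x" "x \<le> y" for x y
  proof -
    have "T x - x / 2 \<le> T y - y / 2"
    proof (rule within_derivative_nonneg_imp_le[of x y "\<lambda>x. T x - x / 2"])
      show "((\<lambda>x. T x - x / 2) has_real_derivative h z - 1 / 2) (at z within {x..y})" if "z \<in> {x..y}" for z
        using that \<open>0 \<le> x\<close> by (auto intro!: derivative_eq_intros DERIV_subset[OF T'])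
      show "0 \<le> h z - 1 / 2" if "z \<in> {x..y}" for z
        using h[of z] that \<open>0 \<le> x\<close> by simp
    qed (use that in auto)
    then show ?thesis by (simp add: field_simps)
  qed
  have "\<exists>x\<ge>0. T x = t" if "0 \<le> t" for t
  proof -
    have "\<exists>x. 0 \<le> x \<and> x \<le> 2 * t \<and> T x = t"
      using grow[of 0 "2 * t"] that T0
      by (intro IVT') (auto intro: continuous_on_subset[OF Tc])
    then show ?thesis by auto
  qed
  then obtain \<theta> where \<theta>: "\<And>t. 0 \<le> t \<Longrightarrow> 0 \<le> \<theta> t" "\<And>t. 0 \<le> t \<Longrightarrow> T (\<theta> t) = t"
    by metis
  have lip: "\<bar>\<theta> s - \<theta> t\<bar> \<le> 2 * \<bar>s - t\<bar>" if "0 \<le> s" "0 \<le> t" for s t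
    using grow[of "\<theta> s" "\<theta> t"] grow[of "\<theta> t" "\<theta> s"] \<theta> that by (cases "\<theta> s \<le> \<theta> t") auto
  have "continuous (at t within {0..}) \<theta>" if "0 \<le> t" for t
    unfolding continuous_within_eps_delta
  proof (intro allI impI)
    fix e :: real assume e: "0 < e"
    show "\<exists>d>0. \<forall>x'\<in>{0..}. dist x' t < d \<longrightarrow> dist (\<theta> x') (\<theta> t) < e"
      by (rule exI[of _ "e / 2"]) (use lip[OF _ that] e in \<open>fastforce simp: dist_real_def\<close>)
  qed
  then have "(\<theta> has_real_derivative 1 / h (\<theta> t)) (at t within {0..})" if "0 \<le> t" for t
    using T'[of "\<theta> t"] \<theta> h[of "\<theta> t"] that
    by (intro has_real_derivative_right_inverse[where T=T and S="{0..}"]) auto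
  moreover have "\<theta> 0 = 0" using lip[of 0 0] grow[of 0 "\<theta> 0"] \<theta>[of 0] T0 by auto
  ultimately show ?thesis using that \<theta> by blast
qed

section \<open>From the cubic system back to the wave equation\<close>

context mode_system
begin

text \<open>The wave speed as a function of the new variables. Since |p_k|^2 / k = a k^2 |u_k|^2,
  \<open>momentum\<close> is \<open>a\<close> times half the Dirichlet energy, and the relation a (1
  + c E) = 1 turns into a = 1 - \<gamma> \<open>momentum\<close>.\<close>

definition momentum where "momentum t = (\<Sum>n. \<rho> n * (1 / freq n * (cmod (p n t))\<^sup>2))"
definition speed where "speed t = 1 - \<gamma> * momentum t"

lemma cmod_p_sq_le: "t \<in> S \<Longrightarrow> \<bar>(cmod (p n t))\<^sup>2\<bar> \<le> K"
  using bound[of t n] by (simp add: modeN_eq) (smt (verit) zero_le_power2)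

lemma inverse_freq_le: "\<bar>1 / freq n\<bar> \<le> 1"
  using freq_ge_1[of n] by simp

text \<open>The weight 1 / freq cancels the frequency in the derivative of |p|^2, so the linear part
  sums to 2\<sigma>; the coupling contributes -2\<gamma>\<sigma> \<open>momentum\<close>. The two
  parts combine into a multiple of \<open>speed\<close>, which therefore obeys a linear
  equation.\<close>

lemma momentum_deriv:
  assumes "t \<in> S"
  shows "(momentum has_real_derivative 2 * \<sigma> t * speed t) (at t within S)"
proof -
  have d: "((\<lambda>t. (cmod (p n t))\<^sup>2) has_real_derivative freq n * R n t - 2 * \<gamma> * \<sigma> t * (cmod (p n t))\<^sup>2) (at t within S)"
    if "t \<in> S" for n t
    unfolding cmod_power2 modeR_def
    by (rule DERIV_cong, (rule DERIV_add DERIV_power component_derivs that)+)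
      (simp add: algebra_simps power2_eq_square)
  have eq: "1 / freq n * (freq n * R n t - 2 * \<gamma> * \<sigma> t * (cmod (p n t))\<^sup>2)
      = R n t - (2 * \<gamma> * \<sigma> t) * (1 / freq n * (cmod (p n t))\<^sup>2)" for n t
    using freq_pos[of n] by (simp add: field_simps)
  have "((\<lambda>t. \<Sum>n. \<rho> n * (1 / freq n * (cmod (p n t))\<^sup>2)) has_real_derivative
     (\<Sum>n. \<rho> n * (1 / freq n * (freq n * R n t - 2 * \<gamma> * \<sigma> t * (cmod (p n t))\<^sup>2)))) (at t within S)"
  proof (rule weighted_deriv[where B=1])
    show "\<bar>1 / freq n * (freq n * R n t - 2 * \<gamma> * \<sigma> t * (cmod (p n t))\<^sup>2)\<bar>
        \<le> K + 2 * \<bar>\<gamma>\<bar> * (K * suminf \<rho>) * K" if t: "t \<in> S" for n t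
    proof -
      have "\<bar>1 / freq n * (2 * \<gamma> * \<sigma> t * (cmod (p n t))\<^sup>2)\<bar> \<le> 1 * (2 * \<bar>\<gamma>\<bar> * (K * suminf \<rho>) * K)"
        unfolding abs_mult[of "1 / freq n"]
        by (intro mult_mono inverse_freq_le \<gamma>\<sigma>_bound t cmod_p_sq_le) auto
      then have "\<bar>(2 * \<gamma> * \<sigma> t) * (1 / freq n * (cmod (p n t))\<^sup>2)\<bar> \<le> 2 * \<bar>\<gamma>\<bar> * (K * suminf \<rho>) * K"
        by (simp add: mult_ac)
      then show ?thesis unfolding eq using abs_R_le[OF t, of n] by linarith
    qed
  qed (use assms inverse_freq_le cmod_p_sq_le d in auto)
  moreover have "(\<Sum>n. \<rho> n * (1 / freq n * (freq n * R n t - 2 * \<gamma> * \<sigma> t * (cmod (p n t))\<^sup>2)))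
      = 2 * \<sigma> t * speed t"
  proof -
    have "summable (\<lambda>n. \<rho> n * (1 * R n t))"
      by (rule weighted_summable[where B=1]) (use assms abs_R_le in auto)
    then have 1: "(\<lambda>n. \<rho> n * R n t) sums (2 * \<sigma> t)" using assms by (simp add: \<sigma>_eq summable_sums)
    have "summable (\<lambda>n. \<rho> n * (1 / freq n * (cmod (p n t))\<^sup>2))"
      by (rule weighted_summable[where B=1]) (use assms inverse_freq_le cmod_p_sq_le in auto)
    then have "(\<lambda>n. \<rho> n * R n t - (2 * \<gamma> * \<sigma> t) * (\<rho> n * (1 / freq n * (cmod (p n t))\<^sup>2)))
        sums (2 * \<sigma> t - (2 * \<gamma> * \<sigma> t) * momentum t)"
      unfolding momentum_def by (intro sums_diff 1 sums_mult summable_sums)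
    then show ?thesis
      unfolding eq by (simp add: sums_iff speed_def algebra_simps)
  qed
  ultimately show ?thesis by (simp add: momentum_def[abs_def])
qed

lemma speed_deriv:
  assumes "t \<in> S"
  shows "(speed has_real_derivative - 2 * \<gamma> * \<sigma> t * speed t) (at t within S)"
  unfolding speed_def[abs_def]
  by (auto intro!: derivative_eq_intros momentum_deriv assms simp: speed_def)

lemma sqrt_speed_deriv:
  assumes "t \<in> S" "0 < speed t"
  shows "((\<lambda>t. sqrt (speed t)) has_real_derivative - \<gamma> * \<sigma> t * sqrt (speed t)) (at t within S)"
    and "((\<lambda>t. 1 / sqrt (speed t)) has_real_derivative \<gamma> * \<sigma> t / sqrt (speed t)) (at t within S)"
proof -
  have sq: "sqrt (speed t) * sqrt (speed t) = speed t" using assms(2) by simp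
  have eq: "inverse (sqrt (speed t)) / 2 * (- 2 * \<gamma> * \<sigma> t * speed t) = - \<gamma> * \<sigma> t * sqrt (speed t)"
    using assms(2) by (subst sq[symmetric]) (simp add: field_simps)
  show d: "((\<lambda>t. sqrt (speed t)) has_real_derivative - \<gamma> * \<sigma> t * sqrt (speed t)) (at t within S)"
    by (rule DERIV_cong[OF DERIV_chain2[OF DERIV_real_sqrt[OF assms(2)] speed_deriv[OF assms(1)]] eq])
  show "((\<lambda>t. 1 / sqrt (speed t)) has_real_derivative \<gamma> * \<sigma> t / sqrt (speed t)) (at t within S)"
    by (rule DERIV_cong[OF DERIV_divide[OF DERIV_const d]]) (use assms(2) in \<open>auto simp: field_simps\<close>)
qed

text \<open>Half of the logarithmic derivative of \<open>speed\<close> is -\<gamma>\<sigma>.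
  Dividing \<open>p\<close> and multiplying \<open>q\<close> by the square root of
  \<open>speed\<close> removes exactly the terms with \<gamma>\<sigma>, and the wave equation with
  variable speed remains.\<close>

lemma field_mode_derivs:
  assumes t: "t \<in> S" and pos: "0 < speed t"
  shows "((\<lambda>t. (1 / sqrt (speed t)) *\<^sub>R p n t) has_vector_derivative
        (freq n / speed t) *\<^sub>R (sqrt (speed t) *\<^sub>R q n t)) (at t within S)"
    and "((\<lambda>t. sqrt (speed t) *\<^sub>R q n t) has_vector_derivative
        (- (freq n * speed t)) *\<^sub>R ((1 / sqrt (speed t)) *\<^sub>R p n t)) (at t within S)"
proof -
  define r where "r = sqrt (speed t)"
  have r: "0 < r" "speed t = r * r" using pos by (auto simp: r_def)
  show "((\<lambda>t. (1 / sqrt (speed t)) *\<^sub>R p n t) has_vector_derivative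
        (freq n / speed t) *\<^sub>R (sqrt (speed t) *\<^sub>R q n t)) (at t within S)"
    by (rule has_vector_derivative_eq_rhs[OF has_vector_derivative_scaleR[OF sqrt_speed_deriv(2)[OF t pos] p_deriv[OF t]]])
      (use r in \<open>simp add: r_def[symmetric] algebra_simps\<close>)
  show "((\<lambda>t. sqrt (speed t) *\<^sub>R q n t) has_vector_derivative
        (- (freq n * speed t)) *\<^sub>R ((1 / sqrt (speed t)) *\<^sub>R p n t)) (at t within S)"
    by (rule has_vector_derivative_eq_rhs[OF has_vector_derivative_scaleR[OF sqrt_speed_deriv(1)[OF t pos] q_deriv[OF t]]])
      (use r in \<open>simp add: r_def[symmetric] algebra_simps\<close>)
qed

end


theorem kirchhoff_modes_global:
  fixes c :: real and f g :: "nat \<Rightarrow> complex"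
  assumes fs: "summable (\<lambda>n. freq n ^ 3 * (cmod (f n))\<^sup>2)" and gs: "summable (\<lambda>n. freq n * (cmod (g n))\<^sup>2)"
    and small: "\<bar>c\<bar> * ((\<Sum>n. freq n ^ 3 * (cmod (f n))\<^sup>2) + (\<Sum>n. freq n * (cmod (g n))\<^sup>2)) \<le> 1 / 400"
  obtains u v a M where
    "\<And>n. u n 0 = f n" "\<And>n. v n 0 = g n"
    "\<And>n t. 0 \<le> t \<Longrightarrow> (u n has_vector_derivative v n t) (at t within {0..})"
    "\<And>n t. 0 \<le> t \<Longrightarrow> (v n has_vector_derivative (- ((a t)\<^sup>2 * (freq n)\<^sup>2)) *\<^sub>R u n t) (at t within {0..})"
    "\<And>t. 0 \<le> t \<Longrightarrow> 1 / 2 \<le> a t \<and> a t \<le> 2"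
    "\<And>t. 0 \<le> t \<Longrightarrow> a t * (1 + 2 * c * (\<Sum>n. (freq n)\<^sup>2 * (cmod (u n t))\<^sup>2)) = 1"
    "\<And>t. 0 \<le> t \<Longrightarrow> \<exists>a'. (a has_real_derivative a') (at t within {0..}) \<and> \<bar>a'\<bar> \<le> M"
    "\<And>n t. 0 \<le> t \<Longrightarrow> freq n ^ 3 * (cmod (u n t))\<^sup>2 + freq n * (cmod (v n t))\<^sup>2
        \<le> 8 * (freq n ^ 3 * (cmod (f n))\<^sup>2 + freq n * (cmod (g n))\<^sup>2)"
proof -
  \<comment> \<open>The sums here run over positive frequencies and are half of the Dirichlet
    energy, hence the factor 2.\<close>
  define \<gamma> where "\<gamma> = 2 * c"
  define r where "r n = sqrt (freq n)" for n
  have r: "0 < r n" "r n * r n = freq n" "(r n)\<^sup>2 = freq n" for n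
    using freq_pos[of n] by (auto simp: r_def)
  define E where "E = (\<Sum>n. (freq n)\<^sup>2 * (cmod (f n))\<^sup>2)"
  have f_le: "(freq n)\<^sup>2 * x \<le> freq n ^ 3 * x" if "0 \<le> x" for n x
    by (intro mult_right_mono power_increasing freq_ge_1 that) auto
  have f2s: "summable (\<lambda>n. (freq n)\<^sup>2 * (cmod (f n))\<^sup>2)"
    by (rule summable_comparison_test'[OF fs, of 0]) (use f_le in auto)
  have E: "0 \<le> E" "E \<le> (\<Sum>n. freq n ^ 3 * (cmod (f n))\<^sup>2)"
    unfolding E_def by (auto intro!: suminf_nonneg suminf_le f2s fs f_le)
  have gnn: "0 \<le> (\<Sum>n. freq n * (cmod (g n))\<^sup>2)"
    using gs freq_pos by (intro suminf_nonneg) (auto simp: less_imp_le)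
  have "\<bar>c\<bar> * E \<le> 1 / 400"
    by (rule order_trans[OF mult_left_mono small]) (use E gnn in auto)
  then have \<gamma>E: "\<bar>\<gamma> * E\<bar> \<le> 1 / 200" using E by (simp add: \<gamma>_def abs_mult)
  define a0 where "a0 = 1 / (1 + \<gamma> * E)"
  have b0: "0 < 1 + \<gamma> * E" using \<gamma>E by linarith
  have a0: "1 / 2 \<le> a0" "a0 \<le> 2" "0 < a0" "1 / a0 \<le> 2"
    using \<gamma>E b0 by (auto simp: a0_def field_simps)
  define w where "w = sqrt a0"
  have w: "0 < w" "w * w = a0" "w\<^sup>2 = a0" using a0 by (auto simp: w_def)
  define P Q where "P n = complex_of_real (w * r n * freq n) * f n" and "Q n = complex_of_real (r n / w) * g n" for n
  have Psq: "(cmod (P n))\<^sup>2 = a0 * (freq n ^ 3 * (cmod (f n))\<^sup>2)" for n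
    unfolding P_def norm_mult norm_of_real power_mult_distrib power2_abs w(3) r(3)
    by (simp add: power3_eq_cube power2_eq_square)
  have Qsq: "(cmod (Q n))\<^sup>2 = (freq n * (cmod (g n))\<^sup>2) / a0" for n
    unfolding Q_def norm_mult norm_of_real power_mult_distrib power2_abs power_divide w(3) r(3) by simp
  define \<rho> where "\<rho> n = modeN (P n) (Q n)" for n
  have \<rho>0: "0 \<le> \<rho> n" for n by (simp add: \<rho>_def modeN_nonneg)
  define B where "B n = freq n ^ 3 * (cmod (f n))\<^sup>2 + freq n * (cmod (g n))\<^sup>2" for n
  have \<rho>B: "\<rho> n \<le> 2 * B n" for n
  proof -
    have "a0 * (freq n ^ 3 * (cmod (f n))\<^sup>2) \<le> 2 * (freq n ^ 3 * (cmod (f n))\<^sup>2)"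
      using a0 freq_pos[of n] by (intro mult_right_mono) auto
    moreover have "1 / a0 * (freq n * (cmod (g n))\<^sup>2) \<le> 2 * (freq n * (cmod (g n))\<^sup>2)"
      using a0 freq_pos[of n] by (intro mult_right_mono) auto
    ultimately show ?thesis by (simp add: \<rho>_def modeN_eq Psq Qsq B_def)
  qed
  have Bs: "summable B" and Bsum: "suminf B = (\<Sum>n. freq n ^ 3 * (cmod (f n))\<^sup>2) + (\<Sum>n. freq n * (cmod (g n))\<^sup>2)"
    unfolding B_def[abs_def] by (auto intro: summable_add fs gs simp: suminf_add[OF fs gs])
  have \<rho>s: "summable \<rho>"
    by (rule summable_comparison_test'[OF summable_mult[OF Bs, of 2], of 0]) (use \<rho>B \<rho>0 in auto)
  have "suminf \<rho> \<le> 2 * suminf B"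
    unfolding suminf_mult[OF Bs, symmetric] by (intro suminf_le \<rho>B \<rho>s summable_mult Bs)
  then have "\<bar>\<gamma>\<bar> * suminf \<rho> \<le> 4 * (\<bar>c\<bar> * suminf B)"
    using mult_left_mono[of "suminf \<rho>" "2 * suminf B" "2 * \<bar>c\<bar>"] by (simp add: \<gamma>_def abs_mult)
  then have small': "\<bar>\<gamma>\<bar> * suminf \<rho> \<le> 1 / 100" using small by (simp add: Bsum)
  then have small72: "\<bar>\<gamma>\<bar> * suminf \<rho> \<le> 1 / 72" by linarith
  define s where "s n = sqrt (\<rho> n)" for n
  have s: "0 \<le> s n" "s n * s n = \<rho> n" "(s n)\<^sup>2 = \<rho> n" for n using \<rho>0 by (auto simp: s_def)
  have s0: "P n = 0 \<and> Q n = 0" if "s n = 0" for n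
    using that s(3)[of n] by (simp add: \<rho>_def modeN_eq add_nonneg_eq_0_iff)
  \<comment> \<open>Each mode is divided by its own initial size. A mode with \<open>s n = 0\<close>
    has \<open>P n = Q n = 0\<close>, so the value 0 of division by zero is the right one.\<close>
  define p0 q0 where "p0 n = P n / s n" and "q0 n = Q n / s n" for n
  have sp: "s n *\<^sub>R p0 n = P n" and sq: "s n *\<^sub>R q0 n = Q n" for n
    using s0[of n] by (auto simp: p0_def q0_def scaleR_conv_of_real)
  have init: "modeN (p0 n) (q0 n) \<le> 1" for n
  proof -
    have "modeN (p0 n) (q0 n) = \<rho> n / \<rho> n"
      using s(1) by (simp add: modeN_eq p0_def q0_def norm_divide power_divide s(3) \<rho>_def add_divide_distrib[symmetric])
    then show ?thesis by simp
  qed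
  obtain p q \<sigma> where sys: "mode_system \<gamma> \<rho> {0..} 9 p q \<sigma>"
    and p0: "\<And>n. p n 0 = p0 n" and q0: "\<And>n. q n 0 = q0 n"
    and N2: "\<And>n t. 0 \<le> t \<Longrightarrow> modeN (p n t) (q n t) \<le> 2"
    by (rule mode_system_global[of \<rho> \<gamma> p0 q0]) (use \<rho>0 \<rho>s small72 init in blast)+
  interpret mode_system \<gamma> \<rho> "{0..}" 9 p q \<sigma> by (rule sys)
  have mom_sum: "summable (\<lambda>n. \<rho> n * (1 / freq n * (cmod (p n t))\<^sup>2))" if "0 \<le> t" for t
    by (rule weighted_summable[where B=1]) (use that inverse_freq_le cmod_p_sq_le[of t] in auto)
  have \<gamma>mom: "\<bar>\<gamma> * momentum t\<bar> \<le> 9 / 100" if t: "0 \<le> t" for t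
  proof -
    have "\<bar>momentum t\<bar> \<le> 1 * 9 * suminf \<rho>"
      unfolding momentum_def
      by (rule weighted_suminf_le) (use t inverse_freq_le cmod_p_sq_le[of t] in auto)
    then have "\<bar>\<gamma>\<bar> * \<bar>momentum t\<bar> \<le> \<bar>\<gamma>\<bar> * (9 * suminf \<rho>)" by (intro mult_left_mono) auto
    also have "\<dots> \<le> 9 / 100" using small' by simp
    finally show ?thesis by (simp add: abs_mult)
  qed
  have sp_bounds: "9 / 10 \<le> speed t" "speed t \<le> 11 / 10" if "0 \<le> t" for t
    using \<gamma>mom[OF that] by (auto simp: speed_def)
  then have sp_pos: "0 < speed t" if "0 \<le> t" for t using that by force
  \<comment> \<open>\<open>P\<close> and \<open>Q\<close> were built with the speed
    \<open>a0\<close> computed from the data. That the speed read off from the modes starts at this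
    value follows from \<open>momentum 0 = a0 * E\<close> and a0 (1 + \<gamma> E) = 1.\<close>
  have speed0: "speed 0 = a0"
  proof -
    have "\<rho> n * (1 / freq n * (cmod (p n 0))\<^sup>2) = a0 * ((freq n)\<^sup>2 * (cmod (f n))\<^sup>2)" for n
    proof -
      have "\<rho> n * (cmod (p n 0))\<^sup>2 = (cmod (s n *\<^sub>R p0 n))\<^sup>2"
        by (simp add: p0 power_mult_distrib s(3))
      also have "\<dots> = a0 * (freq n ^ 3 * (cmod (f n))\<^sup>2)" by (simp only: sp Psq)
      finally have "\<rho> n * (cmod (p n 0))\<^sup>2 / freq n = a0 * (freq n ^ 3 * (cmod (f n))\<^sup>2) / freq n" by simp
      then show ?thesis using freq_pos[of n] by (simp add: power3_eq_cube power2_eq_square)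
    qed
    then have "momentum 0 = a0 * E" unfolding momentum_def E_def by (simp add: suminf_mult[OF f2s])
    then show ?thesis using b0 unfolding speed_def a0_def by (simp add: field_simps)
  qed
  have cont: "continuous_on {0..} (\<lambda>t. 1 / speed t)"
  proof (intro continuous_on_divide continuous_on_const ballI)
    show "continuous_on {0..} speed"
      unfolding continuous_on_eq_continuous_within by (auto intro!: DERIV_continuous[OF speed_deriv])
    show "speed x \<noteq> 0" if "x \<in> {0..}" for x
      using sp_pos[of x] that by simp
  qed
  have "1 / 2 \<le> 1 / speed t" if "0 \<le> t" for t
    using sp_bounds[OF that] by (auto simp: field_simps)
  from increasing_reparametrization[OF cont this]
  obtain \<theta> where \<theta>0: "\<theta> 0 = 0" and \<theta>_nn: "\<And>t. 0 \<le> t \<Longrightarrow> 0 \<le> \<theta> t"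
    and \<theta>': "\<And>t. 0 \<le> t \<Longrightarrow> (\<theta> has_real_derivative 1 / (1 / speed (\<theta> t))) (at t within {0..})"
    by blast
  have \<theta>': "(\<theta> has_real_derivative speed (\<theta> t)) (at t within {0..})" if "0 \<le> t" for t
    using \<theta>'[OF that] by simp
  define U V where "U n x = (s n / (r n * freq n)) *\<^sub>R ((1 / sqrt (speed x)) *\<^sub>R p n x)"
    and "V n x = (s n / r n) *\<^sub>R (sqrt (speed x) *\<^sub>R q n x)" for n x
  have U': "(U n has_vector_derivative (1 / speed x) *\<^sub>R V n x) (at x within {0..})" if x: "0 \<le> x" for n x
  proof -
    have d: "(U n has_vector_derivative (s n / (r n * freq n)) *\<^sub>R ((freq n / speed x) *\<^sub>R (sqrt (speed x) *\<^sub>R q n x))) (at x within {0..})"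
      unfolding U_def[abs_def]
      by (rule bounded_linear.has_vector_derivative[OF bounded_linear_scaleR_right field_mode_derivs(1)])
        (use x sp_pos in auto)
    show ?thesis
      by (rule has_vector_derivative_eq_rhs[OF d]) (use freq_pos[of n] in \<open>simp add: V_def mult_ac\<close>)
  qed
  have V': "(V n has_vector_derivative (- (speed x * (freq n)\<^sup>2)) *\<^sub>R U n x) (at x within {0..})" if x: "0 \<le> x" for n x
  proof -
    have d: "(V n has_vector_derivative (s n / r n) *\<^sub>R ((- (freq n * speed x)) *\<^sub>R ((1 / sqrt (speed x)) *\<^sub>R p n x))) (at x within {0..})"
      unfolding V_def[abs_def]
      by (rule bounded_linear.has_vector_derivative[OF bounded_linear_scaleR_right field_mode_derivs(2)])
        (use x sp_pos in auto)
    show ?thesis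
      by (rule has_vector_derivative_eq_rhs[OF d])
        (use freq_pos[of n] in \<open>simp add: U_def power2_eq_square mult_ac\<close>)
  qed
  have comp: "((\<lambda>t. X (\<theta> t)) has_vector_derivative speed (\<theta> t) *\<^sub>R X') (at t within {0..})"
    if "0 \<le> t" "(X has_vector_derivative X') (at (\<theta> t) within {0..})" for X :: "real \<Rightarrow> complex" and X' t
  proof -
    have "(X has_vector_derivative X') (at (\<theta> t) within \<theta> ` {0..})"
      by (rule has_vector_derivative_within_subset[OF that(2)]) (use \<theta>_nn in auto)
    then show ?thesis
      using vector_diff_chain_within[of \<theta> "speed (\<theta> t)" t "{0..}" X X'] \<theta>'[OF that(1)]
      by (simp add: has_real_derivative_iff_has_vector_derivative o_def)
  qed
  have Usq: "(cmod (U n x))\<^sup>2 = \<rho> n * (cmod (p n x))\<^sup>2 / (speed x * freq n ^ 3)"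
    and Vsq: "(cmod (V n x))\<^sup>2 = \<rho> n * (cmod (q n x))\<^sup>2 * speed x / freq n" if "0 \<le> x" for n x
    using sp_pos[OF that]
    by (simp_all add: U_def V_def power_mult_distrib power_divide s(3) r(3) power3_eq_cube power2_eq_square[of "freq n"])
  show ?thesis
  proof (rule that[of "\<lambda>n t. U n (\<theta> t)" "\<lambda>n t. V n (\<theta> t)" "\<lambda>t. speed (\<theta> t)" "2 * \<bar>\<gamma>\<bar> * (9 * suminf \<rho>) * 9 * 2"])
    have "U n 0 = complex_of_real (1 / (r n * freq n * w)) * (s n *\<^sub>R p0 n)" for n
      by (simp add: U_def p0 speed0 w_def scaleR_conv_of_real mult_ac)
    then show "U n (\<theta> 0) = f n" for n
      unfolding sp P_def \<theta>0 using r(1)[of n] freq_pos[of n] w(1) by simp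
    have "V n 0 = complex_of_real (w / r n) * (s n *\<^sub>R q0 n)" for n
      by (simp add: V_def q0 speed0 w_def scaleR_conv_of_real mult_ac)
    then show "V n (\<theta> 0) = g n" for n
      unfolding sq Q_def \<theta>0 using r(1)[of n] w(1) by simp
    fix n t assume t: "0 \<le> (t::real)"
    note x = \<theta>_nn[OF t]
    have pos: "0 < speed (\<theta> t)" by (rule sp_pos[OF x])
    show "((\<lambda>t. U n (\<theta> t)) has_vector_derivative V n (\<theta> t)) (at t within {0..})"
      using comp[OF t U'[OF x]] pos by simp
    show "((\<lambda>t. V n (\<theta> t)) has_vector_derivative (- ((speed (\<theta> t))\<^sup>2 * (freq n)\<^sup>2)) *\<^sub>R U n (\<theta> t)) (at t within {0..})"
      using comp[OF t V'[OF x]] by (simp add: power2_eq_square mult_ac)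
    show "1 / 2 \<le> speed (\<theta> t) \<and> speed (\<theta> t) \<le> 2" using sp_bounds[OF x] by auto
    have "(\<Sum>n. (freq n)\<^sup>2 * (cmod (U n (\<theta> t)))\<^sup>2) = (\<Sum>n. 1 / speed (\<theta> t) * (\<rho> n * (1 / freq n * (cmod (p n (\<theta> t)))\<^sup>2)))"
      using freq_pos by (intro suminf_cong) (simp add: Usq[OF x] power3_eq_cube power2_eq_square[of "freq _"] less_imp_neq[THEN not_sym])
    also have "\<dots> = momentum (\<theta> t) / speed (\<theta> t)"
      by (subst suminf_mult[OF mom_sum[OF x]]) (simp add: momentum_def)
    finally have E: "(\<Sum>n. (freq n)\<^sup>2 * (cmod (U n (\<theta> t)))\<^sup>2) = momentum (\<theta> t) / speed (\<theta> t)" .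
    have "speed (\<theta> t) * (1 + \<gamma> * (momentum (\<theta> t) / speed (\<theta> t))) = speed (\<theta> t) + \<gamma> * momentum (\<theta> t)"
      using pos by (simp add: distrib_left)
    also have "\<dots> = 1" by (simp add: speed_def)
    finally show "speed (\<theta> t) * (1 + 2 * c * (\<Sum>n. (freq n)\<^sup>2 * (cmod (U n (\<theta> t)))\<^sup>2)) = 1"
      unfolding E \<gamma>_def[symmetric] .
    have "((\<lambda>t. speed (\<theta> t)) has_real_derivative (- 2 * \<gamma> * \<sigma> (\<theta> t) * speed (\<theta> t)) * speed (\<theta> t)) (at t within {0..})"
      by (rule DERIV_image_chain[of speed _ \<theta>, unfolded o_def, OF DERIV_subset[OF speed_deriv] \<theta>'[OF t]])
        (use x \<theta>_nn in auto)
    moreover have "\<bar>(- 2 * \<gamma> * \<sigma> (\<theta> t) * speed (\<theta> t)) * speed (\<theta> t)\<bar> \<le> 2 * \<bar>\<gamma>\<bar> * (9 * suminf \<rho>) * 9 * 2"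
    proof -
      \<comment> \<open>\<open>\<gamma>\<sigma>_bound\<close> is applied with the speed in the place
        of a quantity bounded by \<open>K = 9\<close>; this explains the second 9. The last 2 bounds
        the remaining factor \<open>speed\<close>.\<close>
      have "\<bar>2 * \<gamma> * \<sigma> (\<theta> t) * speed (\<theta> t)\<bar> * \<bar>speed (\<theta> t)\<bar> \<le> 2 * \<bar>\<gamma>\<bar> * (9 * suminf \<rho>) * 9 * 2"
        using x sp_bounds[OF x] by (intro mult_mono \<gamma>\<sigma>_bound) (auto simp: suminf_nonneg[OF \<rho>s \<rho>0])
      then show ?thesis by (simp add: abs_mult)
    qed
    ultimately show "\<exists>a'. ((\<lambda>t. speed (\<theta> t)) has_real_derivative a') (at t within {0..}) \<and> \<bar>a'\<bar> \<le> 2 * \<bar>\<gamma>\<bar> * (9 * suminf \<rho>) * 9 * 2"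
      by blast
    have "freq n ^ 3 * (cmod (U n (\<theta> t)))\<^sup>2 = 1 / speed (\<theta> t) * (\<rho> n * (cmod (p n (\<theta> t)))\<^sup>2)"
      using freq_pos[of n] by (simp add: Usq[OF x])
    also have "\<dots> \<le> 2 * (\<rho> n * (cmod (p n (\<theta> t)))\<^sup>2)"
      using sp_bounds[OF x] pos \<rho>0 by (intro mult_right_mono) (auto simp: field_simps)
    finally have 1: "freq n ^ 3 * (cmod (U n (\<theta> t)))\<^sup>2 \<le> 2 * (\<rho> n * (cmod (p n (\<theta> t)))\<^sup>2)" .
    have "freq n * (cmod (V n (\<theta> t)))\<^sup>2 = speed (\<theta> t) * (\<rho> n * (cmod (q n (\<theta> t)))\<^sup>2)"
      using freq_pos[of n] by (simp add: Vsq[OF x])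
    also have "\<dots> \<le> 2 * (\<rho> n * (cmod (q n (\<theta> t)))\<^sup>2)"
      using sp_bounds[OF x] \<rho>0 by (intro mult_right_mono) auto
    finally have "freq n ^ 3 * (cmod (U n (\<theta> t)))\<^sup>2 + freq n * (cmod (V n (\<theta> t)))\<^sup>2
        \<le> 2 * (\<rho> n * modeN (p n (\<theta> t)) (q n (\<theta> t)))"
      using 1 by (simp add: modeN_eq algebra_simps)
    also have "\<dots> \<le> 2 * (\<rho> n * 2)" by (intro mult_left_mono N2 x \<rho>0) auto
    \<comment> \<open>The constant 8 collects three factors 2: from the range of the speed now, from
      the bound 2 of the normalised mode, and from the initial speed in
      \<open>\<rho> n \<le> 2 * B n\<close>.\<close>
    also have "\<dots> \<le> 8 * B n" using \<rho>B[of n] by simp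
    finally show "freq n ^ 3 * (cmod (U n (\<theta> t)))\<^sup>2 + freq n * (cmod (V n (\<theta> t)))\<^sup>2
        \<le> 8 * (freq n ^ 3 * (cmod (f n))\<^sup>2 + freq n * (cmod (g n))\<^sup>2)"
      by (simp add: B_def)
  qed
qed


section \<open>Uniqueness for the Fourier modes\<close>

lemma suminf_Cauchy_Schwarz:
  fixes f g :: "nat \<Rightarrow> real"
  assumes f: "summable (\<lambda>n. (f n)\<^sup>2)" and g: "summable (\<lambda>n. (g n)\<^sup>2)"
  shows summable_abs_mult_of_squares: "summable (\<lambda>n. \<bar>f n\<bar> * \<bar>g n\<bar>)"
    and "(\<Sum>n. \<bar>f n\<bar> * \<bar>g n\<bar>) \<le> sqrt (\<Sum>n. (f n)\<^sup>2) * sqrt (\<Sum>n. (g n)\<^sup>2)"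
proof -
  have le: "(\<Sum>i<n. \<bar>f i\<bar> * \<bar>g i\<bar>) \<le> sqrt (\<Sum>n. (f n)\<^sup>2) * sqrt (\<Sum>n. (g n)\<^sup>2)" for n
  proof -
    have "(\<Sum>i<n. \<bar>f i\<bar> * \<bar>g i\<bar>) \<le> L2_set f {..<n} * L2_set g {..<n}"
      by (rule L2_set_mult_ineq)
    also have "\<dots> \<le> sqrt (\<Sum>n. (f n)\<^sup>2) * sqrt (\<Sum>n. (g n)\<^sup>2)"
      unfolding L2_set_def using f g
      by (intro mult_mono real_sqrt_le_mono sum_le_suminf) (auto intro: suminf_nonneg sum_nonneg)
    finally show ?thesis .
  qed
  then show s: "summable (\<lambda>n. \<bar>f n\<bar> * \<bar>g n\<bar>)"
    by (intro summableI_nonneg_bounded) auto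
  show "(\<Sum>n. \<bar>f n\<bar> * \<bar>g n\<bar>) \<le> sqrt (\<Sum>n. (f n)\<^sup>2) * sqrt (\<Sum>n. (g n)\<^sup>2)"
    by (rule suminf_le_const[OF s le])
qed

lemma cmod_square_deriv:
  assumes "(f has_vector_derivative f') (at t within S)"
  shows "((\<lambda>t. (cmod (f t))\<^sup>2) has_real_derivative 2 * (f t \<bullet> f')) (at t within S)"
  using bounded_bilinear.has_vector_derivative[OF bounded_bilinear_inner assms assms]
  by (simp add: power2_norm_eq_inner has_real_derivative_iff_has_vector_derivative inner_commute)

text \<open>A form of Gronwall's inequality in which \<open>e\<close> is not assumed differentiable:
  the differential inequality is imposed on the partial sums only. Integrating them and passing to
  the limit improves e \<le> K successively to K (C t)^j / j!, which tends to 0.\<close>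

lemma integral_inequality_zero:
  fixes e :: "real \<Rightarrow> real" and x :: "nat \<Rightarrow> real \<Rightarrow> real"
  assumes xs: "\<And>t. t \<in> {0..T} \<Longrightarrow> (\<lambda>n. x n t) sums e t" and xnn: "\<And>n t. t \<in> {0..T} \<Longrightarrow> 0 \<le> x n t"
    and d: "\<And>n t. t \<in> {0..T} \<Longrightarrow> (x n has_real_derivative x' n t) (at t within {0..T})"
    and ineq: "\<And>n t. t \<in> {0..T} \<Longrightarrow> (\<Sum>k<n. x' k t) \<le> C * e t"
    and C: "0 \<le> C" and bnd: "\<And>t. t \<in> {0..T} \<Longrightarrow> e t \<le> K" and init: "\<And>n. x n 0 = 0"
    and t: "t \<in> {0..T}"
  shows "x n t = 0"
proof -
  have bound: "\<forall>t\<in>{0..T}. e t \<le> K * ((C * t) ^ j / fact j)" for j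
  proof (induction j)
    case 0
    then show ?case using bnd by simp
  next
    case (Suc j)
    show ?case
    proof
      fix t assume t: "t \<in> {0..T}"
      have "(\<Sum>k<n. x k t) \<le> K * ((C * t) ^ Suc j / fact (Suc j))" for n
      proof -
        define F where "F s = K * ((C * s) ^ Suc j / fact (Suc j)) - (\<Sum>k<n. x k s)" for s
        have "F 0 \<le> F t"
        proof (rule within_derivative_nonneg_imp_le[of 0 t F])
          fix s assume s: "s \<in> {0..t}"
          then have sT: "s \<in> {0..T}" using t by auto
          have A: "((\<lambda>s. K * ((C * s) ^ Suc j / fact (Suc j))) has_real_derivative
              K * (real (Suc j) * (C * (C * s) ^ j) / fact (Suc j))) (at s within {0..t})"
            by (auto intro!: derivative_eq_intros simp del: power_Suc fact_Suc)
          have eq: "K * (real (Suc j) * (C * (C * s) ^ j) / fact (Suc j)) = C * (K * ((C * s) ^ j / fact j))"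
          proof -
            have "real (Suc j) * (C * (C * s) ^ j) / fact (Suc j) = C * (C * s) ^ j / fact j"
              by (simp only: fact_Suc) (simp del: of_nat_Suc)
            then show ?thesis by simp
          qed
          have B: "((\<lambda>s. \<Sum>k<n. x k s) has_real_derivative (\<Sum>k<n. x' k s)) (at s within {0..t})"
            by (intro DERIV_sum DERIV_subset[OF d[OF sT]]) (use t in auto)
          show "(F has_real_derivative C * (K * ((C * s) ^ j / fact j)) - (\<Sum>k<n. x' k s)) (at s within {0..t})"
            unfolding F_def[abs_def] eq[symmetric] by (rule DERIV_diff[OF A B])
          have "(\<Sum>k<n. x' k s) \<le> C * e s" by (rule ineq[OF sT])
          also have "\<dots> \<le> C * (K * ((C * s) ^ j / fact j))" by (intro mult_left_mono C) (use Suc sT in auto)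
          finally show "0 \<le> C * (K * ((C * s) ^ j / fact j)) - (\<Sum>k<n. x' k s)" by simp
        qed (use t in auto)
        moreover have "F 0 = 0" by (simp add: F_def init)
        ultimately show ?thesis by (simp add: F_def)
      qed
      moreover have "(\<lambda>n. \<Sum>k<n. x k t) \<longlonglongrightarrow> e t" using xs[OF t] by (simp add: sums_def)
      ultimately show "e t \<le> K * ((C * t) ^ Suc j / fact (Suc j))" by (intro LIMSEQ_le_const2) auto
    qed
  qed
  have "(\<lambda>j. (C * t) ^ j / fact j) \<longlonglongrightarrow> 0"
    using summable_LIMSEQ_zero[OF summable_exp[of "C * t"]] by (simp add: divide_inverse mult.commute)
  then have "(\<lambda>j. K * ((C * t) ^ j / fact j)) \<longlonglongrightarrow> K * 0" by (rule tendsto_mult_left)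
  then have "e t \<le> K * 0" using bound t by (intro LIMSEQ_le_const) auto
  moreover have "x n t \<le> e t"
    using sum_le_suminf[OF sums_summable[OF xs[OF t]], of "{n}"] xnn[OF t] sums_unique[OF xs[OF t]] by simp
  ultimately show ?thesis using xnn[OF t, of n] by simp
qed

lemma cmod_diff_squared_le: "(cmod (x - y))\<^sup>2 \<le> 2 * (cmod x)\<^sup>2 + 2 * (cmod y)\<^sup>2"
proof -
  have "(cmod (x - y))\<^sup>2 \<le> (cmod x + cmod y)\<^sup>2" by (intro power_mono norm_triangle_ineq4) auto
  then show ?thesis using zero_le_power2[of "cmod x - cmod y"] unfolding power2_sum power2_diff by linarith
qed

text \<open>The two solutions enter asymmetrically. The weight of the energy contains the speed
  \<open>a\<close>, so \<open>a\<close> must stay away from zero and have a bounded derivative; of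
  the competitor's speed \<open>a2\<close> just a bound is assumed, since a competitor is merely a
  continuous curve in Sobolev spaces.\<close>

lemma kirchhoff_modes_unique:
  fixes c T M :: real and u v u2 v2 :: "nat \<Rightarrow> real \<Rightarrow> complex" and a a' a2 :: "real \<Rightarrow> real"
  assumes u': "\<And>n t. t \<in> {0..T} \<Longrightarrow> (u n has_vector_derivative v n t) (at t within {0..T})"
    and v': "\<And>n t. t \<in> {0..T} \<Longrightarrow> (v n has_vector_derivative (- ((a t)\<^sup>2 * (freq n)\<^sup>2)) *\<^sub>R u n t) (at t within {0..T})"
    and u2': "\<And>n t. t \<in> {0..T} \<Longrightarrow> (u2 n has_vector_derivative v2 n t) (at t within {0..T})"
    and v2': "\<And>n t. t \<in> {0..T} \<Longrightarrow> (v2 n has_vector_derivative (- ((a2 t)\<^sup>2 * (freq n)\<^sup>2)) *\<^sub>R u2 n t) (at t within {0..T})"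
    and a: "\<And>t. t \<in> {0..T} \<Longrightarrow> 1 / 2 \<le> a t \<and> a t \<le> 2"
    and a': "\<And>t. t \<in> {0..T} \<Longrightarrow> (a has_real_derivative a' t) (at t within {0..T}) \<and> \<bar>a' t\<bar> \<le> M"
    and a2: "\<And>t. t \<in> {0..T} \<Longrightarrow> \<bar>a2 t\<bar> \<le> M"
    and aE: "\<And>t. t \<in> {0..T} \<Longrightarrow> a t * (1 + 2 * c * (\<Sum>n. (freq n)\<^sup>2 * (cmod (u n t))\<^sup>2)) = 1"
    and a2E: "\<And>t. t \<in> {0..T} \<Longrightarrow> a2 t * (1 + 2 * c * (\<Sum>n. (freq n)\<^sup>2 * (cmod (u2 n t))\<^sup>2)) = 1"
    and us: "\<And>t. t \<in> {0..T} \<Longrightarrow> summable (\<lambda>n. freq n ^ 3 * (cmod (u n t))\<^sup>2) \<and> (\<Sum>n. freq n ^ 3 * (cmod (u n t))\<^sup>2) \<le> M"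
    and vs: "\<And>t. t \<in> {0..T} \<Longrightarrow> summable (\<lambda>n. freq n * (cmod (v n t))\<^sup>2) \<and> (\<Sum>n. freq n * (cmod (v n t))\<^sup>2) \<le> M"
    and u2s: "\<And>t. t \<in> {0..T} \<Longrightarrow> summable (\<lambda>n. freq n ^ 3 * (cmod (u2 n t))\<^sup>2) \<and> (\<Sum>n. freq n ^ 3 * (cmod (u2 n t))\<^sup>2) \<le> M"
    and v2s: "\<And>t. t \<in> {0..T} \<Longrightarrow> summable (\<lambda>n. freq n * (cmod (v2 n t))\<^sup>2) \<and> (\<Sum>n. freq n * (cmod (v2 n t))\<^sup>2) \<le> M"
    and init: "\<And>n. u n 0 = u2 n 0" "\<And>n. v n 0 = v2 n 0" and t: "t \<in> {0..T}"
  shows "u n t = u2 n t"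
proof -
  define d w where "d n t = u n t - u2 n t" and "w n t = v n t - v2 n t" for n t
  \<comment> \<open>The energy of the difference is measured in \<open>H\<^bsup>1/2\<^esup> \<times> H\<^bsup>-1/2\<^esup>\<close>, one derivative below the
    solutions: the term with the difference of the two wave speeds loses one derivative.\<close>
  define x where "x n t = (cmod (w n t))\<^sup>2 / freq n + (a t)\<^sup>2 * freq n * (cmod (d n t))\<^sup>2" for n t
  \<comment> \<open>The two terms with a^2 times the inner product of \<open>d\<close> and
    \<open>w\<close> cancel. What survives is the forcing by the difference of the speeds and the
    derivative of the weight.\<close>
  define x' where "x' n t = - 2 * ((a t)\<^sup>2 - (a2 t)\<^sup>2) * (freq n * (w n t \<bullet> u2 n t))
      + 2 * a t * a' t * (freq n * (cmod (d n t))\<^sup>2)" for n t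
  define e where "e t = (\<Sum>n. x n t)" for t
  have M0: "0 \<le> M" using a2[OF t] by linarith
  have dw': "(d n has_vector_derivative w n t) (at t within {0..T})"
    "(w n has_vector_derivative (- ((a t)\<^sup>2 * (freq n)\<^sup>2)) *\<^sub>R d n t - (((a t)\<^sup>2 - (a2 t)\<^sup>2) * (freq n)\<^sup>2) *\<^sub>R u2 n t) (at t within {0..T})"
    if "t \<in> {0..T}" for n t
  proof -
    show "(d n has_vector_derivative w n t) (at t within {0..T})"
      unfolding d_def[abs_def] w_def using u'[OF that] u2'[OF that] by (rule has_vector_derivative_diff)
    show "(w n has_vector_derivative (- ((a t)\<^sup>2 * (freq n)\<^sup>2)) *\<^sub>R d n t - (((a t)\<^sup>2 - (a2 t)\<^sup>2) * (freq n)\<^sup>2) *\<^sub>R u2 n t) (at t within {0..T})"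
      unfolding d_def w_def[abs_def]
      by (rule has_vector_derivative_eq_rhs[OF has_vector_derivative_diff[OF v'[OF that] v2'[OF that]]])
        (simp add: algebra_simps)
  qed
  have x_deriv: "(x n has_real_derivative x' n t) (at t within {0..T})" if t: "t \<in> {0..T}" for n t
  proof -
    have "(x n has_real_derivative
        2 * (w n t \<bullet> ((- ((a t)\<^sup>2 * (freq n)\<^sup>2)) *\<^sub>R d n t - (((a t)\<^sup>2 - (a2 t)\<^sup>2) * (freq n)\<^sup>2) *\<^sub>R u2 n t)) / freq n
        + (real 2 * (a' t * (a t) ^ (2 - Suc 0)) * freq n * (cmod (d n t))\<^sup>2 + 2 * (d n t \<bullet> w n t) * ((a t)\<^sup>2 * freq n))) (at t within {0..T})"
      unfolding x_def[abs_def]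
      by (intro DERIV_add DERIV_cdivide DERIV_mult DERIV_cmult_right DERIV_power cmod_square_deriv dw' t conjunct1[OF a'[OF t]])
    then show ?thesis
      by (rule DERIV_cong, unfold x'_def inner_diff_right inner_scaleR_right inner_commute[of "d n t"])
        (use freq_pos[of n] in \<open>simp add: field_simps power2_eq_square\<close>)
  qed
  have xnn: "0 \<le> x n t" for n t using freq_pos[of n] by (simp add: x_def)
  have x_le: "x n t \<le> 2 * (freq n * (cmod (v n t))\<^sup>2) + 2 * (freq n * (cmod (v2 n t))\<^sup>2)
      + 8 * (freq n ^ 3 * (cmod (u n t))\<^sup>2) + 8 * (freq n ^ 3 * (cmod (u2 n t))\<^sup>2)" if t: "t \<in> {0..T}" for n t
  proof -
    have "(cmod (w n t))\<^sup>2 / freq n \<le> (cmod (w n t))\<^sup>2 * freq n"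
      using freq_ge_1[of n] mult_mono[of 1 "freq n" 1 "freq n"]
      by (auto simp: divide_le_eq mult.assoc intro!: mult_right_le_one_le) (simp add: mult_le_cancel_left1)
    also have "\<dots> \<le> (2 * (cmod (v n t))\<^sup>2 + 2 * (cmod (v2 n t))\<^sup>2) * freq n"
      unfolding w_def using freq_pos[of n] by (intro mult_right_mono cmod_diff_squared_le) auto
    finally have 1: "(cmod (w n t))\<^sup>2 / freq n \<le> 2 * (freq n * (cmod (v n t))\<^sup>2) + 2 * (freq n * (cmod (v2 n t))\<^sup>2)"
      by (simp add: algebra_simps)
    have "(a t)\<^sup>2 \<le> 2\<^sup>2" using a[OF t] by (intro power_mono) auto
    moreover have "freq n ^ 1 \<le> freq n ^ 3" by (intro power_increasing freq_ge_1) auto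
    ultimately have "(a t)\<^sup>2 * freq n * (cmod (d n t))\<^sup>2 \<le> 4 * freq n ^ 3 * (2 * (cmod (u n t))\<^sup>2 + 2 * (cmod (u2 n t))\<^sup>2)"
      unfolding d_def using freq_pos[of n] by (intro mult_mono cmod_diff_squared_le) auto
    then show ?thesis using 1 by (simp add: x_def algebra_simps)
  qed
  have bsum: "(\<lambda>n. 2 * (freq n * (cmod (v n t))\<^sup>2) + 2 * (freq n * (cmod (v2 n t))\<^sup>2)
      + 8 * (freq n ^ 3 * (cmod (u n t))\<^sup>2) + 8 * (freq n ^ 3 * (cmod (u2 n t))\<^sup>2)) sums
      (2 * (\<Sum>n. freq n * (cmod (v n t))\<^sup>2) + 2 * (\<Sum>n. freq n * (cmod (v2 n t))\<^sup>2)
      + 8 * (\<Sum>n. freq n ^ 3 * (cmod (u n t))\<^sup>2) + 8 * (\<Sum>n. freq n ^ 3 * (cmod (u2 n t))\<^sup>2))" if "t \<in> {0..T}" for t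
    using us[OF that] vs[OF that] u2s[OF that] v2s[OF that] by (intro sums_add sums_mult summable_sums) auto
  have xs: "summable (\<lambda>n. x n t)" if "t \<in> {0..T}" for t
    by (rule summable_comparison_test'[OF sums_summable[OF bsum[OF that]], of 0]) (use xnn x_le[OF that] in auto)
  \<comment> \<open>The four coefficients of the majorant add up: 2 + 2 + 8 + 8 = 20.\<close>
  have e_le: "e t \<le> 20 * M" if "t \<in> {0..T}" for t
  proof -
    have "e t \<le> 2 * (\<Sum>n. freq n * (cmod (v n t))\<^sup>2) + 2 * (\<Sum>n. freq n * (cmod (v2 n t))\<^sup>2)
      + 8 * (\<Sum>n. freq n ^ 3 * (cmod (u n t))\<^sup>2) + 8 * (\<Sum>n. freq n ^ 3 * (cmod (u2 n t))\<^sup>2)"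
      unfolding e_def using sums_unique[OF bsum[OF that]] sums_summable[OF bsum[OF that]] xs[OF that] x_le[OF that]
      by (metis (no_types, lifting) suminf_le)
    then show ?thesis using us[OF that] vs[OF that] u2s[OF that] v2s[OF that] by linarith
  qed
  have enn: "0 \<le> e t" if "t \<in> {0..T}" for t
    unfolding e_def by (rule suminf_nonneg[OF xs[OF that] xnn])
  define r where "r n = sqrt (freq n)" for n
  have r: "0 < r n" "r n * r n = freq n" "(r n)\<^sup>2 = freq n" for n
    using freq_pos[of n] by (auto simp: r_def)
  have e_d: "summable (\<lambda>n. (r n * cmod (d n t))\<^sup>2) \<and> (\<Sum>n. (r n * cmod (d n t))\<^sup>2) \<le> 4 * e t" if t: "t \<in> {0..T}" for t
  proof -
    have le: "(r n * cmod (d n t))\<^sup>2 \<le> 4 * x n t" for n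
    proof -
      have "(1 / 2)\<^sup>2 \<le> (a t)\<^sup>2" using a[OF t] by (intro power_mono) auto
      then have "1 / 4 * (freq n * (cmod (d n t))\<^sup>2) \<le> (a t)\<^sup>2 * (freq n * (cmod (d n t))\<^sup>2)"
        using freq_pos[of n] by (intro mult_right_mono) (auto simp: power2_eq_square)
      moreover have "0 \<le> (cmod (w n t))\<^sup>2 / freq n" using freq_pos[of n] by simp
      ultimately show ?thesis by (simp add: x_def power_mult_distrib r(3) mult.assoc)
    qed
    have s: "summable (\<lambda>n. (r n * cmod (d n t))\<^sup>2)"
      by (rule summable_comparison_test'[OF summable_mult[OF xs[OF t], of 4], of 0]) (use le in auto)
    then show ?thesis
      unfolding e_def suminf_mult[OF xs[OF t], symmetric]
      by (intro conjI suminf_le le summable_mult xs t) auto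
  qed
  have e_w: "summable (\<lambda>n. (cmod (w n t) / r n)\<^sup>2) \<and> (\<Sum>n. (cmod (w n t) / r n)\<^sup>2) \<le> e t" if t: "t \<in> {0..T}" for t
  proof -
    have le: "(cmod (w n t) / r n)\<^sup>2 \<le> x n t" for n
      using freq_pos[of n] by (simp add: x_def power_divide r(3))
    have s: "summable (\<lambda>n. (cmod (w n t) / r n)\<^sup>2)"
      by (rule summable_comparison_test'[OF xs[OF t], of 0]) (use le in auto)
    then show ?thesis unfolding e_def by (intro conjI suminf_le le xs t) auto
  qed
  have r3: "(r n * freq n * cmod z)\<^sup>2 = freq n ^ 3 * (cmod z)\<^sup>2" for n z
    by (simp only: power_mult_distrib r(3)) (simp add: power3_eq_cube power2_eq_square)
  \<comment> \<open>Both sums pair the difference, in H^(-1/2) or H^(1/2), with a solution in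
    H^(3/2) by Cauchy-Schwarz. Here the exponent 3/2 is exactly what is required.\<close>
  have cs: "(\<Sum>k<n. freq k * (cmod (w k t) * cmod (u2 k t))) \<le> sqrt (e t) * sqrt M"
    "(\<Sum>k<n. (freq k)\<^sup>2 * (cmod (d k t) * cmod (z k))) \<le> sqrt (4 * e t) * sqrt M"
    if t: "t \<in> {0..T}" and z: "summable (\<lambda>n. freq n ^ 3 * (cmod (z n))\<^sup>2) \<and> (\<Sum>n. freq n ^ 3 * (cmod (z n))\<^sup>2) \<le> M" for n t z
  proof -
    have A: "(\<Sum>k<n. \<bar>f k\<bar> * \<bar>r k * freq k * cmod (y k)\<bar>) \<le> sqrt b * sqrt M"
      if f: "summable (\<lambda>n. (f n)\<^sup>2) \<and> (\<Sum>n. (f n)\<^sup>2) \<le> b"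
        and y: "summable (\<lambda>n. freq n ^ 3 * (cmod (y n))\<^sup>2) \<and> (\<Sum>n. freq n ^ 3 * (cmod (y n))\<^sup>2) \<le> M" for f b and y :: "nat \<Rightarrow> complex"
    proof -
      have y': "summable (\<lambda>n. (r n * freq n * cmod (y n))\<^sup>2)" using y by (simp only: r3)
      have "(\<Sum>k<n. \<bar>f k\<bar> * \<bar>r k * freq k * cmod (y k)\<bar>) \<le> (\<Sum>k. \<bar>f k\<bar> * \<bar>r k * freq k * cmod (y k)\<bar>)"
        by (intro sum_le_suminf suminf_Cauchy_Schwarz y' conjunct1[OF f]) auto
      also have "\<dots> \<le> sqrt (\<Sum>n. (f n)\<^sup>2) * sqrt (\<Sum>n. (r n * freq n * cmod (y n))\<^sup>2)"
        by (intro suminf_Cauchy_Schwarz y' conjunct1[OF f])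
      also have "\<dots> \<le> sqrt b * sqrt M"
      proof (intro mult_mono real_sqrt_le_mono)
        have "0 \<le> (\<Sum>n. (f n)\<^sup>2)" using f by (intro suminf_nonneg) auto
        then show "0 \<le> sqrt b" using f by simp
        show "0 \<le> sqrt (\<Sum>n. (r n * freq n * cmod (y n))\<^sup>2)" using y' by (intro real_sqrt_ge_zero suminf_nonneg) auto
        show "(\<Sum>n. (r n * freq n * cmod (y n))\<^sup>2) \<le> M" using y by (simp only: r3)
      qed (use f in auto)
      finally show ?thesis .
    qed
    have "freq k * (cmod (w k t) * cmod (u2 k t)) = \<bar>cmod (w k t) / r k\<bar> * \<bar>r k * freq k * cmod (u2 k t)\<bar>" for k
      using r(1)[of k] freq_pos[of k] by (simp add: abs_mult)
    then show "(\<Sum>k<n. freq k * (cmod (w k t) * cmod (u2 k t))) \<le> sqrt (e t) * sqrt M"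
      using A[OF e_w[OF t] u2s[OF t]] by simp
    have "(freq k)\<^sup>2 * (cmod (d k t) * cmod (z k)) = \<bar>r k * cmod (d k t)\<bar> * \<bar>r k * freq k * cmod (z k)\<bar>" for k
      using r(1,2)[of k] freq_pos[of k] by (simp add: abs_mult power2_eq_square)
    then show "(\<Sum>k<n. (freq k)\<^sup>2 * (cmod (d k t) * cmod (z k))) \<le> sqrt (4 * e t) * sqrt M"
      using A[OF e_d[OF t] z] by simp
  qed
  have E_diff: "\<bar>(\<Sum>n. (freq n)\<^sup>2 * (cmod (u n t))\<^sup>2) - (\<Sum>n. (freq n)\<^sup>2 * (cmod (u2 n t))\<^sup>2)\<bar> \<le> 4 * (sqrt (e t) * sqrt M)" if t: "t \<in> {0..T}" for t
  proof -
    have le: "(freq n)\<^sup>2 * (cmod y)\<^sup>2 \<le> freq n ^ 3 * (cmod y)\<^sup>2" for n y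
      by (intro mult_right_mono power_increasing freq_ge_1) auto
    have s: "summable (\<lambda>n. (freq n)\<^sup>2 * (cmod (u n t))\<^sup>2)" "summable (\<lambda>n. (freq n)\<^sup>2 * (cmod (u2 n t))\<^sup>2)"
      by (rule summable_comparison_test'[OF conjunct1[OF us[OF t]], of 0], use le in simp,
          rule summable_comparison_test'[OF conjunct1[OF u2s[OF t]], of 0], use le in simp)
    have fin: "\<bar>\<Sum>k<n. (freq k)\<^sup>2 * (cmod (u k t))\<^sup>2 - (freq k)\<^sup>2 * (cmod (u2 k t))\<^sup>2\<bar> \<le> 4 * (sqrt (e t) * sqrt M)" for n
    proof -
      have "\<bar>(freq k)\<^sup>2 * (cmod (u k t))\<^sup>2 - (freq k)\<^sup>2 * (cmod (u2 k t))\<^sup>2\<bar>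
          \<le> (freq k)\<^sup>2 * (cmod (d k t) * cmod (u k t)) + (freq k)\<^sup>2 * (cmod (d k t) * cmod (u2 k t))" for k
      proof -
        have "\<bar>(cmod (u k t))\<^sup>2 - (cmod (u2 k t))\<^sup>2\<bar> = \<bar>cmod (u k t) - cmod (u2 k t)\<bar> * (cmod (u k t) + cmod (u2 k t))"
          by (simp add: power2_eq_square square_diff_square_factored abs_mult mult.commute)
        also have "\<dots> \<le> cmod (d k t) * (cmod (u k t) + cmod (u2 k t))"
          unfolding d_def by (intro mult_right_mono norm_triangle_ineq3) auto
        finally have "(freq k)\<^sup>2 * \<bar>(cmod (u k t))\<^sup>2 - (cmod (u2 k t))\<^sup>2\<bar> \<le> (freq k)\<^sup>2 * (cmod (d k t) * (cmod (u k t) + cmod (u2 k t)))"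
          by (rule mult_left_mono) simp
        then show ?thesis by (simp add: abs_mult right_diff_distrib[symmetric] distrib_left)
      qed
      then have "\<bar>\<Sum>k<n. (freq k)\<^sup>2 * (cmod (u k t))\<^sup>2 - (freq k)\<^sup>2 * (cmod (u2 k t))\<^sup>2\<bar>
          \<le> (\<Sum>k<n. (freq k)\<^sup>2 * (cmod (d k t) * cmod (u k t)) + (freq k)\<^sup>2 * (cmod (d k t) * cmod (u2 k t)))"
        by (intro order_trans[OF sum_abs] sum_mono)
      also have "\<dots> \<le> sqrt (4 * e t) * sqrt M + sqrt (4 * e t) * sqrt M"
        unfolding sum.distrib by (intro add_mono cs t us u2s)
      finally show ?thesis by (simp add: real_sqrt_mult mult_ac)
    qed
    have "(\<lambda>n. \<bar>\<Sum>k<n. (freq k)\<^sup>2 * (cmod (u k t))\<^sup>2 - (freq k)\<^sup>2 * (cmod (u2 k t))\<^sup>2\<bar>) \<longlonglongrightarrow>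
        \<bar>(\<Sum>n. (freq n)\<^sup>2 * (cmod (u n t))\<^sup>2) - (\<Sum>n. (freq n)\<^sup>2 * (cmod (u2 n t))\<^sup>2)\<bar>"
      using sums_diff[OF summable_sums[OF s(1)] summable_sums[OF s(2)]] unfolding sums_def by (rule tendsto_rabs)
    then show ?thesis by (rule LIMSEQ_le_const2) (use fin in auto)
  qed
  \<comment> \<open>The two relations between speed and energy give a - a2 = 2 c a a2 (E2 - E), and
    2 + M bounds the other factor a + a2 of the difference of squares.\<close>
  define C1 where "C1 = 2 * M * (2 * \<bar>c\<bar> * (4 * sqrt M)) * (2 + M)"
  have C1: "0 \<le> C1" using M0 by (simp add: C1_def)
  have a_diff: "\<bar>(a t)\<^sup>2 - (a2 t)\<^sup>2\<bar> \<le> C1 * sqrt (e t)" if t: "t \<in> {0..T}" for t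
  proof -
    define E E2 where "E = (\<Sum>n. (freq n)\<^sup>2 * (cmod (u n t))\<^sup>2)" and "E2 = (\<Sum>n. (freq n)\<^sup>2 * (cmod (u2 n t))\<^sup>2)"
    have aE: "a t * (1 + 2 * c * E) = 1" and a2E: "a2 t * (1 + 2 * c * E2) = 1"
      using aE[OF t] a2E[OF t] by (simp_all add: E_def E2_def)
    have "a t - a2 t = a t * (a2 t * (1 + 2 * c * E2)) - a2 t * (a t * (1 + 2 * c * E))"
      unfolding aE a2E by simp
    also have "\<dots> = a t * a2 t * (2 * c * (E2 - E))" by (simp add: algebra_simps)
    finally have "\<bar>a t - a2 t\<bar> = \<bar>a t\<bar> * \<bar>a2 t\<bar> * (2 * \<bar>c\<bar> * \<bar>E - E2\<bar>)"
      by (simp add: abs_mult abs_minus_commute)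
    also have "\<dots> \<le> 2 * M * (2 * \<bar>c\<bar> * (4 * (sqrt (e t) * sqrt M)))"
      using a[OF t] a2[OF t] E_diff[OF t, folded E_def E2_def] M0
      by (intro mult_mono) auto
    finally have 1: "\<bar>a t - a2 t\<bar> \<le> 2 * M * (2 * \<bar>c\<bar> * (4 * (sqrt (e t) * sqrt M)))" .
    have "\<bar>(a t)\<^sup>2 - (a2 t)\<^sup>2\<bar> = \<bar>a t - a2 t\<bar> * \<bar>a t + a2 t\<bar>"
      by (simp add: power2_eq_square square_diff_square_factored abs_mult mult.commute)
    also have "\<dots> \<le> 2 * M * (2 * \<bar>c\<bar> * (4 * (sqrt (e t) * sqrt M))) * (2 + M)"
      using a[OF t] a2[OF t] by (intro mult_mono 1) (auto simp: M0 enn[OF t])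
    finally show ?thesis by (simp add: C1_def mult_ac)
  qed
  \<comment> \<open>The first term comes from the speed difference paired with \<open>u2\<close>;
    the second is 4 M, from the derivative of the weight, times the factor 4 between the H^(1/2)
    norm squared of \<open>d\<close> and \<open>e\<close>.\<close>
  define C where "C = 2 * C1 * sqrt M + 16 * M"
  have ineq: "(\<Sum>k<n. x' k t) \<le> C * e t" if t: "t \<in> {0..T}" for n t
  proof -
    define W DD where "W = (\<Sum>k<n. freq k * (cmod (w k t) * cmod (u2 k t)))" and "DD = (\<Sum>k<n. freq k * (cmod (d k t))\<^sup>2)"
    have DD: "0 \<le> DD" "DD \<le> 4 * e t"
    proof -
      have "DD = (\<Sum>k<n. (r k * cmod (d k t))\<^sup>2)" by (simp add: DD_def power_mult_distrib r(3))
      then show "0 \<le> DD" "DD \<le> 4 * e t"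
        using sum_le_suminf[OF conjunct1[OF e_d[OF t]], of "{..<n}"] e_d[OF t] by (auto intro: sum_nonneg)
    qed
    have "x' k t \<le> 2 * \<bar>(a t)\<^sup>2 - (a2 t)\<^sup>2\<bar> * (freq k * (cmod (w k t) * cmod (u2 k t))) + 4 * M * (freq k * (cmod (d k t))\<^sup>2)" for k
    proof -
      have "- 2 * ((a t)\<^sup>2 - (a2 t)\<^sup>2) * (freq k * (w k t \<bullet> u2 k t)) \<le> \<bar>- 2 * ((a t)\<^sup>2 - (a2 t)\<^sup>2) * (freq k * (w k t \<bullet> u2 k t))\<bar>"
        by (rule abs_ge_self)
      also have "\<dots> = 2 * \<bar>(a t)\<^sup>2 - (a2 t)\<^sup>2\<bar> * (freq k * \<bar>w k t \<bullet> u2 k t\<bar>)"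
        unfolding abs_mult using freq_pos[of k] by simp
      also have "\<dots> \<le> 2 * \<bar>(a t)\<^sup>2 - (a2 t)\<^sup>2\<bar> * (freq k * (cmod (w k t) * cmod (u2 k t)))"
        using freq_pos[of k] by (intro mult_left_mono Cauchy_Schwarz_ineq2) auto
      finally have 1: "- 2 * ((a t)\<^sup>2 - (a2 t)\<^sup>2) * (freq k * (w k t \<bullet> u2 k t)) \<le> 2 * \<bar>(a t)\<^sup>2 - (a2 t)\<^sup>2\<bar> * (freq k * (cmod (w k t) * cmod (u2 k t)))" .
      have "\<bar>a t * a' t\<bar> \<le> 2 * M" unfolding abs_mult using a[OF t] a'[OF t] by (intro mult_mono) auto
      then have "2 * a t * a' t \<le> 4 * M" by linarith
      then have "2 * a t * a' t * (freq k * (cmod (d k t))\<^sup>2) \<le> 4 * M * (freq k * (cmod (d k t))\<^sup>2)"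
        using freq_pos[of k] by (intro mult_right_mono) auto
      then show ?thesis unfolding x'_def by (rule add_mono[OF 1])
    qed
    then have "(\<Sum>k<n. x' k t) \<le> 2 * \<bar>(a t)\<^sup>2 - (a2 t)\<^sup>2\<bar> * W + 4 * M * DD"
      unfolding W_def DD_def sum_distrib_left sum.distrib[symmetric] by (rule sum_mono)
    also have "\<dots> \<le> 2 * (C1 * sqrt (e t)) * (sqrt (e t) * sqrt M) + 4 * M * (4 * e t)"
      unfolding W_def using M0 C1 DD enn[OF t] freq_pos
      by (intro add_mono mult_mono a_diff cs(1)[OF t us[OF t]] t) (auto intro!: sum_nonneg mult_nonneg_nonneg freq_pos[THEN less_imp_le])
    also have "\<dots> = C * e t"
    proof -
      have "sqrt (e t) * (sqrt (e t) * sqrt M) = e t * sqrt M" using enn[OF t] by (simp add: mult.assoc[symmetric])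
      then have "2 * (C1 * sqrt (e t)) * (sqrt (e t) * sqrt M) = 2 * C1 * (e t * sqrt M)" by simp
      then show ?thesis by (simp add: C_def algebra_simps)
    qed
    finally show ?thesis .
  qed
  have "x n t = 0"
  proof (rule integral_inequality_zero[of T x e x' C "20 * M"])
    show "(\<lambda>n. x n t) sums e t" if "t \<in> {0..T}" for t
      unfolding e_def by (rule summable_sums[OF xs[OF that]])
    show "0 \<le> C" using C1 M0 by (simp add: C_def)
    show "x n 0 = 0" for n by (simp add: x_def d_def w_def init)
  qed (use xnn x_deriv ineq e_le t in auto)
  then have "(a t)\<^sup>2 * freq n * (cmod (d n t))\<^sup>2 = 0"
    using freq_pos[of n] by (simp add: x_def add_nonneg_eq_0_iff)
  then show ?thesis using a[OF t] freq_pos[of n] by (auto simp: d_def)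
qed


section \<open>Fourier series on the circle\<close>

abbreviation circ :: "real measure" where "circ \<equiv> restrict_space lborel {0..2 * pi}"

lemma finite_measure_circ: "finite_measure circ"
  by (rule finite_measureI) (simp add: emeasure_restrict_space space_restrict_space)

interpretation circ: finite_measure circ by (rule finite_measure_circ)

lemma set_integrable_circ:
  fixes f :: "real \<Rightarrow> 'a::{banach,second_countable_topology}"
  shows "set_integrable lborel {0..2 * pi} f \<longleftrightarrow> integrable circ f"
  unfolding set_integrable_def by (rule integrable_restrict_space[symmetric]) simp

lemma set_integral_circ:
  fixes f :: "real \<Rightarrow> 'a::{banach,second_countable_topology}"
  shows "(LBINT x:{0..2 * pi}. f x) = integral\<^sup>L circ f"
  unfolding set_lebesgue_integral_def by (rule integral_restrict_space[symmetric]) simp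

lemma measure_circ: "measure circ (space circ) = 2 * pi"
  by (simp add: measure_restrict_space space_restrict_space)

lemma borel_measurable_circ: "f \<in> borel_measurable borel \<Longrightarrow> f \<in> borel_measurable circ"
  by (rule measurable_restrict_space1) simp

lemma integrable_circ_continuous:
  fixes f :: "real \<Rightarrow> 'a::euclidean_space"
  assumes "continuous_on {0..2 * pi} f" shows "integrable circ f"
  using borel_integrable_atLeastAtMost'[OF assms] by (simp add: set_integrable_circ)

lemma integrable_circ_mult_bounded:
  fixes f :: "real \<Rightarrow> 'a::{real_normed_field,banach,second_countable_topology}"
  assumes f: "integrable circ f" and g: "g \<in> borel_measurable borel" and b: "\<And>x. norm (g x) \<le> B"
  shows "integrable circ (\<lambda>x. f x * g x)"
proof (rule Bochner_Integration.integrable_bound[OF integrable_mult_right[OF integrable_norm[OF f]]])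
  show "(\<lambda>x. f x * g x) \<in> borel_measurable circ"
    using borel_measurable_integrable[OF f] borel_measurable_circ[OF g] by measurable
  show "AE x in circ. norm (f x * g x) \<le> norm (B * norm (f x))"
  proof (rule AE_I2)
    fix x
    have "norm (f x * g x) \<le> B * norm (f x)"
      using mult_left_mono[OF b[of x] norm_ge_zero[of "f x"]] by (simp add: norm_mult mult.commute)
    then show "norm (f x * g x) \<le> norm (B * norm (f x))" by (simp add: order_trans[OF _ abs_ge_self])
  qed
qed

lemma borel_measurable_cis: "(\<lambda>x. cis (a * x)) \<in> borel_measurable borel"
  by (intro borel_measurable_continuous_onI continuous_intros)

lemma integrable_circ_cis:
  "integrable circ f \<Longrightarrow> integrable circ (\<lambda>x. complex_of_real (f x) * cis (a * x))"
  by (rule integrable_circ_mult_bounded[where B=1]) (auto intro: borel_measurable_cis integrable_of_real)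

lemma integral_circ_cis: "integral\<^sup>L circ (\<lambda>x. cis (of_int k * x)) = (if k = 0 then 2 * pi else 0)"
proof (cases "k = 0")
  case True
  then show ?thesis using measure_circ by (simp add: scaleR_conv_of_real)
next
  case False
  have "integral\<^sup>L lborel (\<lambda>x. indicator {0..2 * pi} x *\<^sub>R cis (of_int k * x)) =
      cis (of_int k * (2 * pi)) / (\<i> * of_int k) - cis (of_int k * 0) / (\<i> * of_int k)"
  proof (rule integral_FTC_atLeastAtMost)
    show "((\<lambda>x. cis (of_int k * x) / (\<i> * of_int k)) has_vector_derivative cis (of_int k * x)) (at x within {0..2 * pi})" for x
      using has_vector_derivative_divide[OF has_vector_derivative_cis_mult[of "of_int k" x "{0..2*pi}"], of "\<i> * of_int k"] False
      by simp
  qed (auto intro!: continuous_intros)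
  also have "cis (of_int k * (2 * pi)) = 1"
    using cis_multiple_2pi[of "of_int k"] by (simp add: mult_ac)
  finally show ?thesis using False set_integral_circ[of "\<lambda>x. cis (of_int k * x)"]
    by (simp add: set_lebesgue_integral_def)
qed

section \<open>Uniqueness of Fourier coefficients\<close>

definition trig_null :: "(real \<Rightarrow> real) \<Rightarrow> bool" where
  "trig_null f \<longleftrightarrow> integrable circ f \<and> (\<forall>k::int. integral\<^sup>L circ (\<lambda>x. complex_of_real (f x) * cis (of_int k * x)) = 0)"

lemma trig_null_add: "trig_null f \<Longrightarrow> trig_null g \<Longrightarrow> trig_null (\<lambda>x. f x + g x)"
  unfolding trig_null_def using integrable_circ_cis by (auto simp: distrib_right)

lemma trig_null_cmult: "trig_null f \<Longrightarrow> trig_null (\<lambda>x. f x * c)"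
  unfolding trig_null_def using integrable_circ_cis
  by (auto simp: mult.assoc mult.left_commute[of _ "complex_of_real c"])

lemma trig_null_mult_cos_sin:
  assumes "trig_null f"
  shows "trig_null (\<lambda>x. f x * cos x)" "trig_null (\<lambda>x. f x * sin x)"
proof -
  have f: "integrable circ f" and z: "\<And>k::int. integral\<^sup>L circ (\<lambda>x. complex_of_real (f x) * cis (of_int k * x)) = 0"
    using assms by (auto simp: trig_null_def)
  have eq: "complex_of_real (f x * cos x) * cis (of_int k * x) =
      (complex_of_real (f x) * cis (of_int (k + 1) * x) + complex_of_real (f x) * cis (of_int (k - 1) * x)) / 2"
    "complex_of_real (f x * sin x) * cis (of_int k * x) =
      (complex_of_real (f x) * cis (of_int (k + 1) * x) - complex_of_real (f x) * cis (of_int (k - 1) * x)) / (2 * \<i>)" for x k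
  proof -
    have 1: "cis (of_int (k + 1) * x) = cis (of_int k * x) * cis x" "cis (of_int (k - 1) * x) = cis (of_int k * x) * cis (- x)"
      by (simp_all add: cis_mult algebra_simps)
    have 2: "complex_of_real (cos x) = (cis x + cis (- x)) / 2" "complex_of_real (sin x) = (cis x - cis (- x)) / (2 * \<i>)"
      by (simp_all add: complex_eq_iff Re_divide Im_divide power2_eq_square)
    show "complex_of_real (f x * cos x) * cis (of_int k * x) =
      (complex_of_real (f x) * cis (of_int (k + 1) * x) + complex_of_real (f x) * cis (of_int (k - 1) * x)) / 2"
      "complex_of_real (f x * sin x) * cis (of_int k * x) =
      (complex_of_real (f x) * cis (of_int (k + 1) * x) - complex_of_real (f x) * cis (of_int (k - 1) * x)) / (2 * \<i>)"
      unfolding of_real_mult 1 2 by (simp_all add: algebra_simps)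
  qed
  have "integrable circ (\<lambda>x. f x * cos x)" "integrable circ (\<lambda>x. f x * sin x)"
    by (rule integrable_circ_mult_bounded[OF f, where B=1]; auto intro!: borel_measurable_continuous_onI continuous_intros)+
  then show "trig_null (\<lambda>x. f x * cos x)" "trig_null (\<lambda>x. f x * sin x)"
    unfolding trig_null_def eq using z[of "_ + 1"] z[of "_ - 1"] integrable_circ_cis[OF f]
    by (auto simp del: of_int_add of_int_diff)
qed

text \<open>The functions with vanishing Fourier coefficients form an ideal under multiplication by
  trigonometric polynomials, which makes Stone-Weierstrass on the unit circle applicable.\<close>

lemma trig_null_mult_polynomial:
  assumes "real_polynomial_function (p :: complex \<Rightarrow> real)"
  shows "trig_null f \<Longrightarrow> trig_null (\<lambda>x. f x * p (cis x))"
  using assms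
proof (induction p arbitrary: f)
  case (linear h)
  interpret h: bounded_linear h by (rule linear)
  have "h (cis x) = cos x * h 1 + sin x * h \<i>" for x
  proof -
    have "cis x = cos x *\<^sub>R 1 + sin x *\<^sub>R \<i>" by (simp add: complex_eq_iff)
    then have "h (cis x) = h (cos x *\<^sub>R 1 + sin x *\<^sub>R \<i>)" by simp
    then show ?thesis by (simp only: h.add h.scaleR) simp
  qed
  then have "f x * h (cis x) = f x * cos x * h 1 + f x * sin x * h \<i>" for x by (simp add: distrib_left mult.assoc)
  then show ?case
    using trig_null_add[OF trig_null_cmult[OF trig_null_mult_cos_sin(1)] trig_null_cmult[OF trig_null_mult_cos_sin(2)], OF linear(2) linear(2)]
    by simp
next
  case (const c)
  then show ?case by (rule trig_null_cmult)
next
  case (add p q)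
  then show ?case using trig_null_add[of "\<lambda>x. f x * p (cis x)" "\<lambda>x. f x * q (cis x)"] by (simp add: distrib_left)
next
  case (mult p q)
  then show ?case by (simp add: mult.assoc[symmetric])
qed

text \<open>A polynomial uniformly close to \<phi> on the unit circle integrates to zero against
  \<open>f\<close>: this is the vanishing of the coefficient of frequency 0 of the product. The
  error is at most \<open>e\<close> times the integral of |f|.\<close>

lemma trig_null_continuous:
  assumes f: "trig_null f" and \<phi>: "continuous_on UNIV (\<phi> :: complex \<Rightarrow> real)"
  shows "integral\<^sup>L circ (\<lambda>x. f x * \<phi> (cis x)) = 0"
proof -
  have fi: "integrable circ f" using f by (simp add: trig_null_def)
  have cc: "continuous_on {0..2 * pi} (\<lambda>x. \<psi> (cis x))" "(\<lambda>x. \<psi> (cis x)) \<in> borel_measurable borel" "\<exists>B. \<forall>x. norm (\<psi> (cis x)) \<le> B"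
    if "continuous_on UNIV \<psi>" for \<psi> :: "complex \<Rightarrow> real"
  proof -
    show "continuous_on {0..2 * pi} (\<lambda>x. \<psi> (cis x))" "(\<lambda>x. \<psi> (cis x)) \<in> borel_measurable borel"
      by (auto intro!: borel_measurable_continuous_onI continuous_on_compose2[OF that] continuous_intros)
    have "bounded (\<psi> ` sphere 0 1)"
      by (intro compact_imp_bounded compact_continuous_image continuous_on_subset[OF that]) auto
    then obtain B where "\<forall>z\<in>sphere 0 1. norm (\<psi> z) \<le> B" unfolding bounded_iff by auto
    then show "\<exists>B. \<forall>x. norm (\<psi> (cis x)) \<le> B" by (intro exI[of _ B]) auto
  qed
  have fint: "integrable circ (\<lambda>x. f x * \<psi> (cis x))" if "continuous_on UNIV \<psi>" for \<psi> :: "complex \<Rightarrow> real"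
    using cc(3)[OF that] integrable_circ_mult_bounded[OF fi cc(2)[OF that]] by blast
  have "\<bar>integral\<^sup>L circ (\<lambda>x. f x * \<phi> (cis x))\<bar> \<le> e * integral\<^sup>L circ (\<lambda>x. \<bar>f x\<bar>)" if e: "0 < e" for e
  proof -
    obtain p where p: "real_polynomial_function p" "\<And>z. z \<in> sphere 0 1 \<Longrightarrow> \<bar>\<phi> z - p z\<bar> < e"
      using Stone_Weierstrass_real_polynomial_function[of "sphere (0::complex) 1" \<phi> e] e continuous_on_subset[OF \<phi>]
      by auto
    have pc: "continuous_on UNIV p"
      using p(1) continuous_on_polymonial_function real_polynomial_function_eq by blast
    have "trig_null (\<lambda>x. f x * p (cis x))" by (rule trig_null_mult_polynomial[OF p(1) f])
    then have "integral\<^sup>L circ (\<lambda>x. complex_of_real (f x * p (cis x)) * cis (of_int 0 * x)) = 0"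
      unfolding trig_null_def by blast
    then have "integral\<^sup>L circ (\<lambda>x. complex_of_real (f x * p (cis x))) = 0" by (simp add: cis_zero)
    then have "integral\<^sup>L circ (\<lambda>x. f x * p (cis x)) = 0" unfolding integral_complex_of_real by simp
    then have "integral\<^sup>L circ (\<lambda>x. f x * \<phi> (cis x)) = integral\<^sup>L circ (\<lambda>x. f x * \<phi> (cis x) - f x * p (cis x))"
      by (subst Bochner_Integration.integral_diff) (auto intro: fint \<phi> pc)
    also have "\<bar>\<dots>\<bar> \<le> integral\<^sup>L circ (\<lambda>x. \<bar>f x * \<phi> (cis x) - f x * p (cis x)\<bar>)" by (rule integral_abs_bound)
    also have "\<dots> \<le> integral\<^sup>L circ (\<lambda>x. e * \<bar>f x\<bar>)"
    proof (rule integral_mono)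
      show "\<bar>f x * \<phi> (cis x) - f x * p (cis x)\<bar> \<le> e * \<bar>f x\<bar>" for x
        using mult_left_mono[OF less_imp_le[OF p(2)[of "cis x"]] abs_ge_zero[of "f x"]]
        by (simp add: right_diff_distrib[symmetric] abs_mult mult.commute[of e])
    qed (intro Bochner_Integration.integrable_abs Bochner_Integration.integrable_diff integrable_mult_right fi fint \<phi> pc)+
    finally show ?thesis by simp
  qed
  note * = this
  have "\<bar>integral\<^sup>L circ (\<lambda>x. f x * \<phi> (cis x))\<bar> \<le> 0"
  proof -
    define I where "I = integral\<^sup>L circ (\<lambda>x. \<bar>f x\<bar>)"
    have "0 \<le> I" by (simp add: I_def)
    show ?thesis
    proof (rule field_le_epsilon)
      fix e :: real assume "0 < e"
      have "\<bar>integral\<^sup>L circ (\<lambda>x. f x * \<phi> (cis x))\<bar> \<le> e / (I + 1) * I" using \<open>0 < e\<close> \<open>0 \<le> I\<close> unfolding I_def[symmetric] by (intro *[folded I_def]) auto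
      also have "\<dots> \<le> e" using \<open>0 < e\<close> \<open>0 \<le> I\<close> by (simp add: field_simps)
      finally show "\<bar>integral\<^sup>L circ (\<lambda>x. f x * \<phi> (cis x))\<bar> \<le> 0 + e" by simp
    qed
  qed
  then show ?thesis by simp
qed

lemma trig_null_compact:
  assumes f: "trig_null f" and K: "compact K" "K \<subseteq> {0..<2 * pi}"
  shows "integral\<^sup>L circ (\<lambda>x. f x * indicator K x) = 0"
proof (cases "K = {}")
  case False
  have fi: "integrable circ f" using f by (simp add: trig_null_def)
  define S where "S = cis ` K"
  have S: "compact S" "S \<noteq> {}"
    unfolding S_def using K False by (auto intro!: compact_continuous_image continuous_intros)
  define \<phi> where "\<phi> n z = max 0 (1 - real n * infdist z S)" for n z
  have \<phi>c: "continuous_on UNIV (\<phi> n)" for n unfolding \<phi>_def by (intro continuous_intros)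
  have lim: "(\<lambda>n. \<phi> n z) \<longlonglongrightarrow> indicator S z" for z
  proof (cases "z \<in> S")
    case True
    then show ?thesis by (simp add: \<phi>_def)
  next
    case False
    then have d: "0 < infdist z S"
      using in_closed_iff_infdist_zero[OF compact_imp_closed[OF S(1)] S(2)] infdist_nonneg[of z S] by fastforce
    obtain N where N: "1 < real N * infdist z S" using reals_Archimedean3[OF d] by blast
    have "\<phi> n z = 0" if "n \<ge> N" for n
    proof -
      have "real N * infdist z S \<le> real n * infdist z S" using that d by (intro mult_right_mono) auto
      then show ?thesis using N by (simp add: \<phi>_def max_def)
    qed
    then show ?thesis using False by (auto intro!: tendsto_eventually eventually_sequentiallyI)
  qed
  have ind: "indicator S (cis x) = (indicator K x :: real)" if "x \<in> {0..<2 * pi}" for x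
  proof -
    have "cis x \<in> S \<longleftrightarrow> x \<in> K"
    proof
      assume "cis x \<in> S"
      then obtain y where y: "y \<in> K" "cis x = cis y" by (auto simp: S_def)
      have "Arg2pi (cis x) = x" "Arg2pi (cis y) = y"
        using that y(1) K(2) by (auto intro!: Arg2pi_unique[of 1] simp: cis_conv_exp)
      then show "x \<in> K" using y by metis
    qed (auto simp: S_def)
    then show ?thesis by (simp add: indicator_def)
  qed
  have m: "(\<lambda>x. \<phi> n (cis x)) \<in> borel_measurable borel" for n
    by (auto intro!: borel_measurable_continuous_onI continuous_on_compose2[OF \<phi>c] continuous_intros)
  \<comment> \<open>The endpoint \<open>2 * pi\<close> has the same image on the circle as 0, and
    there the two indicators may disagree.\<close>
  have ae: "AE x in circ. x \<noteq> 2 * pi"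
    using AE_lborel_singleton[of "2 * pi"] by (auto simp: AE_restrict_space_iff elim: eventually_mono)
  have "(\<lambda>n. integral\<^sup>L circ (\<lambda>x. f x * \<phi> n (cis x))) \<longlonglongrightarrow> integral\<^sup>L circ (\<lambda>x. f x * indicator K x)"
  proof (rule integral_dominated_convergence[where w="\<lambda>x. \<bar>f x\<bar>"])
    show "(\<lambda>x. f x * indicator K x) \<in> borel_measurable circ"
      by (rule borel_measurable_times[OF borel_measurable_integrable[OF fi] borel_measurable_circ[OF borel_measurable_indicator]])
        (use K(1) in \<open>auto intro: borel_closed compact_imp_closed\<close>)
    show "(\<lambda>x. f x * \<phi> n (cis x)) \<in> borel_measurable circ" for n
      by (rule borel_measurable_times[OF borel_measurable_integrable[OF fi] borel_measurable_circ[OF m]])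
    show "AE x in circ. norm (f x * \<phi> n (cis x)) \<le> \<bar>f x\<bar>" for n
      by (rule AE_I2) (auto simp: abs_mult \<phi>_def infdist_nonneg intro!: mult_right_le_one_le)
    show "AE x in circ. (\<lambda>n. f x * \<phi> n (cis x)) \<longlonglongrightarrow> f x * indicator K x"
      using ae AE_space[of circ]
    proof eventually_elim
      case (elim x)
      then have "x \<in> {0..<2 * pi}" by (auto simp: space_restrict_space)
      then show ?case using tendsto_mult_left[OF lim[of "cis x"], of "f x"] ind[of x] by simp
    qed
  qed (use fi in auto)
  then show ?thesis using trig_null_continuous[OF f \<phi>c] by (simp add: LIMSEQ_const_iff)
qed simp

lemma borel_inner_closed:
  fixes B :: "real set" and e :: real
  assumes "B \<in> sets borel" "0 < e"
  shows "\<exists>K. closed K \<and> K \<subseteq> B \<and> emeasure lebesgue (B - K) < ennreal e"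
proof -
  have "B \<in> sets lebesgue" by (rule sets_completionI_sets) (use assms in simp)
  note * = sets_lebesgue_inner_closed[OF this assms(2)]
  show ?thesis by (rule *) (intro exI conjI)
qed

text \<open>Otherwise inner regularity provides a compact set of positive measure on which
  \<open>f\<close> is positive, and the integral of \<open>f\<close> over it would have to
  vanish.\<close>

lemma trig_null_AE_le_zero:
  assumes f: "trig_null f" and m: "f \<in> borel_measurable borel"
  shows "AE x in circ. f x \<le> 0"
proof (rule ccontr)
  assume not: "\<not> (AE x in circ. f x \<le> 0)"
  define B where "B = {x \<in> {0..<2 * pi}. 0 < f x}"
  have Bm: "B \<in> sets borel" unfolding B_def using m by measurable
  have Bpos: "emeasure lborel B \<noteq> 0"
  proof
    assume "emeasure lborel B = 0"
    then have "AE x in lborel. x \<notin> B" using Bm by (intro AE_not_in) (auto simp: null_sets_def)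
    moreover have "AE x in lborel. x \<noteq> 2 * pi" by (rule AE_lborel_singleton)
    ultimately have "AE x in lborel. x \<in> {0..2 * pi} \<longrightarrow> f x \<le> 0"
      by eventually_elim (auto simp: B_def)
    then show False using not by (simp add: AE_restrict_space_iff)
  qed
  have Bfin: "emeasure lborel B < \<infinity>"
    by (rule le_less_trans[OF emeasure_mono[of B "{0..2 * pi}"]]) (auto simp: B_def)
  define e where "e = measure lborel B"
  have e: "emeasure lborel B = ennreal e" "0 < e"
    using Bpos Bfin unfolding e_def by (auto simp: emeasure_eq_ennreal_measure zero_less_measure_iff less_top)
  obtain K where K: "closed K" "K \<subseteq> B" "emeasure lebesgue (B - K) < ennreal e"
    using borel_inner_closed[OF Bm e(2)] by blast
  have "bounded K"
    by (rule bounded_subset[OF bounded_closed_interval[of 0 "2 * pi"]]) (use K(2) in \<open>auto simp: B_def\<close>)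
  then have Kc: "compact K" using K(1) by (simp add: compact_eq_bounded_closed)
  have Km: "K \<in> sets borel" using K(1) by simp
  have Kpos: "emeasure lborel K \<noteq> 0"
  proof
    assume 0: "emeasure lborel K = 0"
    have "emeasure lborel B \<le> emeasure lborel K + emeasure lborel (B - K)"
      using emeasure_subadditive[of K lborel "B - K"] Km Bm K(2) by (simp add: Un_absorb1)
    then have "ennreal e \<le> emeasure lborel (B - K)" by (simp add: 0 e(1))
    then show False using K(3) Bm Km by (simp add: emeasure_completion)
  qed
  have K2: "K \<subseteq> {0..<2 * pi}" using K(2) by (auto simp: B_def)
  have int: "integrable circ (\<lambda>x. f x * indicator K x)"
    using f Km by (intro integrable_circ_mult_bounded[where B=1]) (auto simp: trig_null_def indicator_def)
  have "AE x in circ. f x * indicator K x = 0"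
    using trig_null_compact[OF f Kc K2] K(2)
    by (subst (asm) integral_nonneg_eq_0_iff_AE[OF int]) (auto simp: B_def indicator_def intro!: AE_I2)
  then have "AE x in lborel. x \<in> {0..2 * pi} \<longrightarrow> f x * indicator K x = 0" by (simp add: AE_restrict_space_iff)
  then have "AE x in lborel. x \<notin> K" by eventually_elim (use K(2) in \<open>auto simp: B_def indicator_def\<close>)
  then show False using Kpos Km by (simp add: AE_iff_measurable[OF _ refl] )
qed

lemma trig_null_AE_zero:
  assumes f: "trig_null f" and m: "f \<in> borel_measurable borel"
  shows "AE x in circ. f x = 0"
proof -
  have "AE x in circ. f x * - 1 \<le> 0"
    by (rule trig_null_AE_le_zero[OF trig_null_cmult[OF f]]) (use m in measurable)
  with trig_null_AE_le_zero[OF assms] show ?thesis by eventually_elim auto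
qed

text \<open>Translates of a null set by the countably many periods are null, and every real number
  is moved into the basic interval by one of them.\<close>

lemma AE_circ_periodic:
  assumes per: "\<And>x::real. f (x + 2 * pi) = f x" and m: "f \<in> borel_measurable borel"
    and ae: "AE x in circ. f x = (0::real)"
  shows "AE x in lborel. f x = 0"
proof -
  have perk: "f (x + of_int k * (2 * pi)) = f x" for x k
  proof -
    have n: "f (x + real n * (2 * pi)) = f x" for x n
    proof (induction n)
      case (Suc n)
      have "x + real (Suc n) * (2 * pi) = x + real n * (2 * pi) + 2 * pi" by (simp add: algebra_simps)
      then show ?case by (simp only: per Suc)
    qed simp
    show ?thesis
    proof (cases k rule: int_cases2)
      case (nonneg m)
      then show ?thesis using n[of x m] by simp
    next
      case (nonpos m)
      then show ?thesis using n[of "x - real m * (2 * pi)" m] by simp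
    qed
  qed
  have "AE x in lborel. \<forall>k::int. x + of_int k * (2 * pi) \<in> {0..2 * pi} \<longrightarrow> f (x + of_int k * (2 * pi)) = 0"
  proof (subst AE_all_countable, intro allI)
    fix k :: int
    have "AE x in lborel. x \<in> {0..2 * pi} \<longrightarrow> f x = 0" using ae by (simp add: AE_restrict_space_iff)
    then have "AE x in distr lborel borel ((+) (of_int k * (2 * pi))). x \<in> {0..2 * pi} \<longrightarrow> f x = 0"
      unfolding lborel_distr_plus .
    then show "AE x in lborel. x + of_int k * (2 * pi) \<in> {0..2 * pi} \<longrightarrow> f (x + of_int k * (2 * pi)) = 0"
      using m by (subst (asm) AE_distr_iff) (auto simp: add.commute)
  qed
  then show ?thesis
  proof eventually_elim
    case (elim x)
    define k where "k = - \<lfloor>x / (2 * pi)\<rfloor>"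
    have p: "0 < 2 * pi" by simp
    have "of_int \<lfloor>x / (2 * pi)\<rfloor> \<le> x / (2 * pi)" "x / (2 * pi) < of_int \<lfloor>x / (2 * pi)\<rfloor> + 1"
      by linarith+
    then have "of_int \<lfloor>x / (2 * pi)\<rfloor> * (2 * pi) \<le> x" "x < (of_int \<lfloor>x / (2 * pi)\<rfloor> + 1) * (2 * pi)"
      by (simp_all only: pos_le_divide_eq[OF p] pos_divide_less_eq[OF p])
    then have "x + of_int k * (2 * pi) \<in> {0..2 * pi}" by (simp add: k_def algebra_simps)
    then show ?case using elim perk[of x k] by auto
  qed
qed

section \<open>Square-integrable functions and their Fourier coefficients\<close>

lemma L2_circle_iff:
  "f \<in> L2_circle \<longleftrightarrow> (\<forall>x. f (x + 2 * pi) = f x) \<and> f \<in> borel_measurable borel \<and> integrable circ (\<lambda>x. (f x)\<^sup>2)"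
  by (simp add: L2_circle_def set_integrable_circ)

lemma L2_circleI:
  assumes "\<And>x. f (x + 2 * pi) = f x" "f \<in> borel_measurable borel" "integrable circ (\<lambda>x. (f x)\<^sup>2)"
  shows "f \<in> L2_circle"
  using assms by (simp add: L2_circle_iff)

lemma L2_circleD:
  assumes "f \<in> L2_circle"
  shows "f (x + 2 * pi) = f x" "f \<in> borel_measurable borel" "integrable circ (\<lambda>x. (f x)\<^sup>2)"
    "f \<in> borel_measurable circ"
  using assms by (auto simp: L2_circle_iff intro: borel_measurable_circ)

lemma integrable_circ_mult:
  assumes f: "f \<in> L2_circle" and g: "g \<in> L2_circle"
  shows "integrable circ (\<lambda>x. f x * g x)"
proof (rule Bochner_Integration.integrable_bound)
  show "integrable circ (\<lambda>x. (f x)\<^sup>2 + (g x)\<^sup>2)"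
    by (intro Bochner_Integration.integrable_add L2_circleD(3) f g)
  show "(\<lambda>x. f x * g x) \<in> borel_measurable circ"
    by (intro borel_measurable_times L2_circleD(4) f g)
  have "\<bar>a * b\<bar> \<le> a\<^sup>2 + b\<^sup>2" for a b :: real
    using zero_le_power2[of "\<bar>a\<bar> - \<bar>b\<bar>"] zero_le_power2[of a] zero_le_power2[of b]
    unfolding power2_diff abs_mult power2_abs by linarith
  then show "AE x in circ. norm (f x * g x) \<le> norm ((f x)\<^sup>2 + (g x)\<^sup>2)"
    by (intro AE_I2) (simp add: order_trans[OF _ abs_ge_self])
qed

lemma L2_circle_const: "(\<lambda>_. c) \<in> L2_circle"
  by (intro L2_circleI) (auto intro!: integrable_circ_continuous continuous_intros)

lemma L2_circle_integrable: "f \<in> L2_circle \<Longrightarrow> integrable circ f"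
  using integrable_circ_mult[OF _ L2_circle_const[of 1], of f] by simp

lemma L2_circle_add:
  assumes f: "f \<in> L2_circle" and g: "g \<in> L2_circle" shows "(\<lambda>x. f x + g x) \<in> L2_circle"
proof (rule L2_circleI)
  have "integrable circ (\<lambda>x. (f x)\<^sup>2 + (g x)\<^sup>2 + 2 * (f x * g x))"
    by (intro Bochner_Integration.integrable_add integrable_mult_right L2_circleD(3) integrable_circ_mult f g)
  then show "integrable circ (\<lambda>x. (f x + g x)\<^sup>2)" by (simp add: power2_sum mult.assoc)
qed (use f g in \<open>auto simp: L2_circle_iff\<close>)

lemma L2_circle_cmult: "f \<in> L2_circle \<Longrightarrow> (\<lambda>x. c * f x) \<in> L2_circle"
  by (auto simp: L2_circle_iff power_mult_distrib)

lemma L2_circle_diff: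
  assumes f: "f \<in> L2_circle" and g: "g \<in> L2_circle" shows "(\<lambda>x. f x - g x) \<in> L2_circle"
  using L2_circle_add[OF f L2_circle_cmult[OF g, of "-1"]] by simp

lemma L2_circle_continuous:
  assumes "\<And>x. f (x + 2 * pi) = f x" "continuous_on UNIV f" shows "f \<in> L2_circle"
  using assms(2) by (intro L2_circleI assms(1) borel_measurable_continuous_onI integrable_circ_continuous continuous_intros)
    (auto intro: continuous_on_subset)

lemma circle_pairing_circ: "circle_pairing f g = integral\<^sup>L circ (\<lambda>x. f x * g x)"
  by (simp add: circle_pairing_def set_integral_circ)

lemma fourier_coeff_circ:
  "fourier_coeff f k = integral\<^sup>L circ (\<lambda>x. complex_of_real (f x) * cis (of_int (- k) * x)) / sqrt (2 * pi)"
  unfolding fourier_coeff_def set_integral_circ by (simp add: cis_conv_exp mult_ac)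

lemma fourier_coeff_0: "fourier_coeff f 0 = complex_of_real (integral\<^sup>L circ f / sqrt (2 * pi))"
  by (simp add: fourier_coeff_circ cis_zero)

lemma fourier_coeff_add:
  assumes "f \<in> L2_circle" "g \<in> L2_circle"
  shows "fourier_coeff (\<lambda>x. f x + g x) k = fourier_coeff f k + fourier_coeff g k"
  unfolding fourier_coeff_circ of_real_add distrib_right
  unfolding Bochner_Integration.integral_add[OF integrable_circ_cis[OF L2_circle_integrable[OF assms(1)]]
      integrable_circ_cis[OF L2_circle_integrable[OF assms(2)]]]
  by (rule add_divide_distrib)

lemma fourier_coeff_cmult: "fourier_coeff (\<lambda>x. c * f x) k = c * fourier_coeff f k"
  unfolding fourier_coeff_circ of_real_mult mult.assoc by simp

lemma fourier_coeff_diff: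
  assumes "f \<in> L2_circle" "g \<in> L2_circle"
  shows "fourier_coeff (\<lambda>x. f x - g x) k = fourier_coeff f k - fourier_coeff g k"
  using fourier_coeff_add[OF assms(1) L2_circle_cmult[OF assms(2), of "-1"]] fourier_coeff_cmult[of "-1" g]
  by simp

lemma fourier_coeff_uminus: "fourier_coeff f (- k) = cnj (fourier_coeff f k)"
proof -
  have "cnj (integral\<^sup>L circ (\<lambda>x. complex_of_real (f x) * cis (of_int (- k) * x)))
     = integral\<^sup>L circ (\<lambda>x. cnj (complex_of_real (f x) * cis (of_int (- k) * x)))"
    by (rule Bochner_Integration.integral_cnj[symmetric])
  then show ?thesis unfolding fourier_coeff_circ by (simp add: cis_cnj)
qed

lemma fourier_coeff_cong_AE:
  assumes "AE x in lborel. f x = g x" "f \<in> borel_measurable borel" "g \<in> borel_measurable borel"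
  shows "fourier_coeff f k = fourier_coeff g k"
proof -
  have [measurable]: "f \<in> borel_measurable circ" "g \<in> borel_measurable circ"
    using assms(2,3) by (auto intro: borel_measurable_circ)
  have [measurable]: "(\<lambda>x. cis (of_int (- k) * x)) \<in> borel_measurable circ"
    by (rule borel_measurable_circ[OF borel_measurable_cis])
  have "AE x in circ. f x = g x"
    using assms(1) by (auto simp: AE_restrict_space_iff elim: eventually_mono)
  then have "AE x in circ. complex_of_real (f x) * cis (of_int (- k) * x) = complex_of_real (g x) * cis (of_int (- k) * x)"
    by eventually_elim simp
  moreover have "(\<lambda>x. complex_of_real (f x) * cis (of_int (- k) * x)) \<in> borel_measurable circ"
    "(\<lambda>x. complex_of_real (g x) * cis (of_int (- k) * x)) \<in> borel_measurable circ"
    by measurable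
  ultimately show ?thesis unfolding fourier_coeff_circ by (simp only: integral_cong_AE)
qed

text \<open>Nonnegative indices suffice, because the functions are real and their coefficients at
  opposite frequencies are conjugate.\<close>

lemma fourier_coeff_eq_imp_AE:
  assumes f: "f \<in> L2_circle" and g: "g \<in> L2_circle"
    and eq: "\<And>n. fourier_coeff f (int n) = fourier_coeff g (int n)"
  shows "AE x in lborel. f x = g x"
proof -
  define h where "h x = f x - g x" for x
  have h: "h \<in> L2_circle" unfolding h_def by (rule L2_circle_diff[OF f g])
  have 0: "fourier_coeff h (int n) = 0" for n
    unfolding h_def fourier_coeff_diff[OF f g] by (simp add: eq)
  have 00: "fourier_coeff h k = 0" for k
    using 0[of "nat \<bar>k\<bar>"] fourier_coeff_uminus[of h k] by (cases "0 \<le> k") auto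
  have "trig_null h"
    unfolding trig_null_def
  proof (intro conjI allI)
    show "integrable circ h" by (rule L2_circle_integrable[OF h])
    show "integral\<^sup>L circ (\<lambda>x. complex_of_real (h x) * cis (of_int k * x)) = 0" for k
      using 00[of "- k"] by (simp add: fourier_coeff_circ)
  qed
  then have "AE x in circ. h x = 0" by (rule trig_null_AE_zero[OF _ L2_circleD(2)[OF h]])
  then have "AE x in lborel. h x = 0" by (rule AE_circ_periodic[OF L2_circleD(1,2)[OF h]])
  then show ?thesis by eventually_elim (simp add: h_def)
qed

section \<open>Trigonometric sums, Riesz-Fischer and Parseval\<close>

abbreviation pos_coeff :: "(real \<Rightarrow> real) \<Rightarrow> nat \<Rightarrow> complex" where
  "pos_coeff f n \<equiv> fourier_coeff f (int (Suc n))"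

text \<open>For a real function the terms of frequencies \<open>freq n\<close> and
  \<open>- freq n\<close> are conjugate and add up to twice a real part, so the positive
  coefficients and a real mean coefficient determine the partial sum.\<close>

definition trig :: "real \<Rightarrow> (nat \<Rightarrow> complex) \<Rightarrow> nat \<Rightarrow> real \<Rightarrow> real" where
  "trig c0 c N x = (c0 + (\<Sum>n<N. 2 * Re (c n * cis (freq n * x)))) / sqrt (2 * pi)"

lemma continuous_on_trig: "continuous_on S (trig c0 c N)"
  unfolding trig_def[abs_def] by (intro continuous_intros) auto

lemma cis_freq_periodic: "cis (freq n * (x + 2 * pi)) = cis (freq n * x)"
proof -
  have "cis (freq n * (2 * pi)) = 1" using cis_multiple_2pi[of "freq n"] by (simp add: freq_def mult_ac)
  then show ?thesis by (simp add: distrib_left cis_mult[symmetric])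
qed

lemma trig_L2: "trig c0 c N \<in> L2_circle"
  by (rule L2_circle_continuous[OF _ continuous_on_trig]) (simp only: trig_def cis_freq_periodic)

lemma integral_mult_trig:
  assumes f: "integrable circ f"
  shows "integral\<^sup>L circ (\<lambda>x. f x * trig c0 c N x)
      = c0 * Re (fourier_coeff f 0) + (\<Sum>n<N. 2 * Re (c n * cnj (pos_coeff f n)))"
proof -
  have i: "integrable circ (\<lambda>x. complex_of_real (f x) * cis (a * x))" for a by (rule integrable_circ_cis[OF f])
  have re: "Re (c n * (complex_of_real (f x) * cis (freq n * x))) = f x * Re (c n * cis (freq n * x))" for n x
    by (simp add: algebra_simps)
  have ir: "integrable circ (\<lambda>x. f x * Re (c n * cis (freq n * x)))" for n
    unfolding re[symmetric] by (intro integrable_Re integrable_mult_right i)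
  have int: "integral\<^sup>L circ (\<lambda>x. f x * Re (c n * cis (freq n * x))) = sqrt (2 * pi) * Re (c n * cnj (pos_coeff f n))" for n
  proof -
    have "integral\<^sup>L circ (\<lambda>x. f x * Re (c n * cis (freq n * x))) = Re (c n * integral\<^sup>L circ (\<lambda>x. complex_of_real (f x) * cis (freq n * x)))"
      unfolding re[symmetric] by (subst integral_Re) (auto intro: integrable_mult_right i)
    also have "integral\<^sup>L circ (\<lambda>x. complex_of_real (f x) * cis (freq n * x)) = sqrt (2 * pi) * fourier_coeff f (- int (Suc n))"
      by (simp add: fourier_coeff_circ freq_def add.commute)
    finally have e: "integral\<^sup>L circ (\<lambda>x. f x * Re (c n * cis (freq n * x))) =
        Re (c n * (sqrt (2 * pi) * fourier_coeff f (- int (Suc n))))" .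
    have "Re (a * (complex_of_real r * z)) = r * Re (a * z)" for a z r by (simp add: algebra_simps)
    then show ?thesis unfolding e fourier_coeff_uminus .
  qed
  have "f x * trig c0 c N x = (c0 * f x + (\<Sum>n<N. 2 * (f x * Re (c n * cis (freq n * x))))) / sqrt (2 * pi)" for x
    by (simp add: trig_def distrib_left sum_distrib_left mult_ac)
  then have "integral\<^sup>L circ (\<lambda>x. f x * trig c0 c N x)
      = (c0 * integral\<^sup>L circ f + (\<Sum>n<N. 2 * integral\<^sup>L circ (\<lambda>x. f x * Re (c n * cis (freq n * x))))) / sqrt (2 * pi)"
    using f ir by simp
  also have "\<dots> = c0 * Re (fourier_coeff f 0) + (\<Sum>n<N. 2 * Re (c n * cnj (pos_coeff f n)))"
  proof -
    have "integral\<^sup>L circ f = sqrt (2 * pi) * Re (fourier_coeff f 0)" by (simp add: fourier_coeff_0)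
    moreover have "(\<Sum>n<N. 2 * (sqrt (2 * pi) * X n)) = sqrt (2 * pi) * (\<Sum>n<N. 2 * X n)" for X
      by (simp add: sum_distrib_left mult_ac)
    moreover have "(c0 * (sqrt (2 * pi) * a) + sqrt (2 * pi) * b) / sqrt (2 * pi) = c0 * a + b" for a b
      by (simp add: field_simps)
    ultimately show ?thesis unfolding int by simp
  qed
  finally show ?thesis .
qed

lemma fourier_coeff_trig:
  "fourier_coeff (trig c0 c N) 0 = c0"
  "pos_coeff (trig c0 c N) m = (if m < N then c m else 0)"
proof -
  have eq: "complex_of_real (trig c0 c N x) * cis (of_int (- k) * x) =
     (c0 * cis (of_int (- k) * x) + (\<Sum>n<N. c n * cis (of_int (int (Suc n) - k) * x) + cnj (c n) * cis (of_int (- int (Suc n) - k) * x))) / sqrt (2 * pi)" for x k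
  proof -
    have 1: "complex_of_real (2 * Re (c n * cis (freq n * x))) = c n * cis (freq n * x) + cnj (c n) * cis (- (freq n * x))" for n
      using complex_add_cnj[of "c n * cis (freq n * x)"] by (simp add: cis_cnj)
    have 2: "cis (freq n * x) * cis (of_int (- k) * x) = cis (of_int (int (Suc n) - k) * x)"
      "cis (- (freq n * x)) * cis (of_int (- k) * x) = cis (of_int (- int (Suc n) - k) * x)" for n
      by (simp_all add: cis_mult freq_def algebra_simps)
    show ?thesis
      unfolding trig_def of_real_divide of_real_add of_real_sum 1
      by (simp only: times_divide_eq_left distrib_right sum_distrib_right mult.assoc 2)
  qed
  have i: "integrable circ (\<lambda>x. cis (a * x))" for a
    using integrable_circ_cis[of "\<lambda>_. 1" a] by simp
  define \<delta> :: "bool \<Rightarrow> complex" where "\<delta> b = (if b then 1 else 0)" for b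
  define w r where "w = complex_of_real (2 * pi)" and "r = complex_of_real (sqrt (2 * pi))"
  have wr: "w = r * r" "r \<noteq> 0" unfolding w_def r_def of_real_mult[symmetric] by simp_all
  have \<delta>: "integral\<^sup>L circ (\<lambda>x. cis (of_int k * x)) = w * \<delta> (k = 0)" for k
    unfolding integral_circ_cis by (simp add: \<delta>_def w_def)
  have fc: "fourier_coeff (trig c0 c N) k = c0 * \<delta> (k = 0) +
      (\<Sum>n<N. c n * \<delta> (int (Suc n) = k) + cnj (c n) * \<delta> (- int (Suc n) = k))" (is "_ = ?Z") for k
  proof -
    have "integral\<^sup>L circ (\<lambda>x. complex_of_real (trig c0 c N x) * cis (of_int (- k) * x)) =
     (c0 * integral\<^sup>L circ (\<lambda>x. cis (of_int (- k) * x)) + (\<Sum>n<N. c n * integral\<^sup>L circ (\<lambda>x. cis (of_int (int (Suc n) - k) * x))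
       + cnj (c n) * integral\<^sup>L circ (\<lambda>x. cis (of_int (- int (Suc n) - k) * x)))) / r"
      unfolding eq using i by (simp del: of_int_diff of_int_minus of_int_of_nat_eq add: r_def)
    also have "\<dots> = (c0 * (w * \<delta> (k = 0)) + (\<Sum>n<N. c n * (w * \<delta> (int (Suc n) = k)) + cnj (c n) * (w * \<delta> (- int (Suc n) = k)))) / r"
      unfolding \<delta> by simp
    also have "\<dots> = w * ?Z / r"
      by (simp only: distrib_left sum_distrib_left mult.left_commute[of w])
    finally show ?thesis
      unfolding fourier_coeff_circ r_def[symmetric] using wr by simp
  qed
  have "\<delta> (int (Suc n) = 0) = 0" "\<delta> (- int (Suc n) = 0) = 0" for n
    by (auto simp: \<delta>_def)
  then show "fourier_coeff (trig c0 c N) 0 = c0" unfolding fc by (simp add: \<delta>_def)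
  have "\<delta> (int (Suc n) = int (Suc m)) = (if n = m then 1 else 0)" "\<delta> (- int (Suc n) = int (Suc m)) = 0"
    "\<delta> (int (Suc m) = 0) = 0" for n
    by (auto simp: \<delta>_def)
  then have "pos_coeff (trig c0 c N) m = (\<Sum>n<N. c n * (if n = m then 1 else 0))"
    unfolding fc by simp
  then show "pos_coeff (trig c0 c N) m = (if m < N then c m else 0)"
    by (simp add: if_distrib[of "\<lambda>x. _ * x"] cong: if_cong)
qed

lemma integral_trig_sq:
  "integral\<^sup>L circ (\<lambda>x. (trig c0 c N x)\<^sup>2) = c0\<^sup>2 + (\<Sum>n<N. 2 * (cmod (c n))\<^sup>2)"
proof -
  have "integral\<^sup>L circ (\<lambda>x. (trig c0 c N x)\<^sup>2) = c0 * c0 + (\<Sum>n<N. 2 * Re (c n * cnj (if n < N then c n else 0)))"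
    unfolding power2_eq_square integral_mult_trig[OF L2_circle_integrable[OF trig_L2]] fourier_coeff_trig by simp
  also have "(\<Sum>n<N. 2 * Re (c n * cnj (if n < N then c n else 0))) = (\<Sum>n<N. 2 * (cmod (c n))\<^sup>2)"
    by (intro sum.cong refl) (simp add: complex_mult_cnj cmod_power2)
  finally show ?thesis by (simp add: power2_eq_square)
qed

lemma trig_diff:
  assumes "M \<le> N"
  shows "trig c0 c N x - trig c0 c M x = trig 0 (\<lambda>n. if M \<le> n then c n else 0) N x"
proof -
  have "(\<Sum>n<N. 2 * Re (c n * cis (freq n * x))) - (\<Sum>n<M. 2 * Re (c n * cis (freq n * x)))
      = (\<Sum>n<N. 2 * Re ((if M \<le> n then c n else 0) * cis (freq n * x)))"
  proof -
    have "(\<Sum>n<N. 2 * Re (c n * cis (freq n * x))) =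
      (\<Sum>n<M. 2 * Re (c n * cis (freq n * x))) + (\<Sum>n\<in>{M..<N}. 2 * Re (c n * cis (freq n * x)))"
      using assms by (subst sum.union_disjoint[symmetric]) (auto intro: sum.cong)
    moreover have "(\<Sum>n<N. 2 * Re ((if M \<le> n then c n else 0) * cis (freq n * x))) = (\<Sum>n\<in>{M..<N}. 2 * Re (c n * cis (freq n * x)))"
      by (rule sum.mono_neutral_cong_right) auto
    ultimately show ?thesis by simp
  qed
  then show ?thesis unfolding trig_def by (simp add: diff_divide_distrib[symmetric])
qed

text \<open>The squared deviation of |f| from its mean \<open>m\<close> over the circle has a
  nonnegative integral.\<close>

lemma integral_circ_abs_le:
  assumes f: "f \<in> L2_circle"
  shows "integral\<^sup>L circ (\<lambda>x. \<bar>f x\<bar>) \<le> sqrt (2 * pi) * sqrt (integral\<^sup>L circ (\<lambda>x. (f x)\<^sup>2))"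
proof -
  define I where "I = integral\<^sup>L circ (\<lambda>x. \<bar>f x\<bar>)"
  define m where "m = I / (2 * pi)"
  have i: "integrable circ (\<lambda>x. \<bar>f x\<bar>)" "integrable circ (\<lambda>x. (f x)\<^sup>2)"
    using L2_circle_integrable[OF f] L2_circleD(3)[OF f] by auto
  have "0 \<le> integral\<^sup>L circ (\<lambda>x. (\<bar>f x\<bar> - m)\<^sup>2)" by simp
  also have "(\<lambda>x. (\<bar>f x\<bar> - m)\<^sup>2) = (\<lambda>x. (f x)\<^sup>2 + m\<^sup>2 - 2 * m * \<bar>f x\<bar>)"
    by (simp add: power2_diff mult_ac)
  also have "integral\<^sup>L circ \<dots> = integral\<^sup>L circ (\<lambda>x. (f x)\<^sup>2) + m\<^sup>2 * (2 * pi) - 2 * m * I"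
    using i measure_circ by (simp add: I_def)
  also have "\<dots> = integral\<^sup>L circ (\<lambda>x. (f x)\<^sup>2) - I\<^sup>2 / (2 * pi)"
    by (simp add: m_def power2_eq_square field_simps)
  finally have "I\<^sup>2 \<le> 2 * pi * integral\<^sup>L circ (\<lambda>x. (f x)\<^sup>2)" by (simp add: field_simps)
  then have "sqrt (I\<^sup>2) \<le> sqrt (2 * pi * integral\<^sup>L circ (\<lambda>x. (f x)\<^sup>2))" by (rule real_sqrt_le_mono)
  then show ?thesis by (simp add: I_def real_sqrt_mult)
qed

lemma cmod_fourier_coeff_le_L1:
  "cmod (fourier_coeff f k) \<le> integral\<^sup>L circ (\<lambda>x. \<bar>f x\<bar>) / sqrt (2 * pi)"
proof -
  have "cmod (integral\<^sup>L circ (\<lambda>x. complex_of_real (f x) * cis (of_int (- k) * x)))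
      \<le> integral\<^sup>L circ (\<lambda>x. cmod (complex_of_real (f x) * cis (of_int (- k) * x)))"
    by (rule integral_norm_bound)
  then show ?thesis unfolding fourier_coeff_circ norm_divide by (simp add: norm_mult divide_right_mono)
qed

lemma cmod_fourier_coeff_le:
  assumes f: "f \<in> L2_circle"
  shows "cmod (fourier_coeff f k) \<le> sqrt (integral\<^sup>L circ (\<lambda>x. (f x)\<^sup>2))"
proof -
  have "integral\<^sup>L circ (\<lambda>x. \<bar>f x\<bar>) / sqrt (2 * pi) \<le> sqrt (integral\<^sup>L circ (\<lambda>x. (f x)\<^sup>2))"
    using integral_circ_abs_le[OF f] by (subst pos_divide_le_eq) (auto simp: mult.commute)
  then show ?thesis using cmod_fourier_coeff_le_L1[of f k] by linarith
qed

lemma integral_diff_trig_sq: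
  assumes f: "f \<in> L2_circle" and c0: "fourier_coeff f 0 = complex_of_real c0" and c: "\<And>n. n < N \<Longrightarrow> pos_coeff f n = c n"
  shows "integral\<^sup>L circ (\<lambda>x. (f x - trig c0 c N x)\<^sup>2) = integral\<^sup>L circ (\<lambda>x. (f x)\<^sup>2) - (c0\<^sup>2 + (\<Sum>n<N. 2 * (cmod (c n))\<^sup>2))"
proof -
  have t: "trig c0 c N \<in> L2_circle" by (rule trig_L2)
  have "(\<lambda>x. (f x - trig c0 c N x)\<^sup>2) = (\<lambda>x. (f x)\<^sup>2 + (trig c0 c N x)\<^sup>2 - 2 * (f x * trig c0 c N x))"
    by (simp add: power2_diff mult_ac)
  moreover have "integral\<^sup>L circ (\<lambda>x. (f x)\<^sup>2 + (trig c0 c N x)\<^sup>2 - 2 * (f x * trig c0 c N x))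
     = integral\<^sup>L circ (\<lambda>x. (f x)\<^sup>2) + integral\<^sup>L circ (\<lambda>x. (trig c0 c N x)\<^sup>2) - 2 * integral\<^sup>L circ (\<lambda>x. f x * trig c0 c N x)"
    using L2_circleD(3)[OF f] L2_circleD(3)[OF t] integrable_circ_mult[OF f t] by simp
  moreover have "integral\<^sup>L circ (\<lambda>x. f x * trig c0 c N x) = c0\<^sup>2 + (\<Sum>n<N. 2 * (cmod (c n))\<^sup>2)"
  proof -
    have "(\<Sum>n<N. 2 * Re (c n * cnj (pos_coeff f n))) = (\<Sum>n<N. 2 * (cmod (c n))\<^sup>2)"
      by (intro sum.cong refl) (use c in \<open>simp add: complex_mult_cnj cmod_power2 del: of_nat_Suc\<close>)
    then show ?thesis unfolding integral_mult_trig[OF L2_circle_integrable[OF f]] c0 by (simp add: power2_eq_square)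
  qed
  ultimately show ?thesis unfolding integral_trig_sq by simp
qed

text \<open>The partial sums are Cauchy in L^2, hence in L^1, and a subsequence converges almost
  everywhere. Fatou's lemma carries the L^2 bound of the tails over to the limit, and this gives
  integrability, the coefficients and the norm.\<close>

theorem riesz_fischer:
  fixes c :: "nat \<Rightarrow> complex" and c0 :: real
  assumes s: "summable (\<lambda>n. (cmod (c n))\<^sup>2)"
  obtains f where "f \<in> L2_circle" "fourier_coeff f 0 = complex_of_real c0" "\<And>n. pos_coeff f n = c n"
    "integral\<^sup>L circ (\<lambda>x. (f x)\<^sup>2) = c0\<^sup>2 + 2 * (\<Sum>n. (cmod (c n))\<^sup>2)"
proof -
  define g where "g n = (cmod (c n))\<^sup>2" for n
  have gs: "summable g" using s by (simp add: g_def[abs_def])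
  define S where "S = trig c0 c"
  define tail where "tail M = 2 * (suminf g - sum g {..<M})" for M
  have "(\<lambda>M. 2 * (suminf g - sum g {..<M})) \<longlonglongrightarrow> 2 * (suminf g - suminf g)"
    by (intro tendsto_intros summable_LIMSEQ gs)
  then have tail_lim: "tail \<longlonglongrightarrow> 0" by (simp add: tail_def[abs_def])
  have tail_nn: "0 \<le> tail M" for M
    using sum_le_suminf[OF gs, of "{..<M}"] by (simp add: tail_def g_def)
  have SL2: "S N \<in> L2_circle" for N by (simp add: S_def trig_L2)
  have diff_sq: "integral\<^sup>L circ (\<lambda>x. (S N x - S M x)\<^sup>2) \<le> tail M" if "M \<le> N" for M N
  proof -
    have "integral\<^sup>L circ (\<lambda>x. (S N x - S M x)\<^sup>2) = (\<Sum>n<N. 2 * (cmod (if M \<le> n then c n else 0))\<^sup>2)"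
      unfolding S_def trig_diff[OF that] integral_trig_sq by simp
    also have "\<dots> = (\<Sum>n<N. 2 * g n) - (\<Sum>n<M. 2 * g n)"
    proof -
      have "(\<Sum>n<N. 2 * (cmod (if M \<le> n then c n else 0))\<^sup>2) = (\<Sum>n\<in>{M..<N}. 2 * g n)"
        by (rule sum.mono_neutral_cong_right) (auto simp: g_def)
      moreover have "(\<Sum>n<N. 2 * g n) = (\<Sum>n<M. 2 * g n) + (\<Sum>n\<in>{M..<N}. 2 * g n)"
        using that by (subst sum.union_disjoint[symmetric]) (auto intro: sum.cong)
      ultimately show ?thesis by simp
    qed
    also have "\<dots> \<le> tail M"
      using sum_le_suminf[OF gs, of "{..<N}"] by (simp add: tail_def g_def sum_distrib_left[symmetric])
    finally show ?thesis .
  qed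
  have diff_L1: "integral\<^sup>L circ (\<lambda>x. norm (S i x - S j x)) \<le> sqrt (2 * pi) * sqrt (tail M)" if "M \<le> i" "M \<le> j" for i j M
  proof -
    have 1: "integral\<^sup>L circ (\<lambda>x. \<bar>S i x - S j x\<bar>) \<le> sqrt (2 * pi) * sqrt (tail M)" if "M \<le> j" "j \<le> i" for i j
    proof -
      have "tail j \<le> tail M" using sum_mono2[of "{..<j}" "{..<M}" g] that by (auto simp: tail_def g_def)
      then have "integral\<^sup>L circ (\<lambda>x. (S i x - S j x)\<^sup>2) \<le> tail M" using diff_sq[OF that(2)] by linarith
      then have "sqrt (2 * pi) * sqrt (integral\<^sup>L circ (\<lambda>x. (S i x - S j x)\<^sup>2)) \<le> sqrt (2 * pi) * sqrt (tail M)"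
        by (intro mult_left_mono real_sqrt_le_mono) auto
      then show ?thesis using integral_circ_abs_le[OF L2_circle_diff[OF SL2 SL2], of i j] by linarith
    qed
    show ?thesis
      using 1[of i j] 1[of j i] that by (cases "j \<le> i") (auto simp: abs_minus_commute)
  qed
  obtain r where r: "strict_mono r" and rC: "AE x in circ. Cauchy (\<lambda>i. S (r i) x)"
  proof (rule cauchy_L1_AE_cauchy_subseq[of circ S])
    show "integrable circ (S n)" for n by (rule L2_circle_integrable[OF SL2])
    fix e :: real assume e: "0 < e"
    have "(\<lambda>M. sqrt (2 * pi) * sqrt (tail M)) \<longlonglongrightarrow> sqrt (2 * pi) * sqrt 0"
      by (intro tendsto_intros tail_lim)
    then have "\<forall>\<^sub>F M in sequentially. sqrt (2 * pi) * sqrt (tail M) < e" using e by (intro order_tendstoD(2)) auto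
    then obtain M where "sqrt (2 * pi) * sqrt (tail M) < e" by (auto simp: eventually_sequentially)
    then show "\<exists>N. \<forall>i\<ge>N. \<forall>j\<ge>N. (LINT x|circ. norm (S i x - S j x)) < e"
      using diff_L1 by (intro exI[of _ M]) (meson le_less_trans)
  qed
  \<comment> \<open>Taking \<open>lim\<close> at every point keeps \<open>f\<close> periodic and
    measurable on the whole line, also at points where the subsequence diverges.\<close>
  define f where "f x = lim (\<lambda>i. S (r i) x)" for x
  have Sm: "S N \<in> borel_measurable borel" for N by (rule L2_circleD(2)[OF SL2])
  have fm: "f \<in> borel_measurable borel"
    unfolding f_def[abs_def] by (intro borel_measurable_lim_metric Sm)
  have lim: "AE x in circ. (\<lambda>i. S (r i) x) \<longlonglongrightarrow> f x"
    using rC by eventually_elim (simp add: f_def Cauchy_convergent convergent_LIMSEQ_iff[symmetric])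
  have close: "integrable circ (\<lambda>x. (f x - S M x)\<^sup>2) \<and> integral\<^sup>L circ (\<lambda>x. (f x - S M x)\<^sup>2) \<le> tail M" for M
  proof -
    have m: "(\<lambda>x. (h x - S M x)\<^sup>2) \<in> borel_measurable circ" if "h \<in> borel_measurable borel" for h
      using that Sm[of M] by (intro borel_measurable_circ) measurable
    have "(\<integral>\<^sup>+ x. ennreal ((f x - S M x)\<^sup>2) \<partial>circ) = (\<integral>\<^sup>+ x. liminf (\<lambda>i. ennreal ((S (r i) x - S M x)\<^sup>2)) \<partial>circ)"
    proof (rule nn_integral_cong_AE)
      show "AE x in circ. ennreal ((f x - S M x)\<^sup>2) = liminf (\<lambda>i. ennreal ((S (r i) x - S M x)\<^sup>2))"
        using lim
      proof eventually_elim
        case (elim x)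
        then have "(\<lambda>i. ennreal ((S (r i) x - S M x)\<^sup>2)) \<longlonglongrightarrow> ennreal ((f x - S M x)\<^sup>2)"
          by (intro tendsto_ennrealI tendsto_intros)
        then show ?case by (intro lim_imp_Liminf[symmetric]) auto
      qed
    qed
    also have "\<dots> \<le> liminf (\<lambda>i. \<integral>\<^sup>+ x. ennreal ((S (r i) x - S M x)\<^sup>2) \<partial>circ)"
      by (rule nn_integral_liminf) (use m[OF Sm] in measurable)
    also have "\<dots> \<le> limsup (\<lambda>i. \<integral>\<^sup>+ x. ennreal ((S (r i) x - S M x)\<^sup>2) \<partial>circ)"
      by (rule Liminf_le_Limsup) simp
    also have "\<dots> \<le> ennreal (tail M)"
    proof (rule Limsup_bounded)
      show "\<forall>\<^sub>F i in sequentially. (\<integral>\<^sup>+ x. ennreal ((S (r i) x - S M x)\<^sup>2) \<partial>circ) \<le> ennreal (tail M)"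
      proof (rule eventually_sequentiallyI[of M])
        fix i assume "M \<le> i"
        then have "M \<le> r i" using seq_suble[OF r, of i] by simp
        have "(\<integral>\<^sup>+ x. ennreal ((S (r i) x - S M x)\<^sup>2) \<partial>circ) = ennreal (integral\<^sup>L circ (\<lambda>x. (S (r i) x - S M x)\<^sup>2))"
          by (rule nn_integral_eq_integral) (auto intro: L2_circleD(3)[OF L2_circle_diff[OF SL2 SL2]])
        then show "(\<integral>\<^sup>+ x. ennreal ((S (r i) x - S M x)\<^sup>2) \<partial>circ) \<le> ennreal (tail M)"
          using diff_sq[OF \<open>M \<le> r i\<close>] by (simp add: ennreal_leI)
      qed
    qed
    finally have le: "(\<integral>\<^sup>+ x. ennreal ((f x - S M x)\<^sup>2) \<partial>circ) \<le> ennreal (tail M)" .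
    have i: "integrable circ (\<lambda>x. (f x - S M x)\<^sup>2)"
      by (rule integrableI_bounded[OF m[OF fm]]) (use le in \<open>auto intro: le_less_trans\<close>)
    have "ennreal (integral\<^sup>L circ (\<lambda>x. (f x - S M x)\<^sup>2)) \<le> ennreal (tail M)"
      using le by (subst nn_integral_eq_integral[OF i, symmetric]) auto
    then show ?thesis using i tail_nn[of M] by simp
  qed
  have Dper: "f (x + 2 * pi) - S M (x + 2 * pi) = f x - S M x" for x M
    unfolding f_def using L2_circleD(1)[OF SL2] by simp
  have DL2: "(\<lambda>x. f x - S M x) \<in> L2_circle" for M
    by (rule L2_circleI) (use Dper fm Sm close in \<open>auto intro: borel_measurable_diff\<close>)
  have fL2: "f \<in> L2_circle" using L2_circle_add[OF DL2 SL2, of 0 0] by simp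
  have coeff: "fourier_coeff f k = z" if "\<forall>\<^sub>F M in sequentially. fourier_coeff (S M) k = z" for k z
  proof -
    have b: "cmod (fourier_coeff f k - fourier_coeff (S M) k) \<le> sqrt (tail M)" for M
      using cmod_fourier_coeff_le[OF DL2, of M k] real_sqrt_le_mono[OF conjunct2[OF close[of M]]]
      unfolding fourier_coeff_diff[OF fL2 SL2] by linarith
    have l: "(\<lambda>M. sqrt (tail M)) \<longlonglongrightarrow> 0" using tendsto_real_sqrt[OF tail_lim] by simp
    have "(\<lambda>M. fourier_coeff f k - fourier_coeff (S M) k) \<longlonglongrightarrow> 0"
      by (rule Lim_null_comparison[OF always_eventually l]) (use b in blast)
    moreover have "\<forall>\<^sub>F M in sequentially. fourier_coeff f k - fourier_coeff (S M) k = fourier_coeff f k - z"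
      using that by eventually_elim simp
    ultimately have "(\<lambda>M. fourier_coeff f k - z) \<longlonglongrightarrow> 0" by (rule Lim_transform_eventually)
    then show ?thesis by (simp add: LIMSEQ_const_iff)
  qed
  have f0: "fourier_coeff f 0 = complex_of_real c0"
    by (rule coeff) (simp add: S_def fourier_coeff_trig)
  have fc: "pos_coeff f n = c n" for n
    by (rule coeff) (auto simp: S_def fourier_coeff_trig eventually_sequentially simp del: of_nat_Suc intro!: exI[of _ "Suc n"])
  have "integral\<^sup>L circ (\<lambda>x. (f x)\<^sup>2) = c0\<^sup>2 + 2 * suminf g"
  proof -
    have eq: "integral\<^sup>L circ (\<lambda>x. (f x - S M x)\<^sup>2) = integral\<^sup>L circ (\<lambda>x. (f x)\<^sup>2) - (c0\<^sup>2 + 2 * sum g {..<M})" for M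
      unfolding S_def by (subst integral_diff_trig_sq[OF fL2 f0]) (auto simp: fc g_def sum_distrib_left simp del: of_nat_Suc)
    have "0 \<le> integral\<^sup>L circ (\<lambda>x. (f x - S M x)\<^sup>2)" for M by simp
    then have "norm (integral\<^sup>L circ (\<lambda>x. (f x)\<^sup>2) - (c0\<^sup>2 + 2 * sum g {..<M})) \<le> tail M" for M
      using conjunct2[OF close[of M]] unfolding eq real_norm_def by (metis abs_of_nonneg)
    then have "\<forall>\<^sub>F M in sequentially. norm (integral\<^sup>L circ (\<lambda>x. (f x)\<^sup>2) - (c0\<^sup>2 + 2 * sum g {..<M})) \<le> tail M"
      by (rule always_eventually[OF allI])
    then have "(\<lambda>M. integral\<^sup>L circ (\<lambda>x. (f x)\<^sup>2) - (c0\<^sup>2 + 2 * sum g {..<M})) \<longlonglongrightarrow> 0"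
      using tail_lim by (rule Lim_null_comparison)
    moreover have "(\<lambda>M. integral\<^sup>L circ (\<lambda>x. (f x)\<^sup>2) - (c0\<^sup>2 + 2 * sum g {..<M})) \<longlonglongrightarrow>
        integral\<^sup>L circ (\<lambda>x. (f x)\<^sup>2) - (c0\<^sup>2 + 2 * suminf g)"
      by (intro tendsto_intros summable_LIMSEQ gs)
    ultimately show ?thesis using LIMSEQ_unique by fastforce
  qed
  then show ?thesis using that[OF fL2 f0 fc] by (simp add: g_def[abs_def])
qed

lemma bessel_summable:
  assumes f: "f \<in> L2_circle" shows "summable (\<lambda>n. (cmod (pos_coeff f n))\<^sup>2)"
proof (rule summableI_nonneg_bounded)
  show "(\<Sum>n<N. (cmod (pos_coeff f n))\<^sup>2) \<le> integral\<^sup>L circ (\<lambda>x. (f x)\<^sup>2)" for N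
  proof -
    have "0 \<le> integral\<^sup>L circ (\<lambda>x. (f x - trig (Re (fourier_coeff f 0)) (pos_coeff f) N x)\<^sup>2)" by simp
    also have "\<dots> = integral\<^sup>L circ (\<lambda>x. (f x)\<^sup>2) - ((Re (fourier_coeff f 0))\<^sup>2 + (\<Sum>n<N. 2 * (cmod (pos_coeff f n))\<^sup>2))"
      by (rule integral_diff_trig_sq[OF f]) (auto simp: fourier_coeff_0)
    finally have *: "(Re (fourier_coeff f 0))\<^sup>2 + 2 * (\<Sum>n<N. (cmod (pos_coeff f n))\<^sup>2) \<le> integral\<^sup>L circ (\<lambda>x. (f x)\<^sup>2)"
      unfolding sum_distrib_left by simp
    moreover have "0 \<le> (\<Sum>n<N. (cmod (pos_coeff f n))\<^sup>2)" by (rule sum_nonneg) simp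
    moreover have "0 \<le> (Re (fourier_coeff f 0))\<^sup>2" by simp
    ultimately show ?thesis by linarith
  qed
qed auto

text \<open>The function built by \<open>riesz_fischer\<close> from the coefficients of
  \<open>f\<close> satisfies the identity by construction, and equality of coefficients identifies
  it with \<open>f\<close> almost everywhere.\<close>

theorem parseval:
  assumes f: "f \<in> L2_circle"
  shows "integral\<^sup>L circ (\<lambda>x. (f x)\<^sup>2) = (Re (fourier_coeff f 0))\<^sup>2 + 2 * (\<Sum>n. (cmod (pos_coeff f n))\<^sup>2)"
proof -
  obtain h where h: "h \<in> L2_circle" "fourier_coeff h 0 = complex_of_real (Re (fourier_coeff f 0))"
    "\<And>n. pos_coeff h n = pos_coeff f n"
    and eq: "integral\<^sup>L circ (\<lambda>x. (h x)\<^sup>2) = (Re (fourier_coeff f 0))\<^sup>2 + 2 * (\<Sum>n. (cmod (pos_coeff f n))\<^sup>2)"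
    by (rule riesz_fischer[OF bessel_summable[OF f], of "Re (fourier_coeff f 0)"]) blast
  have "fourier_coeff h (int n) = fourier_coeff f (int n)" for n
    using h(2,3) by (cases n) (auto simp: fourier_coeff_0 simp del: of_nat_Suc)
  then have "AE x in lborel. h x = f x" by (rule fourier_coeff_eq_imp_AE[OF h(1) f])
  then have "AE x in circ. (h x)\<^sup>2 = (f x)\<^sup>2" by (auto simp: AE_restrict_space_iff elim: eventually_mono)
  then have "integral\<^sup>L circ (\<lambda>x. (h x)\<^sup>2) = integral\<^sup>L circ (\<lambda>x. (f x)\<^sup>2)"
    using L2_circleD(4)[OF h(1)] L2_circleD(4)[OF f] by (intro integral_cong_AE) auto
  then show ?thesis using eq by simp
qed

text \<open>Polarisation of \<open>parseval\<close>, applied to f + g and f - g.\<close>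

lemma circle_pairing_sums:
  assumes f: "f \<in> L2_circle" and g: "g \<in> L2_circle"
  shows "(\<lambda>n. 2 * Re (pos_coeff f n * cnj (pos_coeff g n))) sums
    (circle_pairing f g - Re (fourier_coeff f 0) * Re (fourier_coeff g 0))"
proof -
  define h k where "h x = f x + g x" and "k x = f x - g x" for x
  have h: "h \<in> L2_circle" and k: "k \<in> L2_circle"
    unfolding h_def k_def by (intro L2_circle_add L2_circle_diff f g)+
  have hc: "fourier_coeff h j = fourier_coeff f j + fourier_coeff g j" and kc: "fourier_coeff k j = fourier_coeff f j - fourier_coeff g j" for j
    unfolding h_def k_def by (rule fourier_coeff_add[OF f g], rule fourier_coeff_diff[OF f g])
  have "(\<lambda>x. (h x)\<^sup>2 - (k x)\<^sup>2) = (\<lambda>x. 4 * (f x * g x))"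
    by (simp add: h_def k_def power2_sum power2_diff)
  then have "4 * circle_pairing f g = integral\<^sup>L circ (\<lambda>x. (h x)\<^sup>2 - (k x)\<^sup>2)"
    by (simp add: circle_pairing_circ)
  also have "\<dots> = integral\<^sup>L circ (\<lambda>x. (h x)\<^sup>2) - integral\<^sup>L circ (\<lambda>x. (k x)\<^sup>2)"
    by (intro Bochner_Integration.integral_diff L2_circleD(3) h k)
  finally have p: "4 * circle_pairing f g = integral\<^sup>L circ (\<lambda>x. (h x)\<^sup>2) - integral\<^sup>L circ (\<lambda>x. (k x)\<^sup>2)" .
  have pol: "(cmod (z + w))\<^sup>2 - (cmod (z - w))\<^sup>2 = 4 * Re (z * cnj w)" for z w
    unfolding cmod_power2 by (simp add: power2_eq_square algebra_simps)
  have "(\<lambda>n. (cmod (pos_coeff h n))\<^sup>2 - (cmod (pos_coeff k n))\<^sup>2) sums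
      ((\<Sum>n. (cmod (pos_coeff h n))\<^sup>2) - (\<Sum>n. (cmod (pos_coeff k n))\<^sup>2))"
    by (intro sums_diff summable_sums bessel_summable h k)
  then have "(\<lambda>n. 4 * Re (pos_coeff f n * cnj (pos_coeff g n))) sums
      ((\<Sum>n. (cmod (pos_coeff h n))\<^sup>2) - (\<Sum>n. (cmod (pos_coeff k n))\<^sup>2))"
    unfolding hc kc pol .
  from sums_mult[OF this, of "1 / 2"]
  have "(\<lambda>n. 2 * Re (pos_coeff f n * cnj (pos_coeff g n))) sums
      (1 / 2 * ((\<Sum>n. (cmod (pos_coeff h n))\<^sup>2) - (\<Sum>n. (cmod (pos_coeff k n))\<^sup>2)))"
    by (simp only: mult.assoc[symmetric]) simp
  moreover have "1 / 2 * ((\<Sum>n. (cmod (pos_coeff h n))\<^sup>2) - (\<Sum>n. (cmod (pos_coeff k n))\<^sup>2))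
      = circle_pairing f g - Re (fourier_coeff f 0) * Re (fourier_coeff g 0)"
  proof -
    have "4 * (Re (fourier_coeff f 0) * Re (fourier_coeff g 0)) = (Re (fourier_coeff h 0))\<^sup>2 - (Re (fourier_coeff k 0))\<^sup>2"
      unfolding hc kc by (simp add: power2_eq_square algebra_simps)
    then show ?thesis using p unfolding parseval[OF h] parseval[OF k] by simp
  qed
  ultimately show ?thesis by (simp only:)
qed


section \<open>Sobolev norms, test functions and weak derivatives\<close>

text \<open>The nonzero integers are split into the ranges of n + 1 and -(n + 1), on which an even
  summand takes the same values. This translates the unordered sums of the Sobolev norms into series
  over \<open>nat\<close>.\<close>

lemma summable_on_nonzero_ints_even:
  fixes h :: "int \<Rightarrow> real"
  assumes nn: "\<And>k. 0 \<le> h k" and ev: "\<And>k. h (- k) = h k"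
  shows "h summable_on (- {0}) \<longleftrightarrow> summable (\<lambda>n. h (int (Suc n)))"
    and "summable (\<lambda>n. h (int (Suc n))) \<Longrightarrow> infsum h (- {0}) = 2 * (\<Sum>n. h (int (Suc n)))"
proof -
  define P N where "P n = int (Suc n)" and "N n = - int (Suc n)" for n
  have inj: "inj P" "inj N" by (auto simp: inj_def P_def N_def)
  have un: "- {0} = range P \<union> range N"
  proof (intro set_eqI iffI)
    fix k :: int assume "k \<in> - {0}"
    then have "k = P (nat \<bar>k\<bar> - 1) \<or> k = N (nat \<bar>k\<bar> - 1)" by (auto simp: P_def N_def)
    then show "k \<in> range P \<union> range N" by auto
  qed (auto simp: P_def N_def)
  have disj: "range P \<inter> range N = {}" by (auto simp: P_def N_def)
  have comp: "h \<circ> P = (\<lambda>n. h (int (Suc n)))" "h \<circ> N = (\<lambda>n. h (int (Suc n)))"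
    by (auto simp: P_def N_def fun_eq_iff ev[of "int (Suc _)", simplified])
  have sP: "h summable_on range P \<longleftrightarrow> summable (\<lambda>n. h (int (Suc n)))"
    and sN: "h summable_on range N \<longleftrightarrow> summable (\<lambda>n. h (int (Suc n)))"
    unfolding summable_on_reindex[OF inj(1)] summable_on_reindex[OF inj(2)] comp
    by (rule summable_on_UNIV_nonneg_real_iff, rule nn)+
  show 1: "h summable_on (- {0}) \<longleftrightarrow> summable (\<lambda>n. h (int (Suc n)))"
    unfolding un using sP sN summable_on_Un_disjoint[OF _ _ disj] summable_on_subset_banach[of h "range P \<union> range N" "range P"] by blast
  assume s: "summable (\<lambda>n. h (int (Suc n)))"
  have "infsum (\<lambda>n. h (int (Suc n))) UNIV = (\<Sum>n. h (int (Suc n)))"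
    by (rule infsumI[OF sums_nonneg_imp_has_sum[OF summable_sums[OF s] nn]])
  then show "infsum h (- {0}) = 2 * (\<Sum>n. h (int (Suc n)))"
    unfolding un using s sP sN
    by (subst infsum_Un_disjoint[OF _ _ disj]) (auto simp: infsum_reindex inj comp simp del: of_nat_Suc)
qed

definition sob_term :: "real \<Rightarrow> (real \<Rightarrow> real) \<Rightarrow> nat \<Rightarrow> real" where
  "sob_term s f n = freq n powr (2 * s) * (cmod (pos_coeff f n))\<^sup>2"

lemma sob_term_nonneg: "0 \<le> sob_term s f n"
  by (simp add: sob_term_def)

lemma sob_term_eq:
  "\<bar>real_of_int (int (Suc n))\<bar> powr (2 * s) * (cmod (pos_coeff f n))\<^sup>2 = sob_term s f n"
  by (simp add: sob_term_def freq_def)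

lemma sobolev_sums:
  fixes f :: "real \<Rightarrow> real" and s :: real
  defines "h \<equiv> \<lambda>k::int. \<bar>real_of_int k\<bar> powr (2 * s) * (cmod (fourier_coeff f k))\<^sup>2"
  shows "h summable_on (- {0}) \<longleftrightarrow> summable (sob_term s f)"
    and "summable (sob_term s f) \<Longrightarrow> infsum h (- {0}) = 2 * suminf (sob_term s f)"
proof -
  have nn: "0 \<le> h k" and ev: "h (- k) = h k" for k
    unfolding h_def by (simp_all add: fourier_coeff_uminus)
  have eq: "(\<lambda>n. h (int (Suc n))) = sob_term s f"
    unfolding h_def by (rule ext) (rule sob_term_eq)
  show "h summable_on (- {0}) \<longleftrightarrow> summable (sob_term s f)"
    using summable_on_nonzero_ints_even(1)[of h, OF nn ev] unfolding eq .
  show "infsum h (- {0}) = 2 * suminf (sob_term s f)" if "summable (sob_term s f)"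
    using summable_on_nonzero_ints_even(2)[of h, OF nn ev] that unfolding eq by simp
qed

lemma sobolev_iff: "f \<in> sobolev s \<longleftrightarrow> f \<in> L2_circle \<and> summable (sob_term s f)"
  unfolding sobolev_def mem_Collect_eq sobolev_sums(1) ..

lemma hom_norm_eq: "summable (sob_term s f) \<Longrightarrow> hom_norm s f = sqrt (2 * suminf (sob_term s f))"
  unfolding hom_norm_def by (simp only: sobolev_sums(2))

lemma sob_term_mono: "s \<le> s' \<Longrightarrow> sob_term s f n \<le> sob_term s' f n"
  unfolding sob_term_def by (intro mult_right_mono powr_mono freq_ge_1) auto

lemma sob_term_summable_mono:
  "s \<le> s' \<Longrightarrow> summable (sob_term s' f) \<Longrightarrow> summable (sob_term s f)"
  by (rule summable_comparison_test'[of "sob_term s' f" 0]) (auto simp: sob_term_nonneg sob_term_mono)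

lemma sob_term_powers:
  "sob_term 1 f n = (freq n)\<^sup>2 * (cmod (pos_coeff f n))\<^sup>2"
  "sob_term (3 / 2) f n = freq n ^ 3 * (cmod (pos_coeff f n))\<^sup>2"
  "sob_term (1 / 2) f n = freq n * (cmod (pos_coeff f n))\<^sup>2"
  using freq_pos[of n] powr_realpow[of "freq n" 2] powr_realpow[of "freq n" 3]
  by (auto simp: sob_term_def)

lemma integral_zero_iff_coeff: "(LBINT x:{0..2 * pi}. f x) = 0 \<longleftrightarrow> fourier_coeff f 0 = 0"
  by (simp add: set_integral_circ fourier_coeff_0)

lemma sobolev0_iff: "f \<in> sobolev0 s \<longleftrightarrow> f \<in> L2_circle \<and> summable (sob_term s f) \<and> fourier_coeff f 0 = 0"
  by (auto simp: sobolev0_def sobolev_iff integral_zero_iff_coeff)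

section \<open>Test functions and weak derivatives\<close>

lemma test_function_props:
  assumes "\<phi> \<in> test_functions"
  shows "\<phi> (x + 2 * pi) = \<phi> x" "(\<phi> has_real_derivative deriv \<phi> x) (at x)"
    "continuous_on S \<phi>" "\<phi> \<in> L2_circle" "deriv \<phi> \<in> test_functions"
proof -
  show per: "\<phi> (x + 2 * pi) = \<phi> x" for x using assms by (simp add: test_functions_def)
  have "(deriv ^^ 0) \<phi> differentiable_on UNIV" using assms unfolding test_functions_def by blast
  then have diff: "\<phi> differentiable at x" for x by (simp add: differentiable_on_def)
  then show d: "(\<phi> has_real_derivative deriv \<phi> x) (at x)" for x by (simp add: DERIV_deriv_iff_real_differentiable)
  show c: "continuous_on S \<phi>" for S
    using diff by (meson continuous_at_imp_continuous_on differentiable_imp_continuous_within)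
  show "\<phi> \<in> L2_circle" by (rule L2_circle_continuous[OF per c])
  have "deriv \<phi> (x + 2 * pi) = deriv \<phi> x" for x
  proof -
    have "((\<lambda>x. \<phi> (x + 2 * pi)) has_real_derivative deriv \<phi> (x + 2 * pi)) (at x)"
      using d[of "x + 2 * pi"] by (simp add: DERIV_shift)
    then have "(\<phi> has_real_derivative deriv \<phi> (x + 2 * pi)) (at x)" by (simp only: per)
    then show ?thesis by (rule DERIV_imp_deriv[symmetric])
  qed
  moreover have "(deriv ^^ n) (deriv \<phi>) differentiable_on UNIV" for n
  proof -
    have "(deriv ^^ Suc n) \<phi> differentiable_on UNIV" using assms unfolding test_functions_def by blast
    then show ?thesis by (simp only: funpow_Suc_right o_apply)
  qed
  ultimately show "deriv \<phi> \<in> test_functions" by (simp add: test_functions_def)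
qed

lemma fourier_coeff_deriv:
  assumes \<phi>: "\<phi> \<in> test_functions"
  shows "fourier_coeff (deriv \<phi>) k = \<i> * of_int k * fourier_coeff \<phi> k"
proof -
  define e where "e x = cis (of_int (- k) * x)" for x
  have \<phi>': "deriv \<phi> \<in> test_functions" by (rule test_function_props(5)[OF \<phi>])
  have ec: "continuous_on S e" for S unfolding e_def by (intro continuous_intros)
  have i1: "integrable circ (\<lambda>x. complex_of_real (deriv \<phi> x) * e x)" and i2: "integrable circ (\<lambda>x. complex_of_real (\<phi> x) * e x)"
    by (intro integrable_circ_continuous continuous_intros ec test_function_props(3) \<phi> \<phi>')+
  have "(LBINT x:{0..2 * pi}. complex_of_real (deriv \<phi> x) * e x + complex_of_real (\<phi> x) * (\<i> * of_int (- k) * e x))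
      = complex_of_real (\<phi> (2 * pi)) * e (2 * pi) - complex_of_real (\<phi> 0) * e 0"
    unfolding set_lebesgue_integral_def
  proof (rule integral_FTC_atLeastAtMost)
    show "((\<lambda>x. complex_of_real (\<phi> x) * e x) has_vector_derivative
        complex_of_real (deriv \<phi> x) * e x + complex_of_real (\<phi> x) * (\<i> * of_int (- k) * e x)) (at x within {0..2 * pi})" for x
    proof -
      have "((\<lambda>x. complex_of_real (\<phi> x)) has_vector_derivative complex_of_real (deriv \<phi> x)) (at x within {0..2 * pi})"
        by (rule bounded_linear.has_vector_derivative[OF bounded_linear_of_real
            has_vector_derivative_at_within[OF test_function_props(2)[OF \<phi>, unfolded has_real_derivative_iff_has_vector_derivative]]])
      moreover have "(e has_vector_derivative \<i> * of_int (- k) * e x) (at x within {0..2 * pi})"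
        unfolding e_def[abs_def] using has_vector_derivative_cis_mult[of "of_int (- k)" x] by simp
      ultimately show ?thesis
        by (rule has_vector_derivative_eq_rhs[OF has_vector_derivative_mult]) simp
    qed
  qed (auto intro!: continuous_intros ec test_function_props(3) \<phi> \<phi>')
  also have "\<dots> = 0"
    using test_function_props(1)[OF \<phi>, of 0] cis_multiple_2pi[of "of_int (- k)"] by (simp add: e_def mult_ac)
  finally have "integral\<^sup>L circ (\<lambda>x. complex_of_real (deriv \<phi> x) * e x + \<i> * of_int (- k) * (complex_of_real (\<phi> x) * e x)) = 0"
    unfolding set_integral_circ by (simp add: mult_ac)
  then have "integral\<^sup>L circ (\<lambda>x. complex_of_real (deriv \<phi> x) * e x) + \<i> * of_int (- k) * integral\<^sup>L circ (\<lambda>x. complex_of_real (\<phi> x) * e x) = 0"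
    using i1 i2 by (subst (asm) Bochner_Integration.integral_add) auto
  then have "integral\<^sup>L circ (\<lambda>x. complex_of_real (deriv \<phi> x) * e x) = \<i> * of_int k * integral\<^sup>L circ (\<lambda>x. complex_of_real (\<phi> x) * e x)"
    by (simp add: algebra_simps eq_neg_iff_add_eq_0)
  then show ?thesis unfolding fourier_coeff_circ e_def by simp
qed

lemma pos_coeff_deriv: "\<phi> \<in> test_functions \<Longrightarrow> pos_coeff (deriv \<phi>) n = \<i> * freq n * pos_coeff \<phi> n"
  by (simp add: fourier_coeff_deriv freq_def)

text \<open>Each derivative of a test function is again a test function, whose coefficients have
  gained a factor of the frequency.\<close>

lemma test_coeff_decay:
  assumes "\<phi> \<in> test_functions"
  shows "\<exists>B. \<forall>n. freq n ^ m * cmod (pos_coeff \<phi> n) \<le> B"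
  using assms
proof (induction m arbitrary: \<phi>)
  case 0
  then show ?case using cmod_fourier_coeff_le[OF test_function_props(4)] by auto
next
  case (Suc m)
  obtain B where B: "\<And>n. freq n ^ m * cmod (pos_coeff (deriv \<phi>) n) \<le> B"
    using Suc.IH[OF test_function_props(5)[OF Suc.prems]] by blast
  have "freq n ^ Suc m * cmod (pos_coeff \<phi> n) \<le> B" for n
    using B[of n] freq_pos[of n] unfolding pos_coeff_deriv[OF Suc.prems] by (simp add: norm_mult mult_ac)
  then show ?case by blast
qed

text \<open>The family with two free coefficients is closed under differentiation, so the induction
  over iterated derivatives goes through with arbitrary \<open>a\<close> and
  \<open>b\<close>.\<close>

lemma trig_test_function: "(\<lambda>x. a * cos (k * x) + b * sin (k * x)) \<in> test_functions" if k: "k = real_of_int j"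
proof -
  have per: "a * cos (k * (x + 2 * pi)) + b * sin (k * (x + 2 * pi)) = a * cos (k * x) + b * sin (k * x)" for x
  proof -
    have "k * (x + 2 * pi) = k * x + of_int j * (2 * pi)" by (simp add: k algebra_simps)
    moreover have "cos (y + of_int j * (2 * pi)) = cos y" "sin (y + of_int j * (2 * pi)) = sin y" for y
      using cos_int_2pin[of j] sin_int_2pin[of j] by (simp_all add: cos_add sin_add mult_ac)
    ultimately show ?thesis by simp
  qed
  have d: "((\<lambda>x. a * cos (k * x) + b * sin (k * x)) has_real_derivative (b * k) * cos (k * x) + (- a * k) * sin (k * x)) (at x)" for a b x
    by (auto intro!: derivative_eq_intros simp: algebra_simps)
  have deriv: "deriv (\<lambda>x. a * cos (k * x) + b * sin (k * x)) = (\<lambda>x. (b * k) * cos (k * x) + (- a * k) * sin (k * x))" for a b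
    by (rule ext) (rule DERIV_imp_deriv[OF d])
  have "(deriv ^^ n) (\<lambda>x. a * cos (k * x) + b * sin (k * x)) differentiable_on UNIV" for n a b
  proof (induction n arbitrary: a b)
    case 0
    then show ?case
      using d[of a b] unfolding differentiable_on_def by (auto simp: real_differentiable_def)
  next
    case (Suc n)
    then show ?case by (simp only: funpow_Suc_right o_apply deriv)
  qed
  then show ?thesis using per by (simp add: test_functions_def)
qed

lemma cos_sin_test_functions:
  "(\<lambda>x. cos (real_of_int k * x)) \<in> test_functions" "(\<lambda>x. sin (real_of_int k * x)) \<in> test_functions"
  using trig_test_function[OF refl, of 1 k 0] trig_test_function[OF refl, of 0 k 1] by simp_all

text \<open>Test functions are real, so a complex coefficient is recovered from pairings with a
  cosine and a sine. Through this formula identities of distributions become identities of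
  coefficients.\<close>

lemma fourier_coeff_pairing:
  assumes f: "f \<in> L2_circle"
  shows "fourier_coeff f k = (complex_of_real (circle_pairing f (\<lambda>x. cos (real_of_int k * x)))
    - \<i> * complex_of_real (circle_pairing f (\<lambda>x. sin (real_of_int k * x)))) / sqrt (2 * pi)"
proof -
  have i: "integrable circ (\<lambda>x. f x * cos (real_of_int k * x))" "integrable circ (\<lambda>x. f x * sin (real_of_int k * x))"
    by (intro integrable_circ_mult f test_function_props(4) cos_sin_test_functions)+
  have "complex_of_real (f x) * cis (of_int (- k) * x) = complex_of_real (f x * cos (real_of_int k * x)) - \<i> * complex_of_real (f x * sin (real_of_int k * x))" for x
    by (simp add: complex_eq_iff)
  then have "integral\<^sup>L circ (\<lambda>x. complex_of_real (f x) * cis (of_int (- k) * x))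
     = integral\<^sup>L circ (\<lambda>x. complex_of_real (f x * cos (real_of_int k * x)) - \<i> * complex_of_real (f x * sin (real_of_int k * x)))" by simp
  also have "\<dots> = integral\<^sup>L circ (\<lambda>x. complex_of_real (f x * cos (real_of_int k * x))) - integral\<^sup>L circ (\<lambda>x. \<i> * complex_of_real (f x * sin (real_of_int k * x)))"
    by (intro Bochner_Integration.integral_diff integrable_mult_right integrable_of_real i)
  finally show ?thesis unfolding fourier_coeff_circ circle_pairing_circ by (simp only: integral_mult_right_zero integral_complex_of_real)
qed

text \<open>\<open>weak_deriv\<close> is an arbitrary choice, so a weak derivative is first produced
  from the coefficients \<i> k f_k. Testing with cosines and sines shows that the chosen one has the
  same coefficients, and hence the same L^2 norm.\<close>

lemma dirichlet_energy_eq: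
  assumes f: "f \<in> L2_circle" and s: "summable (\<lambda>n. (freq n)\<^sup>2 * (cmod (pos_coeff f n))\<^sup>2)"
  shows "dirichlet_energy f = 2 * (\<Sum>n. (freq n)\<^sup>2 * (cmod (pos_coeff f n))\<^sup>2)"
proof -
  have sq: "(cmod (\<i> * freq n * pos_coeff f n))\<^sup>2 = (freq n)\<^sup>2 * (cmod (pos_coeff f n))\<^sup>2" for n
    by (simp add: norm_mult power_mult_distrib del: of_nat_Suc)
  have "summable (\<lambda>n. (cmod (\<i> * freq n * pos_coeff f n))\<^sup>2)" using s by (simp only: sq)
  from riesz_fischer[OF this, of 0, unfolded sq]
  obtain g0 where g0: "g0 \<in> L2_circle" "fourier_coeff g0 0 = complex_of_real 0"
    "\<And>n. pos_coeff g0 n = \<i> * freq n * pos_coeff f n"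
    and g0sq: "integral\<^sup>L circ (\<lambda>x. (g0 x)\<^sup>2) = 0\<^sup>2 + 2 * (\<Sum>n. (freq n)\<^sup>2 * (cmod (pos_coeff f n))\<^sup>2)"
    by blast
  have w0: "circle_pairing f (deriv \<phi>) = - circle_pairing g0 \<phi>" if \<phi>: "\<phi> \<in> test_functions" for \<phi>
  proof -
    have "(\<lambda>n. 2 * Re (pos_coeff f n * cnj (pos_coeff (deriv \<phi>) n))) sums (circle_pairing f (deriv \<phi>) - Re (fourier_coeff f 0) * Re (fourier_coeff (deriv \<phi>) 0))"
      by (intro circle_pairing_sums f test_function_props \<phi>)
    moreover have "(\<lambda>n. - (2 * Re (pos_coeff g0 n * cnj (pos_coeff \<phi> n)))) sums - (circle_pairing g0 \<phi> - Re (fourier_coeff g0 0) * Re (fourier_coeff \<phi> 0))"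
      by (intro sums_minus circle_pairing_sums g0 test_function_props \<phi>)
    moreover have "2 * Re (pos_coeff f n * cnj (pos_coeff (deriv \<phi>) n)) = - (2 * Re (pos_coeff g0 n * cnj (pos_coeff \<phi> n)))" for n
      unfolding g0(3) pos_coeff_deriv[OF \<phi>] by (simp add: algebra_simps del: of_nat_Suc)
    ultimately have "circle_pairing f (deriv \<phi>) - Re (fourier_coeff f 0) * Re (fourier_coeff (deriv \<phi>) 0)
        = - (circle_pairing g0 \<phi> - Re (fourier_coeff g0 0) * Re (fourier_coeff \<phi> 0))"
      by (simp only: sums_unique2)
    then show ?thesis by (simp add: g0(2) fourier_coeff_deriv[OF \<phi>])
  qed
  then have "g0 \<in> L2_circle \<and> has_weak_deriv f g0" using g0(1) by (simp add: has_weak_deriv_def)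
  then have g: "weak_deriv f \<in> L2_circle \<and> has_weak_deriv f (weak_deriv f)"
    unfolding weak_deriv_def by (rule someI[of "\<lambda>g. g \<in> L2_circle \<and> has_weak_deriv f g"])
  then have "circle_pairing (weak_deriv f) \<phi> = circle_pairing g0 \<phi>" if "\<phi> \<in> test_functions" for \<phi>
    using w0[OF that] that by (simp add: has_weak_deriv_def)
  then have "fourier_coeff (weak_deriv f) k = fourier_coeff g0 k" for k
    using g g0(1) by (simp add: fourier_coeff_pairing cos_sin_test_functions)
  then have "integral\<^sup>L circ (\<lambda>x. (weak_deriv f x)\<^sup>2) = integral\<^sup>L circ (\<lambda>x. (g0 x)\<^sup>2)"
    using g g0(1) by (simp add: parseval)
  then show ?thesis using g0sq by (simp add: dirichlet_energy_def set_integral_circ)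
qed

lemma circle_pairing_deriv2_sums:
  assumes f: "f \<in> L2_circle" and \<phi>: "\<phi> \<in> test_functions"
  shows "(\<lambda>n. - ((freq n)\<^sup>2 * (2 * Re (pos_coeff f n * cnj (pos_coeff \<phi> n))))) sums circle_pairing f (deriv (deriv \<phi>))"
proof -
  have \<phi>': "deriv \<phi> \<in> test_functions" "deriv (deriv \<phi>) \<in> test_functions"
    using test_function_props(5) \<phi> by auto
  have ii: "\<i> * complex_of_real x * (\<i> * complex_of_real x * z) = - (complex_of_real (x\<^sup>2) * z)" for x z
    by (simp add: complex_eq_iff power2_eq_square algebra_simps)
  have re: "Re (z * cnj (- (complex_of_real x * w))) = - (x * Re (z * cnj w))" for z w x
    by (simp add: algebra_simps)
  have "2 * Re (pos_coeff f n * cnj (pos_coeff (deriv (deriv \<phi>)) n)) = - ((freq n)\<^sup>2 * (2 * Re (pos_coeff f n * cnj (pos_coeff \<phi> n))))" for n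
    unfolding pos_coeff_deriv[OF \<phi>'(1)] pos_coeff_deriv[OF \<phi>] ii re by simp
  then show ?thesis
    using circle_pairing_sums[OF f test_function_props(4)[OF \<phi>'(2)]] by (simp add: fourier_coeff_deriv[OF \<phi>'(1)])
qed

section \<open>Convergence in Sobolev norms\<close>

lemma tendsto_suminf_dominated_zero:
  fixes a :: "nat \<Rightarrow> 'a \<Rightarrow> real"
  assumes lim: "\<And>n. ((\<lambda>r. a n r) \<longlongrightarrow> 0) F" and b: "\<forall>\<^sub>F r in F. \<forall>n. \<bar>a n r\<bar> \<le> M n" and M: "summable M"
  shows "((\<lambda>r. \<Sum>n. a n r) \<longlongrightarrow> 0) F"
proof (cases "F = bot")
  case False
  have "eventually (\<lambda>(k, r). norm (a k r) \<le> M k) (at_top \<times>\<^sub>F F)"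
    unfolding eventually_prod_filter
    using b by (intro exI[of _ "\<lambda>_. True"] exI[of _ "\<lambda>r. \<forall>n. \<bar>a n r\<bar> \<le> M n"]) auto
  from tannerys_theorem[OF lim this M False] show ?thesis by simp
qed simp

text \<open>Dominated convergence for series: convergence of each coefficient and one summable
  majorant give convergence in the norm. Continuity and differentiability in time are both obtained
  from this.\<close>

lemma full_norm_tendsto_zero:
  fixes h :: "real \<Rightarrow> real \<Rightarrow> real"
  assumes ev: "\<forall>\<^sub>F r in F. fourier_coeff (h r) 0 = 0 \<and> (\<forall>n. sob_term s (h r) n \<le> M n)"
    and M: "summable M" and lim: "\<And>n. ((\<lambda>r. pos_coeff (h r) n) \<longlongrightarrow> 0) F"
  shows "((\<lambda>r. full_norm s (h r)) \<longlongrightarrow> 0) F"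
proof -
  have "((\<lambda>r. suminf (sob_term s (h r))) \<longlongrightarrow> 0) F"
  proof (rule tendsto_suminf_dominated_zero[OF _ _ M])
    show "((\<lambda>r. sob_term s (h r) n) \<longlongrightarrow> 0) F" for n
    proof -
      have "((\<lambda>r. freq n powr (2 * s) * (cmod (pos_coeff (h r) n))\<^sup>2) \<longlongrightarrow> freq n powr (2 * s) * (cmod 0)\<^sup>2) F"
        by (intro tendsto_intros lim)
      then show ?thesis by (simp add: sob_term_def del: of_nat_Suc)
    qed
    show "\<forall>\<^sub>F r in F. \<forall>n. \<bar>sob_term s (h r) n\<bar> \<le> M n"
      using ev by eventually_elim (simp add: sob_term_nonneg)
  qed
  then have "((\<lambda>r. sqrt (2 * suminf (sob_term s (h r)))) \<longlongrightarrow> sqrt (2 * 0)) F"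
    by (intro tendsto_intros)
  moreover have "\<forall>\<^sub>F r in F. sqrt (2 * suminf (sob_term s (h r))) = full_norm s (h r)"
    using ev
  proof eventually_elim
    case (elim r)
    have sm: "summable (sob_term s (h r))"
      by (rule summable_comparison_test'[OF M, of 0]) (use elim in \<open>auto simp: sob_term_nonneg\<close>)
    then show ?case using elim suminf_nonneg[OF sm sob_term_nonneg] by (simp add: full_norm_def hom_norm_eq)
  qed
  ultimately show ?thesis by (auto intro: Lim_transform_eventually)
qed

lemma suminf_L2_triangle:
  fixes x y z :: "nat \<Rightarrow> real"
  assumes y: "summable (\<lambda>n. (y n)\<^sup>2)" and z: "summable (\<lambda>n. (z n)\<^sup>2)" and x: "summable (\<lambda>n. (x n)\<^sup>2)"
    and le: "\<And>n. \<bar>x n\<bar> \<le> \<bar>y n\<bar> + \<bar>z n\<bar>"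
  shows "sqrt (\<Sum>n. (x n)\<^sup>2) \<le> sqrt (\<Sum>n. (y n)\<^sup>2) + sqrt (\<Sum>n. (z n)\<^sup>2)"
proof -
  define A B where "A = (\<Sum>n. (y n)\<^sup>2)" and "B = (\<Sum>n. (z n)\<^sup>2)"
  have AB: "0 \<le> A" "0 \<le> B" unfolding A_def B_def by (auto intro!: suminf_nonneg y z)
  have "(x n)\<^sup>2 \<le> (y n)\<^sup>2 + (z n)\<^sup>2 + 2 * (\<bar>y n\<bar> * \<bar>z n\<bar>)" for n
    using power_mono[OF le[of n] abs_ge_zero, of 2] by (simp add: power2_sum mult.assoc)
  moreover have sm: "(\<lambda>n. (y n)\<^sup>2 + (z n)\<^sup>2 + 2 * (\<bar>y n\<bar> * \<bar>z n\<bar>)) sums (A + B + 2 * (\<Sum>n. \<bar>y n\<bar> * \<bar>z n\<bar>))"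
    unfolding A_def B_def by (intro sums_add sums_mult summable_sums y z summable_abs_mult_of_squares)
  ultimately have "(\<Sum>n. (x n)\<^sup>2) \<le> A + B + 2 * (\<Sum>n. \<bar>y n\<bar> * \<bar>z n\<bar>)"
    using suminf_le[OF _ x sums_summable[OF sm]] sums_unique[OF sm] by simp
  also have "\<dots> \<le> A + B + 2 * (sqrt A * sqrt B)"
    using suminf_Cauchy_Schwarz(2)[OF y z] by (simp add: A_def B_def)
  also have "\<dots> = (sqrt A + sqrt B)\<^sup>2" using AB by (simp add: power2_sum)
  finally have "sqrt (\<Sum>n. (x n)\<^sup>2) \<le> sqrt ((sqrt A + sqrt B)\<^sup>2)" by (rule real_sqrt_le_mono)
  then show ?thesis using AB by (simp add: A_def B_def)
qed

lemma hom_norm_triangle: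
  assumes f: "f \<in> L2_circle" "summable (sob_term s f)" and g: "g \<in> L2_circle" "summable (sob_term s g)"
    and d: "summable (sob_term s (\<lambda>x. f x - g x))"
  shows "\<bar>hom_norm s f - hom_norm s g\<bar> \<le> hom_norm s (\<lambda>x. f x - g x)"
proof -
  define w where "w h n = freq n powr s * cmod (pos_coeff h n)" for h n
  have sq: "(w h n)\<^sup>2 = sob_term s h n" for h n
    using powr_add[of "freq n" s s] by (simp add: w_def sob_term_def power_mult_distrib power2_eq_square[of "_ powr _"])
  have hn: "hom_norm s h = sqrt 2 * sqrt (\<Sum>n. (w h n)\<^sup>2)" if "summable (sob_term s h)" for h
    unfolding hom_norm_eq[OF that] real_sqrt_mult sq by simp
  have wd: "w (\<lambda>x. f x - g x) n = freq n powr s * cmod (pos_coeff f n - pos_coeff g n)" for n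
    unfolding w_def fourier_coeff_diff[OF f(1) g(1)] ..
  have 1: "\<bar>w f n\<bar> \<le> \<bar>w g n\<bar> + \<bar>w (\<lambda>x. f x - g x) n\<bar>" and 2: "\<bar>w g n\<bar> \<le> \<bar>w f n\<bar> + \<bar>w (\<lambda>x. f x - g x) n\<bar>" for n
  proof -
    have "cmod a \<le> cmod b + cmod (a - b)" "cmod b \<le> cmod a + cmod (a - b)" for a b :: complex
      using norm_triangle_sub[of a b] norm_triangle_sub[of b a] by (simp_all add: norm_minus_commute)
    from mult_left_mono[OF this(1)[of "pos_coeff f n" "pos_coeff g n"], of "freq n powr s"]
      mult_left_mono[OF this(2)[of "pos_coeff g n" "pos_coeff f n"], of "freq n powr s"]
    show "\<bar>w f n\<bar> \<le> \<bar>w g n\<bar> + \<bar>w (\<lambda>x. f x - g x) n\<bar>" "\<bar>w g n\<bar> \<le> \<bar>w f n\<bar> + \<bar>w (\<lambda>x. f x - g x) n\<bar>"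
      unfolding wd by (simp_all add: w_def distrib_left del: of_nat_Suc)
  qed
  have "sqrt (\<Sum>n. (w f n)\<^sup>2) \<le> sqrt (\<Sum>n. (w g n)\<^sup>2) + sqrt (\<Sum>n. (w (\<lambda>x. f x - g x) n)\<^sup>2)"
    by (rule suminf_L2_triangle) (use f g d 1 in \<open>simp_all add: sq\<close>)
  moreover have "sqrt (\<Sum>n. (w g n)\<^sup>2) \<le> sqrt (\<Sum>n. (w f n)\<^sup>2) + sqrt (\<Sum>n. (w (\<lambda>x. f x - g x) n)\<^sup>2)"
    by (rule suminf_L2_triangle) (use f g d 2 in \<open>simp_all add: sq\<close>)
  ultimately have "\<bar>sqrt (\<Sum>n. (w f n)\<^sup>2) - sqrt (\<Sum>n. (w g n)\<^sup>2)\<bar> \<le> sqrt (\<Sum>n. (w (\<lambda>x. f x - g x) n)\<^sup>2)"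
    by linarith
  then have "sqrt 2 * \<bar>sqrt (\<Sum>n. (w f n)\<^sup>2) - sqrt (\<Sum>n. (w g n)\<^sup>2)\<bar> \<le> sqrt 2 * sqrt (\<Sum>n. (w (\<lambda>x. f x - g x) n)\<^sup>2)"
    by (rule mult_left_mono) simp
  moreover have "sqrt 2 * \<bar>a - b\<bar> = \<bar>sqrt 2 * a - sqrt 2 * b\<bar>" for a b
    by (simp add: right_diff_distrib[symmetric] abs_mult)
  ultimately show ?thesis unfolding hn[OF f(2)] hn[OF g(2)] hn[OF d] by simp
qed

lemma sobolev_diff:
  assumes f: "f \<in> sobolev s" and g: "g \<in> sobolev s"
  shows "(\<lambda>x. f x - g x) \<in> sobolev s"
proof -
  have L: "f \<in> L2_circle" "g \<in> L2_circle" and S: "summable (sob_term s f)" "summable (sob_term s g)"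
    using f g by (auto simp: sobolev_iff)
  have "sob_term s (\<lambda>x. f x - g x) n \<le> 2 * sob_term s f n + 2 * sob_term s g n" for n
  proof -
    from mult_left_mono[OF cmod_diff_squared_le[of "pos_coeff f n" "pos_coeff g n"], of "freq n powr (2 * s)"]
    show ?thesis unfolding sob_term_def fourier_coeff_diff[OF L] by (simp add: algebra_simps del: of_nat_Suc)
  qed
  then have "summable (sob_term s (\<lambda>x. f x - g x))"
    by (intro summable_comparison_test'[OF summable_add[OF summable_mult[OF S(1), of 2] summable_mult[OF S(2), of 2]], of 0])
      (auto simp: sob_term_nonneg)
  then show ?thesis using L2_circle_diff[OF L] by (simp add: sobolev_iff)
qed

lemma sobolev_cmult: "f \<in> sobolev s \<Longrightarrow> (\<lambda>x. a * f x) \<in> sobolev s"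
proof -
  assume f: "f \<in> sobolev s"
  have "sob_term s (\<lambda>x. a * f x) = (\<lambda>n. a\<^sup>2 * sob_term s f n)"
    by (simp add: fun_eq_iff sob_term_def fourier_coeff_cmult norm_mult power_mult_distrib del: of_nat_Suc)
  then show ?thesis using f by (auto simp: sobolev_iff L2_circle_cmult summable_mult)
qed

lemma cmod_fourier_coeff_le_full_norm:
  assumes f: "f \<in> sobolev s" and s: "0 \<le> s"
  shows "cmod (fourier_coeff f (int j)) \<le> full_norm s f"
proof -
  have S: "summable (sob_term s f)" using f by (simp add: sobolev_iff)
  have nn: "0 \<le> suminf (sob_term s f)" by (rule suminf_nonneg[OF S sob_term_nonneg])
  have fn: "full_norm s f = sqrt ((cmod (fourier_coeff f 0))\<^sup>2 + 2 * suminf (sob_term s f))"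
    using nn by (simp add: full_norm_def hom_norm_eq[OF S])
  have "(cmod (fourier_coeff f (int j)))\<^sup>2 \<le> (cmod (fourier_coeff f 0))\<^sup>2 + 2 * suminf (sob_term s f)"
  proof (cases j)
    case (Suc n)
    have "1 * (cmod (pos_coeff f n))\<^sup>2 \<le> sob_term s f n"
      unfolding sob_term_def using freq_ge_1[of n] s by (intro mult_right_mono ge_one_powr_ge_zero) auto
    also have "\<dots> \<le> suminf (sob_term s f)"
      using sum_le_suminf[OF S, of "{n}"] by (simp add: sob_term_nonneg)
    finally show ?thesis unfolding Suc using nn zero_le_power2[of "cmod (fourier_coeff f 0)"] by linarith
  qed (use nn in simp)
  then show ?thesis unfolding fn by (rule real_le_rsqrt)
qed

lemma hom_norm_le_full_norm:
  assumes f: "f \<in> sobolev s" and s: "\<sigma> \<le> s"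
  shows "hom_norm \<sigma> f \<le> full_norm s f"
proof -
  have S: "summable (sob_term s f)" using f by (simp add: sobolev_iff)
  have S': "summable (sob_term \<sigma> f)" by (rule sob_term_summable_mono[OF s S])
  have "suminf (sob_term \<sigma> f) \<le> suminf (sob_term s f)" by (intro suminf_le sob_term_mono s S S')
  then have "hom_norm \<sigma> f \<le> hom_norm s f" unfolding hom_norm_eq[OF S] hom_norm_eq[OF S'] by simp
  also have "\<dots> \<le> full_norm s f" unfolding full_norm_def by (rule real_le_rsqrt) simp
  finally show ?thesis .
qed

text \<open>Gives bounds on a compact time interval for the norms and the wave speed of an arbitrary
  competing solution, about which nothing else is known.\<close>

lemma C0_sobolev_continuous_hom_norm:
  assumes w: "C0_sobolev T s w" and s: "\<sigma> \<le> s"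
  shows "continuous_on {0..T} (\<lambda>t. hom_norm \<sigma> (w t))"
  unfolding continuous_on_def
proof
  fix t assume t: "t \<in> {0..T}"
  have ws: "w r \<in> sobolev s" if "r \<in> {0..T}" for r using w that by (simp add: C0_sobolev_def)
  have "((\<lambda>r. full_norm s (\<lambda>x. w r x - w t x)) \<longlongrightarrow> 0) (at t within {0..T})"
    using w t by (simp add: C0_sobolev_def)
  moreover have "\<forall>\<^sub>F r in at t within {0..T}. norm (hom_norm \<sigma> (w r) - hom_norm \<sigma> (w t)) \<le> full_norm s (\<lambda>x. w r x - w t x)"
    unfolding eventually_at_filter
  proof (intro always_eventually allI impI)
    fix r assume r: "r \<in> {0..T}"
    have d: "(\<lambda>x. w r x - w t x) \<in> sobolev s" by (intro sobolev_diff ws r t)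
    have "\<bar>hom_norm \<sigma> (w r) - hom_norm \<sigma> (w t)\<bar> \<le> hom_norm \<sigma> (\<lambda>x. w r x - w t x)"
      using ws[OF r] ws[OF t] d by (intro hom_norm_triangle) (auto simp: sobolev_iff intro: sob_term_summable_mono[OF s])
    also have "\<dots> \<le> full_norm s (\<lambda>x. w r x - w t x)" by (rule hom_norm_le_full_norm[OF d s])
    finally show "norm (hom_norm \<sigma> (w r) - hom_norm \<sigma> (w t)) \<le> full_norm s (\<lambda>x. w r x - w t x)" by simp
  qed
  ultimately have "((\<lambda>r. hom_norm \<sigma> (w r) - hom_norm \<sigma> (w t)) \<longlongrightarrow> 0) (at t within {0..T})"
    by (rule Lim_null_comparison[rotated])
  then show "((\<lambda>r. hom_norm \<sigma> (w r)) \<longlongrightarrow> hom_norm \<sigma> (w t)) (at t within {0..T})" by (simp add: LIM_zero_iff)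
qed

text \<open>Each Fourier coefficient is a linear functional dominated by the full norm, so it can be
  applied to the difference quotient.\<close>

lemma has_time_deriv_coeff:
  assumes w: "has_time_deriv T s w w'" and s: "0 \<le> s" and t: "t \<in> {0..T}"
  shows "((\<lambda>r. fourier_coeff (w r) (int j)) has_vector_derivative fourier_coeff (w' t) (int j)) (at t within {0..T})"
proof -
  define f where "f r = fourier_coeff (w r) (int j)" for r
  have ws: "w r \<in> sobolev s" "w' r \<in> sobolev s" if "r \<in> {0..T}" for r using w that by (auto simp: has_time_deriv_def)
  have lim: "((\<lambda>r. full_norm s (\<lambda>x. (w r x - w t x) / (r - t) - w' t x)) \<longlongrightarrow> 0) (at t within {0..T})"
    using w t by (simp add: has_time_deriv_def)
  have "\<forall>\<^sub>F r in at t within {0..T}. norm (norm ((f r - f t) - (r - t) *\<^sub>R fourier_coeff (w' t) (int j)) / norm (r - t))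
      \<le> full_norm s (\<lambda>x. (w r x - w t x) / (r - t) - w' t x)"
    unfolding eventually_at_filter
  proof (intro always_eventually allI impI)
    fix r assume r: "r \<noteq> t" "r \<in> {0..T}"
    define h where "h x = inverse (r - t) * (w r x - w t x)" for x
    have h: "h \<in> sobolev s" unfolding h_def by (intro sobolev_cmult sobolev_diff ws r t)
    have L: "w r \<in> L2_circle" "w t \<in> L2_circle" "w' t \<in> L2_circle" "h \<in> L2_circle"
      using ws r t h by (auto simp: sobolev_iff)
    have e: "(\<lambda>x. (w r x - w t x) / (r - t) - w' t x) = (\<lambda>x. h x - w' t x)"
      by (simp add: h_def divide_inverse mult.commute)
    have "fourier_coeff (\<lambda>x. h x - w' t x) (int j) = inverse (r - t) * (f r - f t) - fourier_coeff (w' t) (int j)"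
      unfolding fourier_coeff_diff[OF L(4,3)] unfolding h_def fourier_coeff_cmult fourier_coeff_diff[OF L(1,2)] f_def ..
    also have "\<dots> = inverse (r - t) * ((f r - f t) - (r - t) *\<^sub>R fourier_coeff (w' t) (int j))"
    proof -
      have "complex_of_real (inverse x) * A - B = complex_of_real (inverse x) * (A - x *\<^sub>R B)" if "x \<noteq> 0" for x A B
        using that by (simp add: scaleR_conv_of_real right_diff_distrib)
      from this[of "r - t"] show ?thesis using r(1) unfolding right_minus_eq by blast
    qed
    finally have "norm ((f r - f t) - (r - t) *\<^sub>R fourier_coeff (w' t) (int j)) / norm (r - t) = cmod (fourier_coeff (\<lambda>x. h x - w' t x) (int j))"
      by (simp add: norm_mult divide_inverse mult.commute del: of_real_diff of_real_inverse)
    also have "\<dots> \<le> full_norm s (\<lambda>x. h x - w' t x)"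
      by (rule cmod_fourier_coeff_le_full_norm[OF sobolev_diff[OF h ws(2)[OF t]] s])
    finally show "norm (norm ((f r - f t) - (r - t) *\<^sub>R fourier_coeff (w' t) (int j)) / norm (r - t))
      \<le> full_norm s (\<lambda>x. (w r x - w t x) / (r - t) - w' t x)" unfolding e by simp
  qed
  then have "((\<lambda>r. norm ((f r - f t) - (r - t) *\<^sub>R fourier_coeff (w' t) (int j)) / norm (r - t)) \<longlongrightarrow> 0) (at t within {0..T})"
    by (rule Lim_null_comparison[OF _ lim])
  then have "(f has_vector_derivative fourier_coeff (w' t) (int j)) (at t within {0..T})"
    unfolding has_vector_derivative_def has_derivative_iff_norm by (auto intro: bounded_linear_scaleR_left)
  then show ?thesis by (simp add: f_def[abs_def])
qed

lemma kirchhoff_coeff_deriv: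
  assumes sol: "kirchhoff_solution c s u0 v0 T u v" and t: "t \<in> {0..T}"
  shows "((\<lambda>r. fourier_coeff (v r) k) has_vector_derivative
    (- ((1 / (1 + c * dirichlet_energy (u t)))\<^sup>2 * (of_int k)\<^sup>2)) *\<^sub>R fourier_coeff (u t) k) (at t within {0..T})"
proof -
  define C S where "C = (\<lambda>x. cos (real_of_int k * x))" and "S = (\<lambda>x. sin (real_of_int k * x))"
  define a where "a = (1 / (1 + c * dirichlet_energy (u t)))\<^sup>2"
  have tf: "C \<in> test_functions" "S \<in> test_functions" unfolding C_def S_def by (rule cos_sin_test_functions)+
  have L: "u r \<in> L2_circle" "v r \<in> L2_circle" if "r \<in> {0..T}" for r
    using sol that by (auto simp: kirchhoff_solution_def C0_sobolev_def sobolev_iff)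
  have d: "((\<lambda>r. circle_pairing (v r) \<phi>) has_real_derivative a * circle_pairing (u t) (deriv (deriv \<phi>))) (at t within {0..T})"
    if "\<phi> \<in> test_functions" for \<phi>
    using sol that t unfolding kirchhoff_solution_def a_def by blast
  have "deriv C = (\<lambda>x. - (k * S x))" "deriv S = (\<lambda>x. k * C x)"
    unfolding C_def S_def by (rule ext, rule DERIV_imp_deriv, auto intro!: derivative_eq_intros)+
  moreover have "deriv (\<lambda>x. - (k * S x)) = (\<lambda>x. - (k\<^sup>2 * C x))" "deriv (\<lambda>x. k * C x) = (\<lambda>x. - (k\<^sup>2 * S x))"
    unfolding C_def S_def by (rule ext, rule DERIV_imp_deriv, auto intro!: derivative_eq_intros simp: power2_eq_square)+
  ultimately have dd: "deriv (deriv C) = (\<lambda>x. - (k\<^sup>2 * C x))" "deriv (deriv S) = (\<lambda>x. - (k\<^sup>2 * S x))" by simp_all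
  have pm: "circle_pairing f (\<lambda>x. - (real_of_int (k\<^sup>2) * g x)) = - (k\<^sup>2 * circle_pairing f g)" for f g
    by (simp add: circle_pairing_circ mult.left_commute[of "f _"])
  have of_real: "((\<lambda>r. complex_of_real (X r)) has_vector_derivative complex_of_real X') (at t within {0..T})"
    if "(X has_real_derivative X') (at t within {0..T})" for X X'
    using bounded_linear.has_vector_derivative[OF bounded_linear_of_real that[unfolded has_real_derivative_iff_has_vector_derivative]] .
  have "((\<lambda>r. (complex_of_real (circle_pairing (v r) C) - \<i> * complex_of_real (circle_pairing (v r) S)) / sqrt (2 * pi)) has_vector_derivative
     (complex_of_real (a * circle_pairing (u t) (deriv (deriv C))) - \<i> * complex_of_real (a * circle_pairing (u t) (deriv (deriv S)))) / sqrt (2 * pi)) (at t within {0..T})"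
    by (intro has_vector_derivative_divide has_vector_derivative_diff has_vector_derivative_mult_right of_real d tf)
  also have "(complex_of_real (a * circle_pairing (u t) (deriv (deriv C))) - \<i> * complex_of_real (a * circle_pairing (u t) (deriv (deriv S)))) / sqrt (2 * pi)
     = (- (a * (of_int k)\<^sup>2)) *\<^sub>R fourier_coeff (u t) k"
    unfolding dd pm fourier_coeff_pairing[OF L(1)[OF t]] C_def[symmetric] S_def[symmetric]
    by (simp add: scaleR_conv_of_real algebra_simps diff_divide_distrib)
  finally have "((\<lambda>r. (complex_of_real (circle_pairing (v r) C) - \<i> * complex_of_real (circle_pairing (v r) S)) / sqrt (2 * pi)) has_vector_derivative
     (- (a * (of_int k)\<^sup>2)) *\<^sub>R fourier_coeff (u t) k) (at t within {0..T})" .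
  then show ?thesis
    unfolding a_def[symmetric]
    by (rule has_vector_derivative_transform[OF t, rotated]) (simp add: fourier_coeff_pairing[OF L(2)] C_def S_def)
qed


section \<open>The Kirchhoff flow\<close>

definition synth :: "(nat \<Rightarrow> complex) \<Rightarrow> real \<Rightarrow> real" where
  "synth c = (SOME f. f \<in> L2_circle \<and> fourier_coeff f 0 = 0 \<and> (\<forall>n. pos_coeff f n = c n))"

lemma synth:
  assumes "summable (\<lambda>n. (cmod (c n))\<^sup>2)"
  shows "synth c \<in> L2_circle" "fourier_coeff (synth c) 0 = 0" "pos_coeff (synth c) n = c n"
proof -
  obtain f where "f \<in> L2_circle" "fourier_coeff f 0 = complex_of_real 0" "\<And>n. pos_coeff f n = c n"
    using riesz_fischer[OF assms, of 0] by blast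
  then have "\<exists>f. f \<in> L2_circle \<and> fourier_coeff f 0 = 0 \<and> (\<forall>n. pos_coeff f n = c n)" by auto
  from someI_ex[OF this] show "synth c \<in> L2_circle" "fourier_coeff (synth c) 0 = 0" "pos_coeff (synth c) n = c n"
    unfolding synth_def by blast+
qed

text \<open>The weights of H^s and H^(s-1) arise from those of H^(3/2) and H^(1/2) by the same
  factor, a power with exponent 2s - 3. An estimate for each frequency at the threshold thus passes
  to every larger s.\<close>

lemma freq_powr_split:
  "freq n powr (2 * s) = freq n powr (2 * s - 3) * freq n ^ 3"
  "freq n powr (2 * (s - 1)) = freq n powr (2 * s - 3) * freq n"
  using powr_add[of "freq n" "2 * s - 3" 3] powr_add[of "freq n" "2 * s - 3" 1] freq_pos[of n]
  by (simp_all add: algebra_simps)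

locale kirchhoff_flow =
  fixes c s T M :: real and u0 v0 :: "real \<Rightarrow> real" and u v :: "nat \<Rightarrow> real \<Rightarrow> complex" and a :: "real \<Rightarrow> real"
  assumes s: "3 / 2 \<le> s" and u0: "u0 \<in> sobolev0 s" and v0: "v0 \<in> sobolev0 (s - 1)" and T: "0 \<le> T"
    and u_init: "\<And>n. u n 0 = pos_coeff u0 n" and v_init: "\<And>n. v n 0 = pos_coeff v0 n"
    and u_deriv: "\<And>n t. 0 \<le> t \<Longrightarrow> (u n has_vector_derivative v n t) (at t within {0..})"
    and v_deriv: "\<And>n t. 0 \<le> t \<Longrightarrow> (v n has_vector_derivative (- ((a t)\<^sup>2 * (freq n)\<^sup>2)) *\<^sub>R u n t) (at t within {0..})"
    and a_bounds: "\<And>t. 0 \<le> t \<Longrightarrow> 1 / 2 \<le> a t \<and> a t \<le> 2"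
    and a_eq: "\<And>t. 0 \<le> t \<Longrightarrow> a t * (1 + 2 * c * (\<Sum>n. (freq n)\<^sup>2 * (cmod (u n t))\<^sup>2)) = 1"
    and a_deriv: "\<And>t. 0 \<le> t \<Longrightarrow> \<exists>a'. (a has_real_derivative a') (at t within {0..}) \<and> \<bar>a'\<bar> \<le> M"
    and growth: "\<And>n t. 0 \<le> t \<Longrightarrow> freq n ^ 3 * (cmod (u n t))\<^sup>2 + freq n * (cmod (v n t))\<^sup>2
        \<le> 8 * (freq n ^ 3 * (cmod (pos_coeff u0 n))\<^sup>2 + freq n * (cmod (pos_coeff v0 n))\<^sup>2)"
begin

definition U where "U t = synth (\<lambda>n. u n t)"
definition V where "V t = synth (\<lambda>n. v n t)"
definition B where "B n = freq n ^ 3 * (cmod (pos_coeff u0 n))\<^sup>2 + freq n * (cmod (pos_coeff v0 n))\<^sup>2"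
text \<open>The size of the data at one frequency, measured in H^s and H^(s-1), as \<open>B\<close>
  measures it at the threshold. Up to a constant, \<open>W\<close> dominates the solution at all
  times and serves as the summable majorant.\<close>

definition W where "W n = freq n powr (2 * s - 3) * B n"

lemma B_nonneg: "0 \<le> B n"
  using freq_pos[of n] by (simp add: B_def)

lemma W_eq: "W n = sob_term s u0 n + sob_term (s - 1) v0 n"
  unfolding W_def B_def sob_term_def freq_powr_split[of n s] by (simp add: algebra_simps del: of_nat_Suc)

lemma B_le_W: "B n \<le> W n"
proof -
  have "1 \<le> freq n powr (2 * s - 3)" using s freq_ge_1 by (intro ge_one_powr_ge_zero) auto
  from mult_right_mono[OF this B_nonneg] show ?thesis by (simp add: W_def)
qed

lemma W_summable: "summable W" and B_summable: "summable B"
proof -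
  show W: "summable W"
    unfolding W_eq[abs_def] using u0 v0 by (intro summable_add) (auto simp: sobolev0_iff)
  show "summable B"
    by (rule summable_comparison_test'[OF W, of 0]) (use B_le_W B_nonneg in auto)
qed

lemma mode_bounds:
  assumes t: "0 \<le> t"
  shows "freq n ^ 3 * (cmod (u n t))\<^sup>2 \<le> 8 * B n" "freq n * (cmod (v n t))\<^sup>2 \<le> 8 * B n"
    "(cmod (u n t))\<^sup>2 \<le> 8 * B n" "(cmod (v n t))\<^sup>2 \<le> 8 * B n"
proof -
  have nn: "0 \<le> freq n ^ 3 * (cmod (u n t))\<^sup>2" "0 \<le> freq n * (cmod (v n t))\<^sup>2"
    using freq_pos[of n] by auto
  show 1: "freq n ^ 3 * (cmod (u n t))\<^sup>2 \<le> 8 * B n" and 2: "freq n * (cmod (v n t))\<^sup>2 \<le> 8 * B n"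
    using growth[OF t, of n] nn unfolding B_def by linarith+
  have "1 * (cmod (u n t))\<^sup>2 \<le> freq n ^ 3 * (cmod (u n t))\<^sup>2" "1 * (cmod (v n t))\<^sup>2 \<le> freq n * (cmod (v n t))\<^sup>2"
    by (rule mult_right_mono[OF one_le_power[OF freq_ge_1]], simp, rule mult_right_mono[OF freq_ge_1], simp)
  then show "(cmod (u n t))\<^sup>2 \<le> 8 * B n" "(cmod (v n t))\<^sup>2 \<le> 8 * B n" using 1 2 by linarith+
qed

lemma sob_bounds:
  assumes t: "0 \<le> t"
  shows "freq n powr (2 * s) * (cmod (u n t))\<^sup>2 + freq n powr (2 * (s - 1)) * (cmod (v n t))\<^sup>2 \<le> 8 * W n"
    "freq n powr (2 * s) * (cmod (u n t))\<^sup>2 \<le> 8 * W n" "freq n powr (2 * (s - 1)) * (cmod (v n t))\<^sup>2 \<le> 8 * W n"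
proof -
  have "freq n powr (2 * s - 3) * (freq n ^ 3 * (cmod (u n t))\<^sup>2 + freq n * (cmod (v n t))\<^sup>2) \<le> freq n powr (2 * s - 3) * (8 * B n)"
    using growth[OF t, of n] unfolding B_def[symmetric] by (intro mult_left_mono) auto
  then show 1: "freq n powr (2 * s) * (cmod (u n t))\<^sup>2 + freq n powr (2 * (s - 1)) * (cmod (v n t))\<^sup>2 \<le> 8 * W n"
    unfolding freq_powr_split[of n s] W_def by (simp add: algebra_simps)
  have "0 \<le> freq n powr (2 * s) * (cmod (u n t))\<^sup>2" "0 \<le> freq n powr (2 * (s - 1)) * (cmod (v n t))\<^sup>2" by auto
  then show "freq n powr (2 * s) * (cmod (u n t))\<^sup>2 \<le> 8 * W n" "freq n powr (2 * (s - 1)) * (cmod (v n t))\<^sup>2 \<le> 8 * W n"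
    using 1 by linarith+
qed

lemma UV:
  assumes t: "0 \<le> t"
  shows "U t \<in> L2_circle" "fourier_coeff (U t) 0 = 0" "pos_coeff (U t) n = u n t"
    "V t \<in> L2_circle" "fourier_coeff (V t) 0 = 0" "pos_coeff (V t) n = v n t"
proof -
  have "summable (\<lambda>n. (cmod (u n t))\<^sup>2)" "summable (\<lambda>n. (cmod (v n t))\<^sup>2)"
    by (rule summable_comparison_test'[OF summable_mult[OF B_summable, of 8], of 0]; use mode_bounds[OF t] in simp)+
  from synth[OF this(1)] synth[OF this(2)]
  show "U t \<in> L2_circle" "fourier_coeff (U t) 0 = 0" "pos_coeff (U t) n = u n t"
    "V t \<in> L2_circle" "fourier_coeff (V t) 0 = 0" "pos_coeff (V t) n = v n t"
    unfolding U_def V_def by blast+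
qed

lemma sob_term_UV:
  assumes t: "0 \<le> t"
  shows "sob_term s (U t) n \<le> 8 * W n" "sob_term (s - 1) (V t) n \<le> 8 * W n"
    "sob_term s (U t) n + sob_term (s - 1) (V t) n \<le> 8 * W n"
  unfolding sob_term_def UV(3,6)[OF t] using sob_bounds[OF t, of n] by auto

lemma UV_summable:
  assumes t: "0 \<le> t"
  shows "summable (sob_term s (U t))" "summable (sob_term (s - 1) (V t))"
  by (rule summable_comparison_test'[OF summable_mult[OF W_summable, of 8], of 0];
      use sob_term_UV[OF t] in \<open>simp add: sob_term_nonneg\<close>)+

lemma UV_sobolev0:
  assumes t: "0 \<le> t" shows "U t \<in> sobolev0 s" "V t \<in> sobolev0 (s - 1)"
  using UV[OF t] UV_summable[OF t] by (auto simp: sobolev0_iff)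

text \<open>The factor 8 for the squares is enlarged to 9, a square. Each of the two norms is then
  at most 3 times the size of the data, and their sum at most 6 times.\<close>

lemma norm_bound:
  assumes t: "0 \<le> t"
  shows "hom_norm s (U t) + hom_norm (s - 1) (V t) \<le> 6 * (hom_norm s u0 + hom_norm (s - 1) v0)"
proof -
  define x y x0 y0 where "x = hom_norm s (U t)" and "y = hom_norm (s - 1) (V t)" and "x0 = hom_norm s u0" and "y0 = hom_norm (s - 1) v0"
  have s0: "summable (sob_term s u0)" "summable (sob_term (s - 1) v0)" using u0 v0 by (auto simp: sobolev0_iff)
  have sq: "x\<^sup>2 = 2 * suminf (sob_term s (U t))" "y\<^sup>2 = 2 * suminf (sob_term (s - 1) (V t))"
    "x0\<^sup>2 = 2 * suminf (sob_term s u0)" "y0\<^sup>2 = 2 * suminf (sob_term (s - 1) v0)"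
    unfolding x_def y_def x0_def y0_def using UV_summable[OF t] s0
    by (simp_all add: hom_norm_eq suminf_nonneg sob_term_nonneg)
  have nn: "0 \<le> x" "0 \<le> y" "0 \<le> x0" "0 \<le> y0"
    unfolding x_def y_def x0_def y0_def using UV_summable[OF t] s0
    by (simp_all add: hom_norm_eq suminf_nonneg sob_term_nonneg)
  have "suminf (sob_term s (U t)) + suminf (sob_term (s - 1) (V t)) = (\<Sum>n. sob_term s (U t) n + sob_term (s - 1) (V t) n)"
    by (rule suminf_add) (rule UV_summable[OF t])+
  also have "\<dots> \<le> (\<Sum>n. 8 * W n)"
    by (intro suminf_le sob_term_UV(3)[OF t] summable_add UV_summable[OF t] summable_mult W_summable)
  also have "\<dots> = 8 * suminf W" by (rule suminf_mult[OF W_summable])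
  also have "suminf W = suminf (sob_term s u0) + suminf (sob_term (s - 1) v0)"
    unfolding W_eq[abs_def] by (rule suminf_add[OF s0, symmetric])
  finally have "x\<^sup>2 + y\<^sup>2 \<le> 8 * (x0\<^sup>2 + y0\<^sup>2)" using sq by simp
  moreover have "8 * (x0\<^sup>2 + y0\<^sup>2) \<le> 9 * (x0 + y0)\<^sup>2"
  proof -
    have "0 \<le> x0\<^sup>2" "0 \<le> y0\<^sup>2" "0 \<le> x0 * y0" using nn by auto
    then show ?thesis unfolding power2_sum distrib_left by linarith
  qed
  moreover have "(3 * (x0 + y0))\<^sup>2 = 9 * (x0 + y0)\<^sup>2" unfolding power_mult_distrib by simp
  ultimately have le: "x\<^sup>2 + y\<^sup>2 \<le> (3 * (x0 + y0))\<^sup>2" by (metis order_trans)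
  have "x \<le> 3 * (x0 + y0) \<and> y \<le> 3 * (x0 + y0)"
    by (rule sum_squares_le_imp_le[OF le]) (use nn in auto)
  then show ?thesis unfolding x_def y_def x0_def y0_def by linarith
qed

lemma dirichlet_U:
  assumes t: "0 \<le> t"
  shows "dirichlet_energy (U t) = 2 * (\<Sum>n. (freq n)\<^sup>2 * (cmod (u n t))\<^sup>2)"
    "1 + c * dirichlet_energy (U t) \<noteq> 0" "1 / (1 + c * dirichlet_energy (U t)) = a t"
proof -
  have "summable (sob_term 1 (U t))"
    by (rule sob_term_summable_mono[OF _ UV_summable(1)[OF t]]) (use s in simp)
  then have "summable (\<lambda>n. (freq n)\<^sup>2 * (cmod (pos_coeff (U t) n))\<^sup>2)" unfolding sob_term_powers[abs_def] .
  from dirichlet_energy_eq[OF UV(1)[OF t] this]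
  show d: "dirichlet_energy (U t) = 2 * (\<Sum>n. (freq n)\<^sup>2 * (cmod (u n t))\<^sup>2)" unfolding UV(3)[OF t] .
  have e: "a t * (1 + c * dirichlet_energy (U t)) = 1" using a_eq[OF t] by (simp add: d mult_ac)
  then show "1 + c * dirichlet_energy (U t) \<noteq> 0" by auto
  with e show "1 / (1 + c * dirichlet_energy (U t)) = a t" by (simp add: field_simps)
qed

section \<open>Regularity in time and the weak equation\<close>

lemma sob_weight_diff:
  assumes "freq n powr r * (cmod x)\<^sup>2 \<le> 8 * W n" "freq n powr r * (cmod y)\<^sup>2 \<le> 8 * W n"
  shows "freq n powr r * (cmod (x - y))\<^sup>2 \<le> 32 * W n"
proof -
  have "freq n powr r * (cmod (x - y))\<^sup>2 \<le> freq n powr r * (2 * (cmod x)\<^sup>2 + 2 * (cmod y)\<^sup>2)"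
    by (intro mult_left_mono cmod_diff_squared_le) auto
  then show ?thesis using assms by (simp add: distrib_left)
qed

lemma u_tendsto: "t \<in> {0..T} \<Longrightarrow> (u n \<longlongrightarrow> u n t) (at t within {0..T})"
  and v_tendsto: "t \<in> {0..T} \<Longrightarrow> (v n \<longlongrightarrow> v n t) (at t within {0..T})"
proof -
  assume t: "t \<in> {0..T}"
  have "continuous (at t within {0..T}) (u n)" "continuous (at t within {0..T}) (v n)"
    using t by (auto intro!: has_vector_derivative_continuous has_vector_derivative_within_subset[OF u_deriv] has_vector_derivative_within_subset[OF v_deriv])
  then show "(u n \<longlongrightarrow> u n t) (at t within {0..T})" "(v n \<longlongrightarrow> v n t) (at t within {0..T})"
    by (simp_all add: continuous_within)
qed

text \<open>Continuity of the single modes is upgraded to continuity in the Sobolev norm by the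
  majorant \<open>32 * W n\<close>, valid at all times; 32 = 2 * 8 + 2 * 8 from the square of a
  difference.\<close>

lemma C0_of_modes:
  assumes X: "\<And>r. 0 \<le> r \<Longrightarrow> X r \<in> sobolev0 \<sigma>" and x: "\<And>n r. 0 \<le> r \<Longrightarrow> pos_coeff (X r) n = x n r"
    and b: "\<And>n r. 0 \<le> r \<Longrightarrow> freq n powr (2 * \<sigma>) * (cmod (x n r))\<^sup>2 \<le> 8 * W n"
    and lim: "\<And>n t. t \<in> {0..T} \<Longrightarrow> (x n \<longlongrightarrow> x n t) (at t within {0..T})"
  shows "C0_sobolev T \<sigma> X"
  unfolding C0_sobolev_def
proof (intro ballI conjI)
  fix t assume t: "t \<in> {0..T}"
  then have t0: "0 \<le> t" by simp
  show "X t \<in> sobolev \<sigma>" using X[OF t0] by (simp add: sobolev0_def)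
  have pc: "fourier_coeff (\<lambda>y. X r y - X t y) 0 = 0" "pos_coeff (\<lambda>y. X r y - X t y) n = x n r - x n t" if "0 \<le> r" for r n
    using X[OF that] X[OF t0] x[OF that] x[OF t0] by (simp_all add: sobolev0_iff fourier_coeff_diff del: of_nat_Suc)
  have ev: "\<forall>\<^sub>F r in at t within {0..T}. 0 \<le> r" by (simp add: eventually_at_filter)
  show "((\<lambda>r. full_norm \<sigma> (\<lambda>y. X r y - X t y)) \<longlongrightarrow> 0) (at t within {0..T})"
  proof (rule full_norm_tendsto_zero[where M="\<lambda>n. 32 * W n"])
    show "\<forall>\<^sub>F r in at t within {0..T}. fourier_coeff (\<lambda>y. X r y - X t y) 0 = 0 \<and> (\<forall>n. sob_term \<sigma> (\<lambda>y. X r y - X t y) n \<le> 32 * W n)"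
      using ev
    proof eventually_elim
      case (elim r)
      show ?case unfolding sob_term_def pc(2)[OF elim]
        using pc(1)[OF elim] sob_weight_diff[OF b[OF elim] b[OF t0]] by blast
    qed
    show "summable (\<lambda>n. 32 * W n)" by (intro summable_mult W_summable)
    show "((\<lambda>r. pos_coeff (\<lambda>y. X r y - X t y) n) \<longlongrightarrow> 0) (at t within {0..T})" for n
    proof (rule Lim_transform_eventually)
      show "((\<lambda>r. x n r - x n t) \<longlongrightarrow> 0) (at t within {0..T})"
        using lim[OF t] by (simp add: LIM_zero_iff)
      show "\<forall>\<^sub>F r in at t within {0..T}. x n r - x n t = pos_coeff (\<lambda>y. X r y - X t y) n"
        using ev by eventually_elim (simp only: pc(2))
    qed
  qed
qed

lemma C0_U: "C0_sobolev T s U"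
  by (rule C0_of_modes[OF UV_sobolev0(1) UV(3) sob_bounds(2) u_tendsto])

lemma C0_V: "C0_sobolev T (s - 1) V"
  by (rule C0_of_modes[OF UV_sobolev0(2) UV(6) sob_bounds(3) v_tendsto])

lemma v_le: "0 \<le> t \<Longrightarrow> cmod (v n t) \<le> sqrt (8 * B n / freq n)"
  using mode_bounds(2)[of t n] freq_pos[of n] by (intro real_le_rsqrt) (simp add: field_simps)

text \<open>By the mean value inequality a difference quotient of \<open>u n\<close> is bounded by
  the largest modulus of \<open>v n\<close>, and so it has the same majorant as the time
  derivative.\<close>

lemma difference_quotient_bound:
  assumes r: "0 \<le> r" and t: "0 \<le> t" and ne: "r \<noteq> t"
  shows "freq n powr (2 * (s - 1)) * (cmod (complex_of_real (inverse (r - t)) * (u n r - u n t)))\<^sup>2 \<le> 8 * W n"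
proof -
  have "cmod (u n r - u n t) \<le> sqrt (8 * B n / freq n) * norm (r - t)"
  proof (rule differentiable_bound[where S="{0..}" and f'="\<lambda>x h. h *\<^sub>R v n x"])
    show "(u n has_derivative (\<lambda>h. h *\<^sub>R v n x)) (at x within {0..})" if "x \<in> {0..}" for x
      using u_deriv[of x n] that by (simp add: has_vector_derivative_def)
    show "onorm (\<lambda>h. h *\<^sub>R v n x) \<le> sqrt (8 * B n / freq n)" if "x \<in> {0..}" for x
      using mult_left_mono[OF v_le[of x n] abs_ge_zero] that by (intro onorm_le) (simp add: mult.commute)
  qed (use r t in auto)
  then have "cmod (u n r - u n t) / \<bar>r - t\<bar> \<le> sqrt (8 * B n / freq n)"
    using ne by (subst pos_divide_le_eq) auto
  moreover have "cmod (complex_of_real (inverse y) * d) = cmod d / \<bar>y\<bar>" for y d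
    by (simp add: norm_mult norm_inverse divide_inverse mult.commute)
  ultimately have "cmod (complex_of_real (inverse (r - t)) * (u n r - u n t)) \<le> sqrt (8 * B n / freq n)"
    by (simp only:)
  then have "(cmod (complex_of_real (inverse (r - t)) * (u n r - u n t)))\<^sup>2 \<le> (sqrt (8 * B n / freq n))\<^sup>2"
    by (intro power_mono) auto
  also have "\<dots> = 8 * B n / freq n" using B_nonneg[of n] freq_pos[of n] by simp
  finally have "freq n powr (2 * (s - 1)) * (cmod (complex_of_real (inverse (r - t)) * (u n r - u n t)))\<^sup>2 \<le> freq n powr (2 * (s - 1)) * (8 * B n / freq n)"
    by (intro mult_left_mono) auto
  also have "\<dots> = 8 * W n" unfolding freq_powr_split[of n s] W_def using freq_pos[of n] by simp
  finally show ?thesis .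
qed

lemma time_deriv: "has_time_deriv T (s - 1) U V"
  unfolding has_time_deriv_def
proof (intro ballI conjI)
  fix t assume t: "t \<in> {0..T}"
  then have t0: "0 \<le> t" by simp
  show "V t \<in> sobolev (s - 1)" using UV_sobolev0(2)[OF t0] by (simp add: sobolev0_def)
  show "U t \<in> sobolev (s - 1)"
    using UV_sobolev0(1)[OF t0] by (auto simp: sobolev0_iff sobolev_iff intro: sob_term_summable_mono[of "s - 1" s])
  have eq: "(\<lambda>x. (U r x - U t x) / (r - t) - V t x) = (\<lambda>x. inverse (r - t) * (U r x - U t x) - V t x)" for r
    by (simp add: divide_inverse mult.commute)
  have pc: "fourier_coeff (\<lambda>x. inverse (r - t) * (U r x - U t x) - V t x) 0 = 0"
    "pos_coeff (\<lambda>x. inverse (r - t) * (U r x - U t x) - V t x) n = inverse (r - t) * (u n r - u n t) - v n t" if "r \<in> {0..T}" for r n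
    using that t UV[of r] UV[of t]
    by (simp_all add: fourier_coeff_diff L2_circle_cmult L2_circle_diff fourier_coeff_cmult del: of_nat_Suc)
  have ev: "\<forall>\<^sub>F r in at t within {0..T}. r \<in> {0..T} \<and> r \<noteq> t" by (simp add: eventually_at_filter)
  show "((\<lambda>r. full_norm (s - 1) (\<lambda>x. (U r x - U t x) / (r - t) - V t x)) \<longlongrightarrow> 0) (at t within {0..T})"
    unfolding eq
  proof (rule full_norm_tendsto_zero[where M="\<lambda>n. 32 * W n"])
    show "\<forall>\<^sub>F r in at t within {0..T}. fourier_coeff (\<lambda>x. inverse (r - t) * (U r x - U t x) - V t x) 0 = 0
        \<and> (\<forall>n. sob_term (s - 1) (\<lambda>x. inverse (r - t) * (U r x - U t x) - V t x) n \<le> 32 * W n)"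
      using ev
    proof eventually_elim
      case (elim r)
      then have r: "r \<in> {0..T}" and r0: "0 \<le> r" and ne: "r \<noteq> t" by auto
      show ?case unfolding sob_term_def pc(2)[OF r]
        using pc(1)[OF r] sob_weight_diff[OF difference_quotient_bound[OF r0 t0 ne] sob_bounds(3)[OF t0]] by blast
    qed
    show "summable (\<lambda>n. 32 * W n)" by (intro summable_mult W_summable)
    show "((\<lambda>r. pos_coeff (\<lambda>x. inverse (r - t) * (U r x - U t x) - V t x) n) \<longlongrightarrow> 0) (at t within {0..T})" for n
    proof (rule Lim_transform_eventually)
      have "(u n has_vector_derivative v n t) (at t within {0..T})"
        by (rule has_vector_derivative_within_subset[OF u_deriv[OF t0]]) auto
      then have "((\<lambda>r. norm ((u n r - u n t) - (r - t) *\<^sub>R v n t) / norm (r - t)) \<longlongrightarrow> 0) (at t within {0..T})"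
        unfolding has_vector_derivative_def has_derivative_iff_norm by blast
      moreover have "\<forall>\<^sub>F r in at t within {0..T}. norm ((u n r - u n t) - (r - t) *\<^sub>R v n t) / norm (r - t) = norm (inverse (r - t) * (u n r - u n t) - v n t)"
        using ev
      proof eventually_elim
        case (elim r)
        have "norm (A - x *\<^sub>R b) / norm x = norm (complex_of_real (inverse x) * A - b)" if "x \<noteq> 0" for x :: real and A b
        proof -
          have "complex_of_real (inverse x) * A - b = complex_of_real (inverse x) * (A - x *\<^sub>R b)"
            using that by (simp add: scaleR_conv_of_real right_diff_distrib)
          then show ?thesis by (simp add: norm_mult norm_inverse divide_inverse mult.commute)
        qed
        from this[of "r - t"] elim show ?case unfolding right_minus_eq by blast
      qed
      ultimately have "((\<lambda>r. norm (complex_of_real (inverse (r - t)) * (u n r - u n t) - v n t)) \<longlongrightarrow> 0) (at t within {0..T})"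
        by (rule Lim_transform_eventually)
      then show "((\<lambda>r. complex_of_real (inverse (r - t)) * (u n r - u n t) - v n t) \<longlongrightarrow> 0) (at t within {0..T})"
        by (rule tendsto_norm_zero_cancel)
      show "\<forall>\<^sub>F r in at t within {0..T}. complex_of_real (inverse (r - t)) * (u n r - u n t) - v n t
          = pos_coeff (\<lambda>x. inverse (r - t) * (U r x - U t x) - V t x) n"
        using ev by eventually_elim (simp only: pc(2))
    qed
  qed
qed

lemma weak_equation:
  assumes \<phi>: "\<phi> \<in> test_functions" and t: "t \<in> {0..T}"
  shows "((\<lambda>r. circle_pairing (V r) \<phi>) has_real_derivative (a t)\<^sup>2 * circle_pairing (U t) (deriv (deriv \<phi>))) (at t within {0..T})"
proof -
  define f where "f n = pos_coeff \<phi> n" for n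
  \<comment> \<open>Decay of order 4: two powers absorb the factor \<open>(freq n)\<^sup>2\<close>
    of the equation, and the other two make the differentiated series summable.\<close>
  obtain D where D: "\<And>n. freq n ^ 4 * cmod (f n) \<le> D"
    using test_coeff_decay[OF \<phi>, of 4] unfolding f_def by blast
  have \<phi>L: "\<phi> \<in> L2_circle" by (rule test_function_props(4)[OF \<phi>])
  have pair: "(\<lambda>n. 2 * Re (v n r * cnj (f n))) sums circle_pairing (V r) \<phi>" if "0 \<le> r" for r
    using circle_pairing_sums[OF UV(4)[OF that] \<phi>L] unfolding UV(6)[OF that] UV(5)[OF that] f_def by simp
  define K where "K = sqrt (8 * suminf B)"
  have u_le: "cmod (u n r) \<le> K" if "0 \<le> r" for n r
  proof -
    have "B n \<le> suminf B" using sum_le_suminf[OF B_summable, of "{n}"] B_nonneg by simp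
    then show ?thesis using mode_bounds(3)[OF that, of n] unfolding K_def by (intro real_le_rsqrt) simp
  qed
  have K0: "0 \<le> K" using u_le[of 0 0] norm_ge_zero[of "u 0 0"] by linarith
  define f' where "f' n r = 2 * Re ((- ((a r)\<^sup>2 * (freq n)\<^sup>2)) *\<^sub>R u n r * cnj (f n))" for n r
  have "summable (\<lambda>n. inverse ((real n)\<^sup>2))" by (rule inverse_power_summable) simp
  then have "summable (\<lambda>n. inverse ((real (Suc n))\<^sup>2))" by (subst summable_Suc_iff)
  then have Ms: "summable (\<lambda>n. 8 * K * D * inverse ((real (Suc n))\<^sup>2))" by (rule summable_mult)
  have "((\<lambda>r. \<Sum>n. 2 * Re (v n r * cnj (f n))) has_real_derivative (\<Sum>n. f' n t)) (at t within {0..T})"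
  proof (rule has_real_derivative_suminf[where M="\<lambda>n. 8 * K * D * inverse ((real (Suc n))\<^sup>2)"])
    show "((\<lambda>r. 2 * Re (v n r * cnj (f n))) has_real_derivative f' n y) (at y within {0..T})" if y: "y \<in> {0..T}" for n y
    proof -
      have "(v n has_vector_derivative (- ((a y)\<^sup>2 * (freq n)\<^sup>2)) *\<^sub>R u n y) (at y within {0..T})"
        by (rule has_vector_derivative_within_subset[OF v_deriv]) (use y in auto)
      from bounded_linear.has_vector_derivative[OF bounded_linear_Re has_vector_derivative_mult_left[OF this, of "cnj (f n)"]]
      show ?thesis unfolding f'_def has_real_derivative_iff_has_vector_derivative[symmetric] by (rule DERIV_cmult)
    qed
    show "\<bar>f' n y\<bar> \<le> 8 * K * D * inverse ((real (Suc n))\<^sup>2)" if y: "y \<in> {0..T}" for n y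
    proof -
      have y0: "0 \<le> y" using y by simp
      have "\<bar>f' n y\<bar> \<le> 2 * cmod ((- ((a y)\<^sup>2 * (freq n)\<^sup>2)) *\<^sub>R u n y * cnj (f n))"
        unfolding f'_def using abs_Re_le_cmod by (simp only: abs_mult abs_numeral mult_le_cancel_left_pos zero_less_numeral)
      also have "\<dots> = 2 * (a y)\<^sup>2 * cmod (u n y) * ((freq n)\<^sup>2 * cmod (f n))" by (simp add: norm_mult abs_mult)
      also have "\<dots> \<le> 2 * 2\<^sup>2 * K * (D * inverse ((freq n)\<^sup>2))"
      proof (rule mult_mono)
        have "(a y)\<^sup>2 \<le> 2\<^sup>2" using a_bounds[OF y0] by (intro power_mono) auto
        then show "2 * (a y)\<^sup>2 * cmod (u n y) \<le> 2 * 2\<^sup>2 * K" by (intro mult_mono u_le y0) auto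
        have "freq n ^ 4 = (freq n)\<^sup>2 * (freq n)\<^sup>2" by (simp add: power_add[symmetric])
        then show "(freq n)\<^sup>2 * cmod (f n) \<le> D * inverse ((freq n)\<^sup>2)"
          using D[of n] freq_pos[of n] by (simp add: field_simps)
      qed (use K0 in auto)
      finally show ?thesis by (simp add: freq_def mult_ac)
    qed
    show "summable (\<lambda>n. 8 * K * D * inverse ((real (Suc n))\<^sup>2))" by (rule Ms)
    show "summable (\<lambda>n. 2 * Re (v n t * cnj (f n)))" using pair[of t] t by (auto simp: sums_iff)
  qed (use t in auto)
  moreover have "(\<Sum>n. f' n t) = (a t)\<^sup>2 * circle_pairing (U t) (deriv (deriv \<phi>))"
  proof -
    have t0: "0 \<le> t" using t by simp
    have "(\<lambda>n. (a t)\<^sup>2 * - ((freq n)\<^sup>2 * (2 * Re (u n t * cnj (f n))))) sums ((a t)\<^sup>2 * circle_pairing (U t) (deriv (deriv \<phi>)))"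
      using sums_mult[OF circle_pairing_deriv2_sums[OF UV(1)[OF t0] \<phi>]] unfolding UV(3)[OF t0] f_def .
    moreover have "(a t)\<^sup>2 * - ((freq n)\<^sup>2 * (2 * Re (u n t * cnj (f n)))) = f' n t" for n
      by (simp add: f'_def algebra_simps)
    ultimately show ?thesis by (simp add: sums_iff)
  qed
  ultimately have "((\<lambda>r. \<Sum>n. 2 * Re (v n r * cnj (f n))) has_real_derivative (a t)\<^sup>2 * circle_pairing (U t) (deriv (deriv \<phi>))) (at t within {0..T})"
    by simp
  then show ?thesis
    by (rule has_field_derivative_transform_within[where d=1]) (use t pair in \<open>auto simp: sums_iff\<close>)
qed

section \<open>The solution property, uniqueness and the choice of constants\<close>

lemma AE_eq_of_coeffs:
  assumes "f \<in> L2_circle" "g \<in> L2_circle" "fourier_coeff f 0 = fourier_coeff g 0" "\<And>n. pos_coeff f n = pos_coeff g n"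
  shows "AE x in lborel. f x = g x"
proof (rule fourier_coeff_eq_imp_AE[OF assms(1,2)])
  show "fourier_coeff f (int n) = fourier_coeff g (int n)" for n
    using assms(3,4) by (cases n) (auto simp del: of_nat_Suc)
qed

lemma solution: "kirchhoff_solution c s u0 v0 T U V"
  unfolding kirchhoff_solution_def
proof (intro conjI ballI)
  have L: "u0 \<in> L2_circle" "v0 \<in> L2_circle" "fourier_coeff u0 0 = 0" "fourier_coeff v0 0 = 0"
    using u0 v0 by (auto simp: sobolev0_iff)
  show "AE x in lborel. U 0 x = u0 x" "AE x in lborel. V 0 x = v0 x"
    by (rule AE_eq_of_coeffs; use UV[of 0] L u_init v_init in \<open>simp del: of_nat_Suc\<close>)+
  show "1 + c * dirichlet_energy (U t) \<noteq> 0" if "t \<in> {0..T}" for t using dirichlet_U(2)[of t] that by simp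
  show "((\<lambda>r. circle_pairing (V r) \<phi>) has_real_derivative
       (1 / (1 + c * dirichlet_energy (U t)))\<^sup>2 * circle_pairing (U t) (deriv (deriv \<phi>))) (at t within {0..T})"
    if "\<phi> \<in> test_functions" "t \<in> {0..T}" for \<phi> t
    using weak_equation[OF that] dirichlet_U(3)[of t] that(2) by simp
qed (rule C0_U time_deriv C0_V)+

text \<open>The competitor is compared coefficient by coefficient. It lies in
  \<open>sobolev s\<close> only, so its mean has to be shown to vanish; the other modes fall under
  \<open>kirchhoff_modes_unique\<close>, whose bounds come from compactness of the time
  interval.\<close>

lemma unique:
  assumes sol: "kirchhoff_solution c s u0 v0 T u' v'" and t: "t \<in> {0..T}"
  shows "AE x in lborel. u' t x = U t x"
proof -
  have C0: "C0_sobolev T s u'" "C0_sobolev T (s - 1) v'" and td: "has_time_deriv T (s - 1) u' v'"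
    and ini: "AE x in lborel. u' 0 x = u0 x" "AE x in lborel. v' 0 x = v0 x"
    and nz: "\<And>r. r \<in> {0..T} \<Longrightarrow> 1 + c * dirichlet_energy (u' r) \<noteq> 0"
    using sol by (auto simp: kirchhoff_solution_def)
  have sob: "u' r \<in> L2_circle" "summable (sob_term s (u' r))" "v' r \<in> L2_circle" "summable (sob_term (s - 1) (v' r))"
    if "r \<in> {0..T}" for r
    using C0 that by (auto simp: C0_sobolev_def sobolev_iff)
  have T0: "0 \<in> {0..T}" using T by simp
  have L: "u0 \<in> L2_circle" "v0 \<in> L2_circle" "fourier_coeff u0 0 = 0" "fourier_coeff v0 0 = 0"
    using u0 v0 by (auto simp: sobolev0_iff)
  have ini': "fourier_coeff (u' 0) k = fourier_coeff u0 k" "fourier_coeff (v' 0) k = fourier_coeff v0 k" for k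
    by (rule fourier_coeff_cong_AE[OF ini(1)] fourier_coeff_cong_AE[OF ini(2)]; use sob[OF T0] L in \<open>auto dest: L2_circleD\<close>)+
  have s1: "0 \<le> s - 1" using s by simp
  have du: "((\<lambda>r. fourier_coeff (u' r) (int j)) has_vector_derivative fourier_coeff (v' r) (int j)) (at r within {0..T})"
    if "r \<in> {0..T}" for r j
    by (rule has_time_deriv_coeff[OF td s1 that])
  \<comment> \<open>At frequency 0 the equation says that the mean of \<open>v'\<close> is constant.
    It vanishes initially, and then the mean of \<open>u'\<close> is constant too.\<close>
  have v_zero: "fourier_coeff (v' r) 0 = 0" if r: "r \<in> {0..T}" for r
  proof -
    have d: "((\<lambda>r. fourier_coeff (v' r) 0) has_vector_derivative 0) (at x within {0..T})" if "x \<in> {0..T}" for x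
      using kirchhoff_coeff_deriv[OF sol that, of 0] by simp
    obtain z where z: "\<And>x. x \<in> {0..T} \<Longrightarrow> fourier_coeff (v' x) 0 = z"
      by (rule has_vector_derivative_zero_constant[OF convex_real_interval(5)[of 0 T] d]) blast+
    show ?thesis using z[OF r] z[OF T0] ini'(2)[of 0] L(4) by simp
  qed
  have u_zero: "fourier_coeff (u' r) 0 = 0" if r: "r \<in> {0..T}" for r
  proof -
    have d: "((\<lambda>r. fourier_coeff (u' r) 0) has_vector_derivative 0) (at x within {0..T})" if "x \<in> {0..T}" for x
      using du[OF that, of 0] v_zero[OF that] by simp
    obtain z where z: "\<And>x. x \<in> {0..T} \<Longrightarrow> fourier_coeff (u' x) 0 = z"
      by (rule has_vector_derivative_zero_constant[OF convex_real_interval(5)[of 0 T] d]) blast+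
    show ?thesis using z[OF r] z[OF T0] ini'(1)[of 0] L(3) by simp
  qed
  have st: "summable (sob_term \<sigma> (u' r))" if "r \<in> {0..T}" "\<sigma> \<le> s" for r \<sigma>
    by (rule sob_term_summable_mono[OF that(2) sob(2)[OF that(1)]])
  have stv: "summable (sob_term \<sigma> (v' r))" if "r \<in> {0..T}" "\<sigma> \<le> s - 1" for r \<sigma>
    by (rule sob_term_summable_mono[OF that(2) sob(4)[OF that(1)]])
  have hn: "(hom_norm \<sigma> g)\<^sup>2 = 2 * suminf (sob_term \<sigma> g)" if "summable (sob_term \<sigma> g)" for g \<sigma>
    using that by (simp add: hom_norm_eq suminf_nonneg sob_term_nonneg)
  have bounded: "\<exists>K. \<forall>r\<in>{0..T}. \<bar>g r\<bar> \<le> K" if "continuous_on {0..T} g" for g :: "real \<Rightarrow> real"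
    using compact_imp_bounded[OF compact_continuous_image[OF that compact_Icc]] unfolding bounded_iff by auto
  have de: "dirichlet_energy (u' r) = 2 * (\<Sum>n. (freq n)\<^sup>2 * (cmod (pos_coeff (u' r) n))\<^sup>2)" if r: "r \<in> {0..T}" for r
  proof (rule dirichlet_energy_eq[OF sob(1)[OF r]])
    have "summable (sob_term 1 (u' r))" by (rule st[OF r]) (use s in simp)
    then show "summable (\<lambda>n. (freq n)\<^sup>2 * (cmod (pos_coeff (u' r) n))\<^sup>2)" unfolding sob_term_powers[abs_def] .
  qed
  have deh: "dirichlet_energy (u' r) = (hom_norm 1 (u' r))\<^sup>2" if r: "r \<in> {0..T}" for r
  proof -
    have "summable (sob_term 1 (u' r))" by (rule st[OF r]) (use s in simp)
    from hn[OF this] show ?thesis unfolding de[OF r] sob_term_powers[abs_def] by simp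
  qed
  define a2 where "a2 r = 1 / (1 + c * dirichlet_energy (u' r))" for r
  have "continuous_on {0..T} (\<lambda>r. 1 / (1 + c * (hom_norm 1 (u' r))\<^sup>2))"
  proof (intro continuous_intros C0_sobolev_continuous_hom_norm[OF C0(1)])
    show "\<forall>r\<in>{0..T}. 1 + c * (hom_norm 1 (u' r))\<^sup>2 \<noteq> 0" using nz deh by simp
  qed (use s in simp)
  then obtain K1 where K1: "\<And>r. r \<in> {0..T} \<Longrightarrow> \<bar>1 / (1 + c * (hom_norm 1 (u' r))\<^sup>2)\<bar> \<le> K1" using bounded by blast
  have "continuous_on {0..T} (\<lambda>r. (hom_norm (3 / 2) (u' r))\<^sup>2 / 2)"
    by (intro continuous_intros C0_sobolev_continuous_hom_norm[OF C0(1)]) (use s in auto)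
  then obtain K2 where K2: "\<And>r. r \<in> {0..T} \<Longrightarrow> \<bar>(hom_norm (3 / 2) (u' r))\<^sup>2 / 2\<bar> \<le> K2" using bounded by blast
  have "continuous_on {0..T} (\<lambda>r. (hom_norm (1 / 2) (v' r))\<^sup>2 / 2)"
    by (intro continuous_intros C0_sobolev_continuous_hom_norm[OF C0(2)]) (use s in auto)
  then obtain K3 where K3: "\<And>r. r \<in> {0..T} \<Longrightarrow> \<bar>(hom_norm (1 / 2) (v' r))\<^sup>2 / 2\<bar> \<le> K3" using bounded by blast
  \<comment> \<open>One constant for all bounds: the derivative of the constructed speed, the
    competitor's speed, its two norms at the threshold, and the majorant of the constructed
    solution. The absolute value of \<open>M\<close> keeps every summand nonnegative.\<close>
  define K where "K = \<bar>M\<bar> + K1 + K2 + K3 + 8 * suminf B"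
  have Bnn: "0 \<le> suminf B" by (rule suminf_nonneg[OF B_summable B_nonneg])
  have Knn: "0 \<le> K1" "0 \<le> K2" "0 \<le> K3" using K1[OF T0] K2[OF T0] K3[OF T0] by linarith+
  obtain a' where a': "\<And>r. 0 \<le> r \<Longrightarrow> (a has_real_derivative a' r) (at r within {0..}) \<and> \<bar>a' r\<bar> \<le> M"
    using a_deriv by metis
  have u_eq: "u n t = pos_coeff (u' t) n" for n
  proof (rule kirchhoff_modes_unique[where T=T and M=K and c=c and ?u2.0="\<lambda>n r. pos_coeff (u' r) n" and ?v2.0="\<lambda>n r. pos_coeff (v' r) n"
        and a=a and a'=a' and ?a2.0=a2 and u=u and v=v and t=t and n=n])
    show "(u n has_vector_derivative v n r) (at r within {0..T})" if "r \<in> {0..T}" for n r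
      by (rule has_vector_derivative_within_subset[OF u_deriv]) (use that in auto)
    show "(v n has_vector_derivative (- ((a r)\<^sup>2 * (freq n)\<^sup>2)) *\<^sub>R u n r) (at r within {0..T})" if "r \<in> {0..T}" for n r
      by (rule has_vector_derivative_within_subset[OF v_deriv]) (use that in auto)
    show "((\<lambda>r. pos_coeff (u' r) n) has_vector_derivative pos_coeff (v' r) n) (at r within {0..T})" if "r \<in> {0..T}" for n r
      by (rule du[OF that])
    show "((\<lambda>r. pos_coeff (v' r) n) has_vector_derivative (- ((a2 r)\<^sup>2 * (freq n)\<^sup>2)) *\<^sub>R pos_coeff (u' r) n) (at r within {0..T})" if "r \<in> {0..T}" for n r
      using kirchhoff_coeff_deriv[OF sol that, of "int (Suc n)"] unfolding a2_def freq_def of_int_of_nat_eq .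
    show "1 / 2 \<le> a r \<and> a r \<le> 2" if "r \<in> {0..T}" for r using a_bounds that by simp
    show "(a has_real_derivative a' r) (at r within {0..T}) \<and> \<bar>a' r\<bar> \<le> K" if "r \<in> {0..T}" for r
      using a'[of r] that Knn Bnn by (auto simp: K_def intro: DERIV_subset)
    show "\<bar>a2 r\<bar> \<le> K" if "r \<in> {0..T}" for r
      using K1[OF that] Knn Bnn unfolding a2_def deh[OF that] K_def by linarith
    show "a r * (1 + 2 * c * (\<Sum>n. (freq n)\<^sup>2 * (cmod (u n r))\<^sup>2)) = 1" if "r \<in> {0..T}" for r
      using a_eq that by simp
    show "a2 r * (1 + 2 * c * (\<Sum>n. (freq n)\<^sup>2 * (cmod (pos_coeff (u' r) n))\<^sup>2)) = 1" if "r \<in> {0..T}" for r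
      using nz[OF that] unfolding a2_def de[OF that] by (simp add: mult_ac del: of_nat_Suc)
    have "summable X \<and> suminf X \<le> K" if "\<And>n. 0 \<le> X n" "\<And>n. X n \<le> 8 * B n" for X
    proof -
      have X: "summable X" by (rule summable_comparison_test'[OF summable_mult[OF B_summable, of 8], of 0]) (use that in simp)
      have "suminf X \<le> 8 * suminf B"
        unfolding suminf_mult[OF B_summable, symmetric] by (intro suminf_le that X summable_mult B_summable)
      then show ?thesis using X Knn by (simp add: K_def)
    qed
    from this[of "\<lambda>n. freq n ^ 3 * (cmod (u n _))\<^sup>2"] this[of "\<lambda>n. freq n * (cmod (v n _))\<^sup>2"]
    show "summable (\<lambda>n. freq n ^ 3 * (cmod (u n r))\<^sup>2) \<and> (\<Sum>n. freq n ^ 3 * (cmod (u n r))\<^sup>2) \<le> K"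
      "summable (\<lambda>n. freq n * (cmod (v n r))\<^sup>2) \<and> (\<Sum>n. freq n * (cmod (v n r))\<^sup>2) \<le> K" if "r \<in> {0..T}" for r
      using mode_bounds(1,2)[of r] that freq_pos by (auto simp: less_imp_le)
    show "summable (\<lambda>n. freq n ^ 3 * (cmod (pos_coeff (u' r) n))\<^sup>2) \<and> (\<Sum>n. freq n ^ 3 * (cmod (pos_coeff (u' r) n))\<^sup>2) \<le> K" if "r \<in> {0..T}" for r
    proof -
      have 1: "summable (sob_term (3 / 2) (u' r))" by (rule st[OF that s])
      then have "suminf (sob_term (3 / 2) (u' r)) \<le> K" using hn[OF 1] K2[OF that] Knn Bnn unfolding K_def by linarith
      with 1 show ?thesis unfolding sob_term_powers[abs_def] by blast
    qed
    show "summable (\<lambda>n. freq n * (cmod (pos_coeff (v' r) n))\<^sup>2) \<and> (\<Sum>n. freq n * (cmod (pos_coeff (v' r) n))\<^sup>2) \<le> K" if "r \<in> {0..T}" for r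
    proof -
      have 1: "summable (sob_term (1 / 2) (v' r))" by (rule stv[OF that]) (use s in simp)
      then have "suminf (sob_term (1 / 2) (v' r)) \<le> K" using hn[OF 1] K3[OF that] Knn Bnn unfolding K_def by linarith
      with 1 show ?thesis unfolding sob_term_powers[abs_def] by blast
    qed
    show "u n 0 = pos_coeff (u' 0) n" "v n 0 = pos_coeff (v' 0) n" for n
      unfolding ini' u_init v_init by (rule refl)+
  qed (rule t)
  have t0: "0 \<le> t" using t by simp
  show ?thesis
  proof (rule AE_eq_of_coeffs)
    show "fourier_coeff (u' t) 0 = fourier_coeff (U t) 0" unfolding u_zero[OF t] UV(2)[OF t0] ..
    show "pos_coeff (u' t) n = pos_coeff (U t) n" for n unfolding UV(3)[OF t0] u_eq ..
  qed (rule sob(1)[OF t] UV(1)[OF t0])+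
qed

lemma unique_bounded: "unique_bounded_solution c 6 s u0 v0 T"
  unfolding unique_bounded_solution_def
  using solution unique UV_sobolev0 norm_bound by (intro exI[of _ U] exI[of _ V]) auto

end

text \<open>The square of 20 yields the threshold 1/400 of the mode system. The denominator contains
  1 + |c| so that it is positive also for c = 0, and |c| \<le> (1 + |c|)^2 gives the required bound.
  The solution exists for every \<open>T\<close>.\<close>

lemma kirchhoff_global_small:
  fixes c s T :: real
  assumes s: "3 / 2 \<le> s" and u0: "u0 \<in> sobolev0 s" and v0: "v0 \<in> sobolev0 (s - 1)" and T: "0 \<le> T"
    and small: "hom_norm s u0 + hom_norm (s - 1) v0 \<le> 1 / (20 * (1 + \<bar>c\<bar>))"
  shows "unique_bounded_solution c 6 s u0 v0 T"
proof -
  have S: "summable (sob_term s u0)" "summable (sob_term (s - 1) v0)" using u0 v0 by (auto simp: sobolev0_iff)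
  have S': "summable (sob_term (3 / 2) u0)" "summable (sob_term (1 / 2) v0)"
    using sob_term_summable_mono[OF _ S(1), of "3 / 2"] sob_term_summable_mono[OF _ S(2), of "1 / 2"] s by auto
  define e where "e = hom_norm s u0 + hom_norm (s - 1) v0"
  have nn: "0 \<le> hom_norm s u0" "0 \<le> hom_norm (s - 1) v0"
    using S by (auto simp: hom_norm_eq suminf_nonneg sob_term_nonneg)
  have sq: "(hom_norm s u0)\<^sup>2 = 2 * suminf (sob_term s u0)" "(hom_norm (s - 1) v0)\<^sup>2 = 2 * suminf (sob_term (s - 1) v0)"
    using S by (auto simp: hom_norm_eq suminf_nonneg sob_term_nonneg)
  have "suminf (sob_term (3 / 2) u0) + suminf (sob_term (1 / 2) v0) \<le> suminf (sob_term s u0) + suminf (sob_term (s - 1) v0)"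
    using s by (intro add_mono suminf_le sob_term_mono S S') auto
  also have "\<dots> \<le> e\<^sup>2 / 2" using sq nn by (simp add: e_def power2_sum)
  finally have "\<bar>c\<bar> * (suminf (sob_term (3 / 2) u0) + suminf (sob_term (1 / 2) v0)) \<le> \<bar>c\<bar> * (e\<^sup>2 / 2)"
    by (rule mult_left_mono) simp
  also have "\<dots> \<le> 1 / 400"
  proof -
    have "e * (20 * (1 + \<bar>c\<bar>)) \<le> 1" using small by (simp add: e_def field_simps)
    moreover have "0 \<le> e" using nn by (simp add: e_def)
    ultimately have "(e * (20 * (1 + \<bar>c\<bar>)))\<^sup>2 \<le> 1\<^sup>2" by (intro power_mono) auto
    then have "400 * ((1 + \<bar>c\<bar>)\<^sup>2 * e\<^sup>2) \<le> 1" unfolding power_mult_distrib by (simp add: mult_ac)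
    moreover have "\<bar>c\<bar> * e\<^sup>2 \<le> (1 + \<bar>c\<bar>)\<^sup>2 * e\<^sup>2"
      by (intro mult_right_mono) (auto simp: power2_eq_square algebra_simps)
    moreover have "0 \<le> \<bar>c\<bar> * e\<^sup>2" by simp
    ultimately show ?thesis by simp
  qed
  finally have le: "\<bar>c\<bar> * ((\<Sum>n. freq n ^ 3 * (cmod (pos_coeff u0 n))\<^sup>2) + (\<Sum>n. freq n * (cmod (pos_coeff v0 n))\<^sup>2)) \<le> 1 / 400"
    unfolding sob_term_powers[abs_def] .
  show ?thesis
  proof (rule kirchhoff_modes_global[OF S'[unfolded sob_term_powers[abs_def]] le])
    fix u v :: "nat \<Rightarrow> real \<Rightarrow> complex" and a M
    assume "\<And>n. u n 0 = pos_coeff u0 n" "\<And>n. v n 0 = pos_coeff v0 n"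
      "\<And>n t. 0 \<le> t \<Longrightarrow> (u n has_vector_derivative v n t) (at t within {0..})"
      "\<And>n t. 0 \<le> t \<Longrightarrow> (v n has_vector_derivative (- ((a t)\<^sup>2 * (freq n)\<^sup>2)) *\<^sub>R u n t) (at t within {0..})"
      "\<And>t. 0 \<le> t \<Longrightarrow> 1 / 2 \<le> a t \<and> a t \<le> 2"
      "\<And>t. 0 \<le> t \<Longrightarrow> a t * (1 + 2 * c * (\<Sum>n. (freq n)\<^sup>2 * (cmod (u n t))\<^sup>2)) = 1"
      "\<And>t. 0 \<le> t \<Longrightarrow> \<exists>a'. (a has_real_derivative a') (at t within {0..}) \<and> \<bar>a'\<bar> \<le> M"
      "\<And>n t. 0 \<le> t \<Longrightarrow> freq n ^ 3 * (cmod (u n t))\<^sup>2 + freq n * (cmod (v n t))\<^sup>2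
        \<le> 8 * (freq n ^ 3 * (cmod (pos_coeff u0 n))\<^sup>2 + freq n * (cmod (pos_coeff v0 n))\<^sup>2)"
    then interpret kirchhoff_flow c s T M u0 v0 u v a
      by (intro kirchhoff_flow.intro s u0 v0 T)
    show ?thesis by (rule unique_bounded)
  qed
qed

theorem theorem1p5:
  fixes c :: real
  shows "\<exists>\<epsilon>\<^sub>0>0. \<exists>C>0. \<exists>A>0. \<exists>B>0. \<forall>s u0 v0.
     3 / 2 \<le> s \<and> s < 2 \<and> u0 \<in> sobolev0 s \<and> v0 \<in> sobolev0 (s - 1)
       \<and> hom_norm s u0 + hom_norm (s - 1) v0 \<le> \<epsilon>\<^sub>0 \<longrightarrow>
     (hom_norm s u0 + hom_norm (s - 1) v0 \<noteq> 0 \<longrightarrow>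
        (\<exists>T. A * (hom_norm s u0 + hom_norm (s - 1) v0) powi (- 6) \<le> T
           \<and> T \<le> B * (hom_norm s u0 + hom_norm (s - 1) v0) powi (- 6)
           \<and> unique_bounded_solution c C s u0 v0 T))
     \<and> (hom_norm s u0 + hom_norm (s - 1) v0 = 0 \<longrightarrow>
        (\<forall>T>0. unique_bounded_solution c C s u0 v0 T))"
proof -
  \<comment> \<open>As the lifespan is free, it is set equal to the power -6 of the size of the
    data, so both comparison constants are 1.\<close>
  have "\<forall>s u0 v0.
     3 / 2 \<le> s \<and> s < 2 \<and> u0 \<in> sobolev0 s \<and> v0 \<in> sobolev0 (s - 1)
       \<and> hom_norm s u0 + hom_norm (s - 1) v0 \<le> 1 / (20 * (1 + \<bar>c\<bar>)) \<longrightarrow>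
     (hom_norm s u0 + hom_norm (s - 1) v0 \<noteq> 0 \<longrightarrow>
        (\<exists>T. 1 * (hom_norm s u0 + hom_norm (s - 1) v0) powi (- 6) \<le> T
           \<and> T \<le> 1 * (hom_norm s u0 + hom_norm (s - 1) v0) powi (- 6)
           \<and> unique_bounded_solution c 6 s u0 v0 T))
     \<and> (hom_norm s u0 + hom_norm (s - 1) v0 = 0 \<longrightarrow>
        (\<forall>T>0. unique_bounded_solution c 6 s u0 v0 T))"
  proof (intro conjI allI impI; (elim conjE)?)
    fix s :: real and u0 v0 :: "real \<Rightarrow> real"
    assume *: "3 / 2 \<le> s" "u0 \<in> sobolev0 s" "v0 \<in> sobolev0 (s - 1)"
      "hom_norm s u0 + hom_norm (s - 1) v0 \<le> 1 / (20 * (1 + \<bar>c\<bar>))"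
    show "\<exists>T. 1 * (hom_norm s u0 + hom_norm (s - 1) v0) powi (- 6) \<le> T
           \<and> T \<le> 1 * (hom_norm s u0 + hom_norm (s - 1) v0) powi (- 6)
           \<and> unique_bounded_solution c 6 s u0 v0 T"
      using kirchhoff_global_small[OF *(1-3) _ *(4)]
      by (intro exI[of _ "(hom_norm s u0 + hom_norm (s - 1) v0) powi (- 6)"]) (auto simp: power_int_minus)
    show "unique_bounded_solution c 6 s u0 v0 T" if "0 < T" for T
      using kirchhoff_global_small[OF *(1-3) _ *(4)] that by simp
  qed
  moreover have "0 < 1 / (20 * (1 + \<bar>c\<bar>))" by (simp add: add_pos_nonneg)
  moreover have "0 < (6::real)" "0 < (1::real)" by simp_all
  ultimately show ?thesis by blast
qed

end
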